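(* Suppose that $u\in C([0,T];W_0^{1,\infty}(\Omega))$, that the nodal points of the finite element spaces $\Psi_h^0,\dots,\Psi_h^{N_T}$ are given by a moving mesh, and that $\Delta t\,|u|_{C(W^{1,\infty})}\le1/8$. Let $F\in H^1(0,T;\Psi')$ be given. For a given $\phi_h^0\in\Psi_h^0$, let $\{\phi_h^n\}_{n=1}^{N_T}$, $\phi_h^n\in\Psi_h^n$, be the numerical solution of the second-order scheme $$\left(\frac{\phi_h^1-(\phi_h^{0}\circ X_1^1)\gamma^1}{\Delta t},\psi_h\right)+\nu(\nabla\phi_h^1,\nabla\psi_h)=\langle F^1,\psi_h\rangle\qquad\forall\psi_h\in\Psi_h^1,$$ $$\left(\frac{3\phi_h^n-4(\phi_h^{n-1}\circ X_1^n)\gamma^n+(\phi_h^{n-2}\circ\tilde X_1^n)\tilde\gamma^n}{2\Delta t},\psi_h\right)+\nu(\nabla\phi_h^n,\nabla\psi_h)=\langle F^n,\psi_h\rangle\qquad\forall\psi_h\in\Psi_h^n,\quad n=2,\dots,N_T.$$ Then there exists a constant $C>0$ independent of $h$ and $\Delta t$ (and of $\phi_h$) such that $$\|\phi_h\|_{\ell^\infty(L^2)}+\sqrt{\nu}\,\|\nabla\phi_h\|_{\ell^2(L^2)}\le C\left(\|\phi_h^0\|+\|F\|_{\ell^2(\Psi_h')}\right).$$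
   Context: $\Omega=(a,b)$ is a bounded interval, $\Gamma=\{a,b\}$, $T>0$, $\nu>0$. $(\cdot,\cdot)$ and $\|\cdot\|$ are the inner product and norm of $L^2(\Omega)$, $\nabla=\partial_x$, $\Psi=H^1(\Omega)$ with dual $\Psi'$. $F(t)\in\Psi'$ is the functional $\langle F(t),\psi\rangle=(f(t),\psi)+\int_\Gamma g(t)\psi\,ds$ for given $f:\Omega\times(0,T)\to\mathbb{R}$, $g:\Gamma\times(0,T)\to\mathbb{R}$ with $f(t)\in L^2(\Omega)$, $g(t)\in L^2(\Gamma)$. $W_0^{1,\infty}(\Omega)$ consists of the $W^{1,\infty}(\Omega)$ functions vanishing at $a,b$, and $|u|_{C(W^{1,\infty})}=\sup_{t\in[0,T]}\|\partial_xu(\cdot,t)\|_{L^\infty(\Omega)}$. $\Delta t>0$, $t^n=n\Delta t$, $N_T=\lfloor T/\Delta t\rfloor$, $\rho^n=\rho(\cdot,t^n)$, $F^n=F(t^n)$. A moving mesh is a set of points $\{P_i^n: i=1,\dots,N_p,\ n=0,\dots,N_T\}\subset\bar\Omega$ with $a=P_1^n<\dots<P_{N_p}^n=b$ for every $n$; $h=\max_n\max_i(P_{i+1}^n-P_i^n)$. $\Psi_h^n\subset\Psi$ is the space of continuous functions on $\bar\Omega$ that are affine on each $[P_i^n,P_{i+1}^n]$, equipped with the $H^1(\Omega)$ norm, and $(\Psi_h^n)'$ is its dual. The upwind maps are $X_1^n(x)=x-u^n(x)\Delta t$ and $\tilde X_1^n(x)=x-2u^n(x)\Delta t$, with Jacobians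 $\gamma^n(x)=\partial_xX_1^n(x)$ and $\tilde\gamma^n(x)=\partial_x\tilde X_1^n(x)$. Discrete norms: $\|\rho\|_{\ell^\infty(L^2)}=\max_{n=1,\dots,N_T}\|\rho^n\|$, $\|\rho\|_{\ell^2(L^2)}=\bigl(\Delta t\sum_{n=1}^{N_T}\|\rho^n\|^2\bigr)^{1/2}$, $\|F\|_{\ell^2(\Psi_h')}=\bigl(\Delta t\sum_{n=1}^{N_T}\|F^n\|^2_{(\Psi_h^n)'}\bigr)^{1/2}$. *)

theory Defs
  imports "HOL-Analysis.Analysis" "HOL-Probability.Essential_Supremum"
begin

section \<open>Function spaces on an interval\<close>

text \<open>
  Functions on an interval are total functions on the reals; values outside the closed
  interval are irrelevant for everything below.
\<close>

definition L2_inner :: "real \<Rightarrow> real \<Rightarrow> (real \<Rightarrow> real) \<Rightarrow> (real \<Rightarrow> real) \<Rightarrow> real" where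
  "L2_inner a b v w = (LINT x|lebesgue_on {a<..<b}. v x * w x)"

definition L2_norm :: "real \<Rightarrow> real \<Rightarrow> (real \<Rightarrow> real) \<Rightarrow> real" where
  "L2_norm a b v = sqrt (L2_inner a b v v)"

definition L2_space :: "real \<Rightarrow> real \<Rightarrow> (real \<Rightarrow> real) set" where
  "L2_space a b = {v. v \<in> borel_measurable (lebesgue_on {a<..<b}) \<and>
                      integrable (lebesgue_on {a<..<b}) (\<lambda>x. (v x)\<^sup>2)}"

definition Linf_esssup :: "real \<Rightarrow> real \<Rightarrow> (real \<Rightarrow> real) \<Rightarrow> ereal" where
  "Linf_esssup a b v = esssup (lebesgue_on {a<..<b}) (\<lambda>x. ereal \<bar>v x\<bar>)"

definition Linf_space :: "real \<Rightarrow> real \<Rightarrow> (real \<Rightarrow> real) set" where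
  "Linf_space a b = {v. v \<in> borel_measurable (lebesgue_on {a<..<b}) \<and> Linf_esssup a b v < \<infinity>}"

definition Linf_norm :: "real \<Rightarrow> real \<Rightarrow> (real \<Rightarrow> real) \<Rightarrow> real" where
  "Linf_norm a b v = real_of_ereal (Linf_esssup a b v)"

definition test_functions :: "real \<Rightarrow> real \<Rightarrow> (real \<Rightarrow> real) set" where
  "test_functions a b =
     {\<eta>. (\<forall>k x. ((deriv ^^ k) \<eta>) differentiable (at x)) \<and>
          (\<exists>c d. a < c \<and> d < b \<and> (\<forall>x. \<eta> x \<noteq> 0 \<longrightarrow> c \<le> x \<and> x \<le> d))}"

definition locally_integrable :: "real \<Rightarrow> real \<Rightarrow> (real \<Rightarrow> real) \<Rightarrow> bool" where
  "locally_integrable a b v \<longleftrightarrow> (\<forall>c d. a < c \<and> d < b \<longrightarrow> set_integrable lebesgue {c..d} v)"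

definition has_weak_deriv :: "real \<Rightarrow> real \<Rightarrow> (real \<Rightarrow> real) \<Rightarrow> (real \<Rightarrow> real) \<Rightarrow> bool" where
  "has_weak_deriv a b v w \<longleftrightarrow>
     locally_integrable a b v \<and> locally_integrable a b w \<and>
     (\<forall>\<eta>\<in>test_functions a b.
        (LINT x|lebesgue_on {a<..<b}. v x * deriv \<eta> x) =
        - (LINT x|lebesgue_on {a<..<b}. w x * \<eta> x))"

text \<open>
  The weak derivative is unique only up to null sets; \<open>wderiv\<close> picks one representative. It is
  only used under integrals and essential suprema, where the choice does not matter.
\<close>

definition wderiv :: "real \<Rightarrow> real \<Rightarrow> (real \<Rightarrow> real) \<Rightarrow> (real \<Rightarrow> real)" where
  "wderiv a b v = (SOME w. has_weak_deriv a b v w)"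

text \<open>
  Elements of \<open>H\<^sup>1\<close> and \<open>W\<^sup>1\<^sup>,\<^sup>\<infinity>\<close> are represented by their continuous representative on the
  closed interval, so that boundary values and compositions are meaningful.
\<close>

definition H1_space :: "real \<Rightarrow> real \<Rightarrow> (real \<Rightarrow> real) set" where
  "H1_space a b = {v \<in> L2_space a b. continuous_on {a..b} v \<and>
                      (\<exists>w\<in>L2_space a b. has_weak_deriv a b v w)}"

definition H1_norm :: "real \<Rightarrow> real \<Rightarrow> (real \<Rightarrow> real) \<Rightarrow> real" where
  "H1_norm a b v = sqrt ((L2_norm a b v)\<^sup>2 + (L2_norm a b (wderiv a b v))\<^sup>2)"

definition W1inf_space :: "real \<Rightarrow> real \<Rightarrow> (real \<Rightarrow> real) set" where
  "W1inf_space a b = {v \<in> Linf_space a b. continuous_on {a..b} v \<and>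
                         (\<exists>w\<in>Linf_space a b. has_weak_deriv a b v w)}"

definition W1inf_norm :: "real \<Rightarrow> real \<Rightarrow> (real \<Rightarrow> real) \<Rightarrow> real" where
  "W1inf_norm a b v = max (Linf_norm a b v) (Linf_norm a b (wderiv a b v))"

definition W01inf_space :: "real \<Rightarrow> real \<Rightarrow> (real \<Rightarrow> real) set" where
  "W01inf_space a b = {v \<in> W1inf_space a b. v a = 0 \<and> v b = 0}"

definition C_W01inf :: "real \<Rightarrow> real \<Rightarrow> real \<Rightarrow> (real \<Rightarrow> real \<Rightarrow> real) set" where
  "C_W01inf a b T = {u. \<forall>t\<in>{0..T}. u t \<in> W01inf_space a b \<and>
     ((\<lambda>s. W1inf_norm a b (\<lambda>x. u s x - u t x)) \<longlongrightarrow> 0) (at t within {0..T})}"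

definition C_W1inf_seminorm :: "real \<Rightarrow> real \<Rightarrow> real \<Rightarrow> (real \<Rightarrow> real \<Rightarrow> real) \<Rightarrow> real" where
  "C_W1inf_seminorm a b T u = (SUP t\<in>{0..T}. Linf_norm a b (wderiv a b (u t)))"


section \<open>The dual of \<open>H\<^sup>1\<close> and Bochner spaces with values in it\<close>

text \<open>
  Functionals are total maps on functions; only their values on \<open>H\<^sup>1\<close> matter.
\<close>

definition H1_dual :: "real \<Rightarrow> real \<Rightarrow> ((real \<Rightarrow> real) \<Rightarrow> real) set" where
  "H1_dual a b =
     {L. (\<forall>\<psi>\<in>H1_space a b. \<forall>\<psi>'\<in>H1_space a b. \<forall>c d.
            L (\<lambda>x. c * \<psi> x + d * \<psi>' x) = c * L \<psi> + d * L \<psi>') \<and>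
         (\<exists>M. \<forall>\<psi>\<in>H1_space a b. \<bar>L \<psi>\<bar> \<le> M * H1_norm a b \<psi>)}"

definition dual_norm ::
    "real \<Rightarrow> real \<Rightarrow> (real \<Rightarrow> real) set \<Rightarrow> ((real \<Rightarrow> real) \<Rightarrow> real) \<Rightarrow> real" where
  "dual_norm a b V L = (SUP \<psi>\<in>{\<psi>\<in>V. H1_norm a b \<psi> \<le> 1}. \<bar>L \<psi>\<bar>)"

definition strongly_measurable_dual ::
    "real \<Rightarrow> real \<Rightarrow> real \<Rightarrow> (real \<Rightarrow> (real \<Rightarrow> real) \<Rightarrow> real) \<Rightarrow> bool" where
  "strongly_measurable_dual a b T F \<longleftrightarrow>
     (\<exists>S :: nat \<Rightarrow> real \<Rightarrow> (real \<Rightarrow> real) \<Rightarrow> real.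
        (\<forall>k. simple_function (lebesgue_on {0<..<T}) (S k)) \<and>
        (\<forall>k. \<forall>t\<in>{0<..<T}. S k t \<in> H1_dual a b) \<and>
        (AE t in lebesgue_on {0<..<T}.
           (\<lambda>k. dual_norm a b (H1_space a b) (\<lambda>\<psi>. S k t \<psi> - F t \<psi>)) \<longlonglongrightarrow> 0))"

definition L2_time_dual ::
    "real \<Rightarrow> real \<Rightarrow> real \<Rightarrow> (real \<Rightarrow> (real \<Rightarrow> real) \<Rightarrow> real) set" where
  "L2_time_dual a b T =
     {F. (\<forall>t\<in>{0<..<T}. F t \<in> H1_dual a b) \<and> strongly_measurable_dual a b T F \<and>
         integrable (lebesgue_on {0<..<T}) (\<lambda>t. (dual_norm a b (H1_space a b) (F t))\<^sup>2)}"

text \<open>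
  The space \<open>H\<^sup>1(0,T;\<Psi>')\<close>. Members are the representatives that are continuous on \<open>[0,T]\<close>, so
  that point values, in particular at the end point \<open>T\<close>, are meaningful. The identity defining
  the weak time derivative is an equation between Bochner integrals in \<open>\<Psi>'\<close>; it is written out
  by evaluation at every \<open>\<psi>\<close>, which commutes with the Bochner integral.
\<close>

definition H1_time_dual ::
    "real \<Rightarrow> real \<Rightarrow> real \<Rightarrow> (real \<Rightarrow> (real \<Rightarrow> real) \<Rightarrow> real) set" where
  "H1_time_dual a b T =
     {F \<in> L2_time_dual a b T.
        (\<forall>t\<in>{0..T}. F t \<in> H1_dual a b \<and>
           ((\<lambda>s. dual_norm a b (H1_space a b) (\<lambda>\<psi>. F s \<psi> - F t \<psi>)) \<longlongrightarrow> 0) (at t within {0..T})) \<and>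
        (\<exists>G\<in>L2_time_dual a b T. \<forall>\<eta>\<in>test_functions 0 T. \<forall>\<psi>\<in>H1_space a b.
           (LINT t|lebesgue_on {0<..<T}. F t \<psi> * deriv \<eta> t) =
           - (LINT t|lebesgue_on {0<..<T}. G t \<psi> * \<eta> t))}"

text \<open>The boundary integral over \<open>{a, b}\<close> is taken with respect to counting measure.\<close>

definition load_functional ::
    "real \<Rightarrow> real \<Rightarrow> (real \<Rightarrow> real) \<Rightarrow> (real \<Rightarrow> real) \<Rightarrow> (real \<Rightarrow> real) \<Rightarrow> real" where
  "load_functional a b f g \<psi> = L2_inner a b f \<psi> + (\<Sum>x\<in>{a, b}. g x * \<psi> x)"


section \<open>Moving mesh, finite element spaces and the scheme\<close>

definition num_steps :: "real \<Rightarrow> real \<Rightarrow> nat" where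
  "num_steps T dt = nat \<lfloor>T / dt\<rfloor>"

text \<open>\<open>P n i\<close> is the \<open>i\<close>-th node, \<open>i = 1, \<dots>, Np\<close>, at time level \<open>n\<close>.\<close>

definition moving_mesh :: "real \<Rightarrow> real \<Rightarrow> nat \<Rightarrow> nat \<Rightarrow> (nat \<Rightarrow> nat \<Rightarrow> real) \<Rightarrow> bool" where
  "moving_mesh a b N Np P \<longleftrightarrow> 2 \<le> Np \<and>
     (\<forall>n\<le>N. P n 1 = a \<and> P n Np = b \<and> (\<forall>i\<in>{1..<Np}. P n i < P n (i + 1)))"

definition fe_space :: "real \<Rightarrow> real \<Rightarrow> nat \<Rightarrow> (nat \<Rightarrow> real) \<Rightarrow> (real \<Rightarrow> real) set" where
  "fe_space a b Np p = {v. continuous_on {a..b} v \<and>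
     (\<forall>i\<in>{1..<Np}. \<exists>c d. \<forall>x\<in>{p i..p (i + 1)}. v x = c + d * x)}"

definition upwind :: "(real \<Rightarrow> real \<Rightarrow> real) \<Rightarrow> real \<Rightarrow> nat \<Rightarrow> real \<Rightarrow> real" where
  "upwind u dt n x = x - u (real n * dt) x * dt"

definition upwind2 :: "(real \<Rightarrow> real \<Rightarrow> real) \<Rightarrow> real \<Rightarrow> nat \<Rightarrow> real \<Rightarrow> real" where
  "upwind2 u dt n x = x - 2 * u (real n * dt) x * dt"

definition jacobian ::
    "real \<Rightarrow> real \<Rightarrow> (real \<Rightarrow> real \<Rightarrow> real) \<Rightarrow> real \<Rightarrow> nat \<Rightarrow> real \<Rightarrow> real" where
  "jacobian a b u dt n = wderiv a b (upwind u dt n)"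

definition jacobian2 ::
    "real \<Rightarrow> real \<Rightarrow> (real \<Rightarrow> real \<Rightarrow> real) \<Rightarrow> real \<Rightarrow> nat \<Rightarrow> real \<Rightarrow> real" where
  "jacobian2 a b u dt n = wderiv a b (upwind2 u dt n)"

definition is_numerical_solution ::
    "real \<Rightarrow> real \<Rightarrow> real \<Rightarrow> real \<Rightarrow> (real \<Rightarrow> real \<Rightarrow> real) \<Rightarrow> (real \<Rightarrow> (real \<Rightarrow> real) \<Rightarrow> real) \<Rightarrow>
     real \<Rightarrow> nat \<Rightarrow> (nat \<Rightarrow> nat \<Rightarrow> real) \<Rightarrow> (nat \<Rightarrow> real \<Rightarrow> real) \<Rightarrow> bool" where
  "is_numerical_solution a b T \<nu> u F dt Np P \<phi> \<longleftrightarrow>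
     (\<forall>n\<le>num_steps T dt. \<phi> n \<in> fe_space a b Np (P n)) \<and>
     (1 \<le> num_steps T dt \<longrightarrow>
       (\<forall>\<psi>\<in>fe_space a b Np (P 1).
          L2_inner a b (\<lambda>x. (\<phi> 1 x - \<phi> 0 (upwind u dt 1 x) * jacobian a b u dt 1 x) / dt) \<psi>
            + \<nu> * L2_inner a b (wderiv a b (\<phi> 1)) (wderiv a b \<psi>)
          = F dt \<psi>)) \<and>
     (\<forall>n\<in>{2..num_steps T dt}. \<forall>\<psi>\<in>fe_space a b Np (P n).
          L2_inner a b (\<lambda>x. (3 * \<phi> n x
                - 4 * \<phi> (n - 1) (upwind u dt n x) * jacobian a b u dt n x
                + \<phi> (n - 2) (upwind2 u dt n x) * jacobian2 a b u dt n x) / (2 * dt)) \<psi>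
            + \<nu> * L2_inner a b (wderiv a b (\<phi> n)) (wderiv a b \<psi>)
          = F (real n * dt) \<psi>)"

text \<open>
  Discrete norms over the levels \<open>n = 1, \<dots>, N\<close>. The terms of the maximum are nonnegative, so
  inserting \<open>0\<close> only fixes its value to \<open>0\<close> in the degenerate case \<open>N = 0\<close>.
\<close>

definition linf_L2_norm :: "real \<Rightarrow> real \<Rightarrow> nat \<Rightarrow> (nat \<Rightarrow> real \<Rightarrow> real) \<Rightarrow> real" where
  "linf_L2_norm a b N \<rho> = Max (insert 0 ((\<lambda>n. L2_norm a b (\<rho> n)) ` {1..N}))"

definition l2_L2_norm :: "real \<Rightarrow> real \<Rightarrow> real \<Rightarrow> nat \<Rightarrow> (nat \<Rightarrow> real \<Rightarrow> real) \<Rightarrow> real" where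
  "l2_L2_norm a b dt N \<rho> = sqrt (dt * (\<Sum>n=1..N. (L2_norm a b (\<rho> n))\<^sup>2))"

definition l2_dual_norm ::
    "real \<Rightarrow> real \<Rightarrow> real \<Rightarrow> nat \<Rightarrow> nat \<Rightarrow> (nat \<Rightarrow> nat \<Rightarrow> real) \<Rightarrow>
     (real \<Rightarrow> (real \<Rightarrow> real) \<Rightarrow> real) \<Rightarrow> real" where
  "l2_dual_norm a b dt N Np P F =
     sqrt (dt * (\<Sum>n=1..N. (dual_norm a b (fe_space a b Np (P n)) (F (real n * dt)))\<^sup>2))"

end

theory Submission
  imports Defs
begin

text \<open>
  Testing the scheme with \<open>\<psi>\<^sub>h = \<phi>\<^sub>h\<^sup>n\<close> and integrating by parts with a primitive \<open>\<Phi>\<close> of \<open>\<phi>\<close>,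
  \<open>((\<phi> \<circ> X)\<gamma>, \<psi>) = (\<phi>, \<psi>) - (\<Phi> \<circ> X - \<Phi>, \<nabla>\<psi>)\<close>. Since \<open>\<bar>X(x) - x\<bar> \<le> K \<Delta>t\<close>, the last term is at most
  of order \<open>\<Delta>t \<parallel>\<phi>\<parallel> \<parallel>\<nabla>\<psi>\<parallel>\<close>, so after division by \<open>\<Delta>t\<close> it is absorbed by the diffusion. What remains is the
  second order backward difference without transport, for which
  \<open>\<parallel>\<phi>\<^sup>n\<parallel>\<^sup>2 + \<parallel>2\<phi>\<^sup>n - \<phi>\<^sup>n\<^sup>-\<^sup>1\<parallel>\<^sup>2\<close> is the energy, and the discrete Gronwall lemma applies. The different
  meshes never interact, because \<open>\<phi>\<^sub>h\<^sup>n\<close> alone has to be an admissible test function at step \<open>n\<close>.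
\<close>

section \<open>Smooth cut-off functions\<close>


text \<open>The obstacle is analytic: \<open>wderiv\<close> is an arbitrary choice among weak
  derivatives, while the argument needs a product rule, a chain rule for
  \<open>\<Phi> \<circ> X\<close> and integration by parts for functions that are merely Lipschitz.
  Every function involved (velocity, upwind maps, finite element functions, primitives) is therefore
  written as an indefinite integral of an everywhere bounded measurable density. A uniqueness result
  for weak derivatives, which rests on explicit smooth test functions, carries identities from these
  densities to \<open>wderiv\<close>. The displacement of the upwind maps is of order
  \<open>dt\<close> because the velocity vanishes at the end points; this fact and the step size
  condition also keep the maps inside \<open>[a, b]\<close>. The increment of \<open>\<Phi>\<close>
  along the displacement is estimated in the mean, without a change of variables. Absorbing the
  transport errors in the diffusion leaves a constant proportional to the squared velocity seminorm
  divided by \<open>\<nu>\<close>; it enters the exponent of the Gronwall factor. The final constant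
  depends only on the interval, \<open>T\<close>, \<open>\<nu>\<close> and that seminorm.\<close>

text \<open>The flat function \<open>exp (- (1 / y))\<close>, extended by zero, with a power of
  \<open>1 / y\<close> in front. The index \<open>k\<close> is carried along because differentiation
  only shifts it: the family is closed up to linear combinations.\<close>

definition expinv :: "nat \<Rightarrow> real \<Rightarrow> real" where
  "expinv k y = (if y > 0 then (1 / y) ^ k * exp (- (1 / y)) else 0)"

lemma expinv_nonneg: "0 \<le> expinv k y"
  by (simp add: expinv_def)

lemma expinv_pos: "y > 0 \<Longrightarrow> 0 < expinv k y"
  by (simp add: expinv_def)

lemma expinv_reduce: "expinv k y = y * expinv (Suc k) y"
  by (simp add: expinv_def)

lemma expinv_tendsto_0: "(expinv k \<longlongrightarrow> 0) (at 0)"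
proof -
  have "((\<lambda>y. (1 / y) ^ k * exp (- (1 / y))) \<longlongrightarrow> 0) (at_right (0::real))"
  proof -
    have "((\<lambda>y::real. inverse y ^ k / exp (inverse y)) \<longlongrightarrow> 0) (at_right 0)"
      using filterlim_compose[OF tendsto_power_div_exp_0 filterlim_inverse_at_top_right] .
    then show ?thesis by (simp add: exp_minus divide_inverse)
  qed
  then have r: "(expinv k \<longlongrightarrow> 0) (at_right 0)"
    by (rule Lim_transform_eventually)
      (auto simp: expinv_def eventually_at_right_field intro!: exI[of _ 1])
  have l: "(expinv k \<longlongrightarrow> 0) (at_left 0)"
    by (rule Lim_transform_eventually[OF tendsto_const])
      (auto simp: expinv_def eventually_at_left_field intro!: exI[of _ "-1"])
  from l r show ?thesis by (simp add: filterlim_split_at)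
qed

lemma expinv_has_real_derivative:
  "(expinv k has_real_derivative (expinv (k + 2) y - real k * expinv (k + 1) y)) (at y)"
proof -
  consider "y > 0" | "y < 0" | "y = 0" by linarith
  then show ?thesis
  proof cases
    case 1
    have "((\<lambda>y. (1 / y) ^ k * exp (- (1 / y))) has_real_derivative
        (expinv (k + 2) y - real k * expinv (k + 1) y)) (at y)"
    proof -
      have D: "((\<lambda>y. (1 / y) ^ k * exp (- (1 / y))) has_real_derivative
          (real k * (1 / y) ^ (k - 1) * (- ((1 / y)\<^sup>2)) * exp (- (1 / y))
            + (1 / y) ^ k * (exp (- (1 / y)) * (1 / y)\<^sup>2))) (at y)"
        using 1 by (auto intro!: derivative_eq_intros simp: power2_eq_square)
      \<comment> \<open>For \<open>k = 0\<close> the exponent is truncated, but the factor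
        \<open>real k\<close> makes both sides vanish.\<close>
      have eq: "real k * (1 / y) ^ (k - 1) * (- ((1 / y)\<^sup>2)) = - (real k * (1 / y) ^ (k + 1))"
        by (cases k) (simp_all add: power2_eq_square)
      show ?thesis using D[unfolded eq] 1 unfolding expinv_def
        by (simp add: algebra_simps power2_eq_square)
    qed
    then show ?thesis
      by (rule has_field_derivative_transform_within_open[where S="{0<..}"])
        (use 1 in \<open>auto simp: expinv_def\<close>)
  next
    case 2
    have "((\<lambda>_. 0) has_real_derivative 0) (at y)" by simp
    then have "(expinv k has_real_derivative 0) (at y)"
      by (rule has_field_derivative_transform_within_open[where S="{..<0}"])
        (use 2 in \<open>auto simp: expinv_def\<close>)
    then show ?thesis using 2 by (simp add: expinv_def)
  next
    case 3
    \<comment> \<open>Away from 0, the difference quotient of \<open>expinv k\<close> at 0 is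
      \<open>expinv (Suc k)\<close> itself.\<close>
    have "((\<lambda>h. expinv (Suc k) h) \<longlongrightarrow> 0) (at 0)" by (rule expinv_tendsto_0)
    then have "((\<lambda>h. (expinv k (0 + h) - expinv k 0) / h) \<longlongrightarrow> 0) (at 0)"
      by (rule Lim_transform_eventually)
        (auto simp: eventually_at_filter expinv_reduce[of k] )
    then show ?thesis using 3 by (simp add: DERIV_def expinv_def)
  qed
qed

definition smooth :: "(real \<Rightarrow> real) \<Rightarrow> bool" where
  "smooth f \<longleftrightarrow> (\<forall>k x. ((deriv ^^ k) f) differentiable (at x))"

text \<open>Avoids any formula for iterated derivatives: every iterate of \<open>deriv\<close> stays
  in the class \<open>A\<close>.\<close>

lemma smooth_if_deriv_closed:
  assumes "f \<in> A" and "\<And>g. g \<in> A \<Longrightarrow> \<exists>g'\<in>A. \<forall>x. (g has_real_derivative g' x) (at x)"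
  shows "smooth f"
proof -
  have "(deriv ^^ k) f \<in> A" for k
  proof (induction k)
    case (Suc k)
    then obtain g' where g': "g' \<in> A" "\<forall>x. ((deriv ^^ k) f has_real_derivative g' x) (at x)"
      using assms(2) by blast
    then have "deriv ((deriv ^^ k) f) = g'" by (auto intro!: DERIV_imp_deriv)
    then show ?case using g' by simp
  qed (use assms in simp)
  then show ?thesis unfolding smooth_def
    using assms(2) real_differentiable_def by blast
qed

lemma smooth_primitive:
  assumes "\<And>x. (f has_real_derivative f' x) (at x)" "smooth f'"
  shows "smooth f"
  unfolding smooth_def
proof (intro allI)
  fix k x
  have "deriv f = f'" using assms(1) by (auto intro!: DERIV_imp_deriv)
  then show "(deriv ^^ k) f differentiable at x"
    using assms by (cases k) (auto simp: smooth_def funpow_Suc_right real_differentiable_def simp del: funpow.simps)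
qed

section \<open>Bumps, smooth steps and cut-offs of prescribed width\<close>

definition bump :: "real \<Rightarrow> real \<Rightarrow> real \<Rightarrow> real" where
  "bump c e x = expinv 0 ((x - c) * (c + e - x))"

text \<open>The class consists of differences of terms
  \<open>poly p x * expinv k (poly q x)\<close>. Raising all indices to \<open>k + 2\<close>, at the
  cost of factors \<open>q\<close>, makes the derivative of one term a single term again.
  Differences are treated at once because the derivative of a cut-off is a difference of two
  bumps.\<close>

lemma smooth_bump_diff: "smooth (\<lambda>x. \<alpha> * bump c e x - \<beta> * bump d e' x)"
proof -
  define B where "B = (\<lambda>(p, q, k) x. poly p x * expinv k (poly q x))"
  have B: "(B (p, q, k) has_real_derivative B ((pderiv p * q * q - smult (real k) (p * pderiv q * q)
      + p * pderiv q), q, k + 2) x) (at x)" for p q k x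
    unfolding B_def prod.case
    by (rule derivative_eq_intros poly_DERIV DERIV_chain2[OF expinv_has_real_derivative] refl)+
      (simp add: expinv_reduce[of k] expinv_reduce[of "Suc k"] algebra_simps)
  let ?A = "{g. \<exists>u v. g = (\<lambda>x. B u x - B v x)}"
  show ?thesis
  proof (rule smooth_if_deriv_closed[where A = ?A])
    have "B ([:\<alpha>:], [:-c, 1:] * [:c+e, -1:], 0) = (\<lambda>x. \<alpha> * bump c e x)" for \<alpha> c e
      by (auto simp: B_def bump_def algebra_simps)
    then have "(\<lambda>x. \<alpha> * bump c e x - \<beta> * bump d e' x) =
      (\<lambda>x. B ([:\<alpha>:], [:-c, 1:] * [:c+e, -1:], 0) x - B ([:\<beta>:], [:-d, 1:] * [:d+e', -1:], 0) x)"
      by (simp only:)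
    then show "(\<lambda>x. \<alpha> * bump c e x - \<beta> * bump d e' x) \<in> ?A" by blast
  next
    fix g assume "g \<in> ?A"
    then obtain u v where "g = (\<lambda>x. B u x - B v x)" by blast
    moreover obtain p q k where "u = (p, q, k)" by (cases u)
    moreover obtain p' q' k' where "v = (p', q', k')" by (cases v)
    ultimately have g: "g = (\<lambda>x. B (p,q,k) x - B (p',q',k') x)" by simp
    have "(g has_real_derivative (B ((pderiv p * q * q - smult (real k) (p * pderiv q * q)
      + p * pderiv q), q, k + 2) x - B ((pderiv p' * q' * q' - smult (real k') (p' * pderiv q' * q')
      + p' * pderiv q'), q', k' + 2) x)) (at x)" for x
      unfolding g by (intro DERIV_diff B)
    then show "\<exists>g'\<in>?A. \<forall>x. (g has_real_derivative g' x) (at x)"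
      by (intro bexI[where x="\<lambda>x. (B ((pderiv p * q * q - smult (real k) (p * pderiv q * q)
      + p * pderiv q), q, k + 2) x - B ((pderiv p' * q' * q' - smult (real k') (p' * pderiv q' * q')
      + p' * pderiv q'), q', k' + 2) x)"]) blast+
  qed
qed

lemma bump_nonneg: "0 \<le> bump c e x"
  by (simp add: bump_def expinv_nonneg)

lemma bump_eq_0: "x \<le> c \<or> c + e \<le> x \<Longrightarrow> e > 0 \<Longrightarrow> bump c e x = 0"
proof -
  assume "x \<le> c \<or> c + e \<le> x" "e > 0"
  then have "(x - c) * (c + e - x) \<le> 0"
    by (auto simp: mult_le_0_iff)
  then show ?thesis by (simp add: bump_def expinv_def)
qed

lemma continuous_on_bump [continuous_intros]: "continuous_on S (bump c e)"
proof -
  have "continuous_on UNIV (expinv 0)"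
    using expinv_has_real_derivative DERIV_isCont continuous_at_imp_continuous_on by blast
  then show ?thesis unfolding bump_def
    by (rule continuous_on_compose2) (auto intro!: continuous_intros)
qed

definition bump_mass :: "real \<Rightarrow> real \<Rightarrow> real" where
  "bump_mass c e = integral {c..c+e} (bump c e)"

lemma bump_mass_pos: assumes "e > 0" shows "bump_mass c e > 0"
proof -
  have i: "bump c e integrable_on {c..c+e}"
    by (intro integrable_continuous_real continuous_intros)
  have "bump_mass c e \<noteq> 0"
  proof
    assume "bump_mass c e = 0"
    then have "(bump c e has_integral 0) (cbox c (c+e))"
      using i by (simp add: bump_mass_def has_integral_iff)
    then have "bump c e (c + e/2) = 0"
      by (rule has_integral_0_cbox_imp_0[rotated 2])
        (use assms in \<open>auto intro!: continuous_intros simp: bump_nonneg\<close>)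
    moreover have "bump c e (c + e/2) > 0"
      unfolding bump_def by (rule expinv_pos) (use assms in auto)
    ultimately show False by simp
  qed
  moreover have "bump_mass c e \<ge> 0"
    unfolding bump_mass_def by (intro integral_nonneg i) (simp add: bump_nonneg)
  ultimately show ?thesis by simp
qed

text \<open>Rises from 0 to 1 across \<open>[c, c + e]\<close>; its derivative is a bump of unit
  mass, hence an approximate identity at \<open>c\<close> as \<open>e\<close> tends to 0.\<close>

definition smooth_step :: "real \<Rightarrow> real \<Rightarrow> real \<Rightarrow> real" where
  "smooth_step c e x = integral {c..x} (bump c e) / bump_mass c e"

lemma smooth_step_eq_0: "x \<le> c \<Longrightarrow> smooth_step c e x = 0"
  by (cases "x = c") (auto simp: smooth_step_def)

lemma smooth_step_eq_1:
  assumes "e > 0" "c + e \<le> x"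
  shows "smooth_step c e x = 1"
proof -
  have "integral {c..x} (bump c e) = integral {c..c+e} (bump c e) + integral {c+e..x} (bump c e)"
    by (rule Henstock_Kurzweil_Integration.integral_combine[symmetric])
      (use assms in \<open>auto intro!: integrable_continuous_real continuous_intros\<close>)
  also have "integral {c+e..x} (bump c e) = integral {c+e..x} (\<lambda>_. 0)"
    by (rule integral_cong) (use assms bump_eq_0 in auto)
  finally show ?thesis using bump_mass_pos[OF assms(1), of c]
    by (simp add: smooth_step_def bump_mass_def)
qed

lemma smooth_step_bounds:
  assumes "e > 0"
  shows "0 \<le> smooth_step c e x" "smooth_step c e x \<le> 1"
proof -
  have m: "integral {c..x} (bump c e) \<le> integral {c..y} (bump c e)" if "x \<le> y" for x y
    by (rule integral_subset_le) (use that in \<open>auto intro!: integrable_continuous_real continuous_intros simp: bump_nonneg\<close>)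
  show "0 \<le> smooth_step c e x" unfolding smooth_step_def
    by (intro divide_nonneg_pos bump_mass_pos assms integral_nonneg)
      (auto intro!: integrable_continuous_real continuous_intros simp: bump_nonneg)
  have "smooth_step c e x \<le> smooth_step c e (max x (c+e))"
    unfolding smooth_step_def using bump_mass_pos[OF assms, of c] by (intro divide_right_mono m) auto
  then show "smooth_step c e x \<le> 1" using smooth_step_eq_1[OF assms, of c "max x (c+e)"] by simp
qed

lemma smooth_step_has_real_derivative:
  assumes "e > 0"
  shows "(smooth_step c e has_real_derivative bump c e x / bump_mass c e) (at x)"
proof -
  \<comment> \<open>The lower end point is moved strictly to the left of both \<open>x\<close> and
    \<open>c\<close>, where the bump vanishes, so that \<open>x\<close> becomes an interior point of
    the interval of integration even if \<open>x \<le> c\<close>.\<close>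
  have *: "integral {c..y} (bump c e) = integral {min (x-1) (c-1)..y} (bump c e)" if "y > min (x-1) (c-1)" for y
  proof -
    have z: "integral {min (x-1) (c-1)..y} (bump c e) = 0" if "y \<le> c" for y
    proof -
      have "integral {min (x-1) (c-1)..y} (bump c e) = integral {min (x-1) (c-1)..y} (\<lambda>_. 0)"
        by (rule integral_cong) (use assms that bump_eq_0 in auto)
      then show ?thesis by simp
    qed
    show ?thesis
    proof (cases "y \<le> c")
      case True
      then show ?thesis using z[OF True] by (cases "y = c") auto
    next
      case False
      have "integral {min (x-1) (c-1)..y} (bump c e) = integral {min (x-1) (c-1)..c} (bump c e) + integral {c..y} (bump c e)"
        by (rule Henstock_Kurzweil_Integration.integral_combine[symmetric])
          (use False in \<open>auto intro!: integrable_continuous_real continuous_intros\<close>)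
      then show ?thesis using z[of c] by simp
    qed
  qed
  have "((\<lambda>y. integral {min (x-1) (c-1)..y} (bump c e)) has_real_derivative bump c e x)
      (at x within {min (x-1) (c-1)..x+1})"
    by (rule integral_has_real_derivative) (auto intro!: continuous_intros)
  then have "((\<lambda>y. integral {min (x-1) (c-1)..y} (bump c e)) has_real_derivative bump c e x) (at x)"
    by (subst (asm) at_within_Icc_at) auto
  then have "((\<lambda>y. integral {c..y} (bump c e)) has_real_derivative bump c e x) (at x)"
    by (rule has_field_derivative_transform_within_open[where S="{min (x-1) (c-1)<..}"])
      (use * in auto)
  then show ?thesis unfolding smooth_step_def by (rule DERIV_cdivide)
qed

text \<open>A smoothed indicator of \<open>[c, d]\<close>. Testing with it reads off, in the limit,
  the values of a continuous function at \<open>c\<close> and \<open>d\<close>.\<close>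

lemma smooth_step_diff_test_function:
  assumes "a < c" "c \<le> d" "d + e < b" "e > 0"
  shows "(\<lambda>x. smooth_step c e x - smooth_step d e x) \<in> test_functions a b"
    and "deriv (\<lambda>x. smooth_step c e x - smooth_step d e x) =
      (\<lambda>x. bump c e x / bump_mass c e - bump d e x / bump_mass d e)"
proof -
  have D: "((\<lambda>x. smooth_step c e x - smooth_step d e x) has_real_derivative
      (bump c e x / bump_mass c e - bump d e x / bump_mass d e)) (at x)" for x
    by (intro DERIV_diff smooth_step_has_real_derivative assms)
  then show "deriv (\<lambda>x. smooth_step c e x - smooth_step d e x) =
      (\<lambda>x. bump c e x / bump_mass c e - bump d e x / bump_mass d e)"
    by (auto intro!: DERIV_imp_deriv)
  have "smooth (\<lambda>x. smooth_step c e x - smooth_step d e x)"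
    by (rule smooth_primitive[OF D])
      (use smooth_bump_diff[of "1 / bump_mass c e" c e "1 / bump_mass d e" d e] in simp)
  moreover have "smooth_step c e x - smooth_step d e x \<noteq> 0 \<Longrightarrow> c \<le> x \<and> x \<le> d + e" for x
    using assms smooth_step_eq_0[of x c e] smooth_step_eq_0[of x d e]
      smooth_step_eq_1[of e c x] smooth_step_eq_1[of e d x]
    by (smt (verit))
  ultimately show "(\<lambda>x. smooth_step c e x - smooth_step d e x) \<in> test_functions a b"
    using assms unfolding test_functions_def smooth_def by blast
qed

section \<open>Weak derivatives\<close>


text \<open>Bounded at every point of the open interval, not just almost everywhere: such functions
  form an algebra and are integrable, with no null sets to carry along. Exceptional sets are removed
  once, when a representative is chosen.\<close>

definition bdd_meas :: "real \<Rightarrow> real \<Rightarrow> (real \<Rightarrow> real) \<Rightarrow> bool" where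
  "bdd_meas a b f \<longleftrightarrow> f \<in> borel_measurable (lebesgue_on {a<..<b}) \<and>
     (\<exists>B. \<forall>x\<in>{a<..<b}. \<bar>f x\<bar> \<le> B)"

lemma bdd_meas_bound:
  assumes "bdd_meas a b f"
  obtains B where "B > 0" "\<And>x. x \<in> {a<..<b} \<Longrightarrow> \<bar>f x\<bar> \<le> B"
proof -
  obtain B where B: "\<forall>x\<in>{a<..<b}. \<bar>f x\<bar> \<le> B" using assms by (auto simp: bdd_meas_def)
  show ?thesis by (rule that[of "\<bar>B\<bar> + 1"]) (use B in \<open>auto, force\<close>)
qed

lemma bdd_meas_const [intro, simp]: "bdd_meas a b (\<lambda>_. c)"
  by (auto simp: bdd_meas_def)

lemma bdd_meas_add [intro]:
  assumes "bdd_meas a b f" "bdd_meas a b g"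
  shows "bdd_meas a b (\<lambda>x. f x + g x)"
proof -
  obtain B C where "\<forall>x\<in>{a<..<b}. \<bar>f x\<bar> \<le> B" "\<forall>x\<in>{a<..<b}. \<bar>g x\<bar> \<le> C"
    using assms by (auto simp: bdd_meas_def)
  then have "\<forall>x\<in>{a<..<b}. \<bar>f x + g x\<bar> \<le> B + C" by (meson abs_triangle_ineq add_mono order_trans)
  then show ?thesis using assms by (auto simp: bdd_meas_def)
qed

lemma bdd_meas_mult [intro]:
  assumes "bdd_meas a b f" "bdd_meas a b g"
  shows "bdd_meas a b (\<lambda>x. f x * g x)"
proof -
  obtain B C where "\<forall>x\<in>{a<..<b}. \<bar>f x\<bar> \<le> B" "\<forall>x\<in>{a<..<b}. \<bar>g x\<bar> \<le> C"
    using assms by (auto simp: bdd_meas_def)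
  then have "\<forall>x\<in>{a<..<b}. \<bar>f x * g x\<bar> \<le> B * C"
    unfolding abs_mult by (intro ballI mult_mono) (auto intro: order_trans[OF abs_ge_zero])
  then show ?thesis using assms by (auto simp: bdd_meas_def)
qed

lemma bdd_meas_diff [intro]:
  assumes "bdd_meas a b f" "bdd_meas a b g"
  shows "bdd_meas a b (\<lambda>x. f x - g x)"
  using bdd_meas_add[OF assms(1) bdd_meas_mult[OF bdd_meas_const[of a b "-1"] assms(2)]] by simp

lemma bdd_meas_cmult [intro]: "bdd_meas a b f \<Longrightarrow> bdd_meas a b (\<lambda>x. c * f x)"
  by (rule bdd_meas_mult[OF bdd_meas_const])

lemma bdd_meas_power2 [intro]: "bdd_meas a b f \<Longrightarrow> bdd_meas a b (\<lambda>x. (f x)\<^sup>2)"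
  by (simp add: power2_eq_square bdd_meas_mult)

lemma bdd_meas_continuous:
  assumes "continuous_on {a..b} f"
  shows "bdd_meas a b f"
proof -
  have "f \<in> borel_measurable (lebesgue_on {a<..<b})"
    by (rule continuous_imp_measurable_on_sets_lebesgue)
      (use assms in \<open>auto intro: continuous_on_subset\<close>)
  moreover have "bounded (f ` {a..b})"
    by (intro compact_imp_bounded compact_continuous_image assms) simp
  then obtain B where "\<forall>x\<in>{a..b}. \<bar>f x\<bar> \<le> B" by (auto simp: bounded_iff)
  then have "\<forall>x\<in>{a<..<b}. \<bar>f x\<bar> \<le> B" by auto
  then have "\<exists>B. \<forall>x\<in>{a<..<b}. \<bar>f x\<bar> \<le> B" ..
  ultimately show ?thesis by (simp add: bdd_meas_def)
qed

lemma bdd_meas_subset: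
  assumes "bdd_meas a b f" "a \<le> c" "d \<le> b"
  shows "bdd_meas c d f"
proof -
  have "f \<in> borel_measurable (lebesgue_on {c<..<d})"
    by (rule measurable_restrict_mono[of _ _ "{a<..<b}"]) (use assms in \<open>auto simp: bdd_meas_def\<close>)
  moreover obtain B where "\<forall>x\<in>{a<..<b}. \<bar>f x\<bar> \<le> B" using assms by (auto simp: bdd_meas_def)
  then have "\<forall>x\<in>{c<..<d}. \<bar>f x\<bar> \<le> B" using assms by auto
  ultimately show ?thesis by (auto simp: bdd_meas_def)
qed

lemma bdd_meas_integrable:
  assumes "bdd_meas a b f"
  shows "integrable (lebesgue_on {a<..<b}) f"
proof -
  obtain B where "\<forall>x\<in>{a<..<b}. \<bar>f x\<bar> \<le> B" using assms by (auto simp: bdd_meas_def)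
  interpret finite_measure "lebesgue_on {a<..<b}" by (rule finite_measure_lebesgue_on) simp
  show ?thesis
    by (rule integrable_const_bound[where B=B]) (use assms \<open>\<forall>x\<in>_. _\<close> in \<open>auto simp: bdd_meas_def\<close>)
qed

text \<open>Bridge from the Lebesgue integral over the open interval, used in the definitions, to
  the Henstock-Kurzweil integral over the closed one, used for the calculus.\<close>

lemma bdd_meas_LINT:
  assumes "bdd_meas a b f"
  shows "(LINT x|lebesgue_on {a<..<b}. f x) = integral {a..b} f"
  using lebesgue_integral_eq_integral[OF bdd_meas_integrable[OF assms]]
  by (simp add: integral_open_interval_real)

lemma bdd_meas_integrable_on:
  assumes "bdd_meas a b f" "a \<le> c" "d \<le> b"
  shows "f integrable_on {c..d}"
  using integrable_on_lebesgue_on[OF bdd_meas_integrable[OF bdd_meas_subset[OF assms]]]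
  by (simp add: integrable_on_open_interval_real)

lemma bdd_meas_set_integrable:
  assumes "bdd_meas a b f" "a < c" "d < b"
  shows "set_integrable lebesgue {c..d} f"
proof -
  have "set_integrable lebesgue {a<..<b} f"
    using bdd_meas_integrable[OF assms(1)]
    by (auto simp: set_integrable_def integrable_restrict_space)
  then show ?thesis
    by (rule set_integrable_subset) (use assms in auto)
qed

section \<open>The fundamental theorem of calculus for weak derivatives\<close>

lemma AE_0_if_interval_integrals_0:
  fixes w :: "real \<Rightarrow> real"
  assumes w: "\<And>c d. a < c \<Longrightarrow> d < b \<Longrightarrow> w integrable_on {c..d}"
    and 0: "\<And>c d. a < c \<Longrightarrow> c \<le> d \<Longrightarrow> d < b \<Longrightarrow> integral {c..d} w = 0"
  shows "AE x in lebesgue_on {a<..<b}. w x = 0"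
proof -
  \<comment> \<open>Since \<open>w\<close> is only locally integrable, Lebesgue differentiation is
    applied to its truncations to an exhausting sequence of compact intervals.\<close>
  define c where "c = (\<lambda>n. a + 1 / real (Suc n))"
  define d where "d = (\<lambda>n. b - 1 / real (Suc n))"
  define g where "g = (\<lambda>n x. if x \<in> {c n..d n} then w x else 0)"
  have cd: "a < c n" "d n < b" for n by (auto simp: c_def d_def)
  have "g n integrable_on cbox x y" for n x y
  proof -
    have "w integrable_on {c n..d n} \<inter> cbox x y"
      using w[of "max (c n) x" "min (d n) y"] cd[of n] by (simp add: Int_atLeastAtMost)
    then show ?thesis
      unfolding g_def using integrable_restrict_Int[of "{c n..d n}" w "cbox x y"] by simp
  qed
  then have "\<exists>N. negligible N \<and> (\<forall>x e. x \<notin> N \<longrightarrow> 0 < e \<longrightarrow>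
      (\<exists>\<delta>>0. \<forall>h. 0 < h \<and> h < \<delta> \<longrightarrow> \<bar>integral {x..x + h} (g n) / h - g n x\<bar> < e))" for n
    by (rule integrable_ccontinuous_explicit) (simp add: real_scaleR_def divide_inverse mult.commute, blast)
  then obtain N where N: "\<And>n. negligible (N n)" "\<And>n x e. x \<notin> N n \<Longrightarrow> 0 < e \<Longrightarrow>
      \<exists>\<delta>>0. \<forall>h. 0 < h \<and> h < \<delta> \<longrightarrow> \<bar>integral {x..x + h} (g n) / h - g n x\<bar> < e"
    by metis
  have "w x = 0" if x: "x \<in> {a<..<b}" "x \<notin> (\<Union>n. N n)" for x
  proof -
    obtain n where n: "1 / real (Suc n) < min (x - a) (b - x)"
      using x reals_Archimedean[of "min (x - a) (b - x)"] by (auto simp: inverse_eq_divide)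
    then have nx: "c n < x" "x < d n" by (auto simp: c_def d_def)
    have "\<bar>w x\<bar> < e" if "e > 0" for e
    proof -
      obtain \<delta> where \<delta>: "\<delta> > 0" "\<forall>h. 0 < h \<and> h < \<delta> \<longrightarrow> \<bar>integral {x..x + h} (g n) / h - g n x\<bar> < e"
        using N(2)[of x n e] x \<open>e > 0\<close> by blast
      define h where "h = min (\<delta> / 2) (d n - x)"
      have h: "0 < h" "h < \<delta>" "x + h \<le> d n" using \<delta>(1) nx by (auto simp: h_def)
      have "integral {x..x + h} (g n) = integral {x..x+h} w"
        by (rule integral_cong) (use h nx in \<open>auto simp: g_def\<close>)
      also have "\<dots> = 0" using h nx cd[of n] by (intro 0) auto
      finally show ?thesis using \<delta>(2) h nx by (force simp: g_def)
    qed
    then have "\<not> 0 < \<bar>w x\<bar>" by blast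
    then show ?thesis by simp
  qed
  moreover have "(\<Union>n. N n) \<in> null_sets lebesgue"
    using N(1) by (intro null_sets_UN) (auto simp: negligible_iff_null_sets)
  ultimately show ?thesis
    by (subst AE_restrict_space_iff) (auto intro!: AE_I'[where N="\<Union>n. N n"])
qed

lemma integral_zero_outside:
  fixes f :: "real \<Rightarrow> real"
  assumes "a \<le> c" "d \<le> b" "\<And>x. x \<in> {a..b} - {c..d} \<Longrightarrow> f x = 0"
  shows "integral {a..b} f = integral {c..d} f"
proof -
  have "integral {a..b} f = integral {a..b} (\<lambda>x. if x \<in> {c..d} then f x else 0)"
    by (rule integral_cong) (use assms in auto)
  also have "\<dots> = integral ({c..d} \<inter> {a..b}) f"
    by (rule Henstock_Kurzweil_Integration.integral_restrict_Int)
  also have "{c..d} \<inter> {a..b} = {c..d}" using assms by auto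
  finally show ?thesis .
qed

text \<open>The normalised bump is nonnegative, has mass one and lives on \<open>[c, c + e]\<close>,
  hence it averages values of \<open>v\<close> close to \<open>v c\<close>.\<close>

lemma bump_average_tendsto:
  assumes v: "continuous_on {a..b} v" and c: "a < c" "c < b"
  shows "((\<lambda>e. integral {a..b} (\<lambda>x. v x * (bump c e x / bump_mass c e))) \<longlongrightarrow> v c) (at_right 0)"
proof (rule tendstoI)
  fix r :: real assume "r > 0"
  then obtain \<delta> where \<delta>: "\<delta> > 0" "\<And>x. x \<in> {a..b} \<Longrightarrow> dist x c < \<delta> \<Longrightarrow> dist (v x) (v c) < r / 2"
    using v c unfolding continuous_on_iff by (metis atLeastAtMost_iff half_gt_zero less_eq_real_def)
  have "dist (integral {a..b} (\<lambda>x. v x * (bump c e x / bump_mass c e))) (v c) < r"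
    if e: "0 < e" "e < min \<delta> (b - c)" for e
  proof -
    let ?k = "\<lambda>x. bump c e x / bump_mass c e"
    note m = bump_mass_pos[OF e(1), of c]
    have k: "continuous_on {a..b} ?k" using m by (intro continuous_intros) auto
    have "integral {a..b} ?k = integral {c..c+e} ?k"
      by (rule integral_zero_outside) (use e c bump_eq_0 in auto)
    also have "\<dots> = 1" using m by (simp add: bump_mass_def)
    finally have k1: "integral {a..b} ?k = 1" .
    have "integral {a..b} (\<lambda>x. v x * ?k x) - v c = integral {a..b} (\<lambda>x. v x * ?k x) - integral {a..b} (\<lambda>x. v c * ?k x)"
      by (simp only: integral_mult_right k1 mult_1_right)
    also have "\<dots> = integral {a..b} (\<lambda>x. v x * ?k x - v c * ?k x)"
      by (intro integral_diff[symmetric] integrable_continuous_real continuous_intros v) (use m in auto)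
    finally have "norm (integral {a..b} (\<lambda>x. v x * ?k x) - v c) = norm (integral {a..b} (\<lambda>x. v x * ?k x - v c * ?k x))"
      by simp
    also have "\<dots> \<le> integral {a..b} (\<lambda>x. r / 2 * ?k x)"
    proof (rule integral_norm_bound_integral)
      fix x assume x: "x \<in> {a..b}"
      have k0: "0 \<le> ?k x" using m by (simp add: bump_nonneg)
      show "norm (v x * ?k x - v c * ?k x) \<le> r / 2 * ?k x"
      proof (cases "x \<in> {c<..<c+e}")
        case True
        then have "\<bar>v x - v c\<bar> \<le> r / 2" using \<delta>(2)[OF x] e by (auto simp: dist_real_def)
        then have "\<bar>v x - v c\<bar> * ?k x \<le> r / 2 * ?k x" using k0 by (rule mult_right_mono)
        moreover have "norm (v x * ?k x - v c * ?k x) = \<bar>v x - v c\<bar> * ?k x"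
          unfolding left_diff_distrib[symmetric] real_norm_def abs_mult abs_of_nonneg[OF k0] ..
        ultimately show ?thesis by simp
      next
        case False
        then show ?thesis using bump_eq_0[of x c e] e by auto
      qed
    qed (use m in \<open>auto intro!: integrable_continuous_real continuous_intros v\<close>)
    also have "\<dots> = r / 2" by (simp only: integral_mult_right k1 mult_1_right)
    finally show ?thesis using \<open>r > 0\<close> by (simp add: dist_norm)
  qed
  then show "\<forall>\<^sub>F e in at_right 0. dist (integral {a..b} (\<lambda>x. v x * (bump c e x / bump_mass c e))) (v c) < r"
    using \<delta>(1) c by (auto simp: eventually_at_right_field intro!: exI[of _ "min \<delta> (b - c)"])
qed

text \<open>Test with smoothed indicators of \<open>[c, d]\<close>: the side with
  \<open>deriv \<eta>\<close> converges to \<open>v c - v d\<close> by averaging, the other one by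
  dominated convergence. Both end points are interior because test functions have compact
  support.\<close>

lemma weak_deriv_FTC:
  assumes wd: "has_weak_deriv a b v w" and v: "continuous_on {a..b} v"
    and c: "a < c" "c \<le> d" "d < b"
  shows "integral {c..d} w = v d - v c"
proof -
  \<comment> \<open>The widths tend to 0 and are at most \<open>(b - d) / 2\<close>, so all test
    functions live in the fixed interval \<open>[c, r]\<close>, on which \<open>w\<close> is
    integrable.\<close>
  define e where "e = (\<lambda>n. (b - d) / 2 / real (Suc n))"
  define \<eta> where "\<eta> = (\<lambda>n x. smooth_step c (e n) x - smooth_step d (e n) x)"
  define r where "r = d + (b - d) / 2"
  have e0: "e n > 0" for n using c by (simp add: e_def)
  have er: "d + e n \<le> r" for n
  proof -
    have "(b - d) / 2 / real (Suc n) \<le> (b - d) / 2 / 1"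
      by (rule divide_left_mono) (use c in auto)
    then show ?thesis by (simp add: e_def r_def)
  qed
  have rb: "r < b" "d < r" using c by (auto simp: r_def field_simps)
  have e_lim: "filterlim e (at_right 0) sequentially"
  proof (rule tendsto_imp_filterlim_at_right)
    show "e \<longlonglongrightarrow> 0" unfolding e_def
      using tendsto_mult_right_zero[OF LIMSEQ_inverse_real_of_nat, of "(b-d)/2"]
      unfolding divide_inverse[of _ "real (Suc _)"] .
  qed (use e0 in simp)
  note test = smooth_step_diff_test_function[OF c(1,2) le_less_trans[OF er rb(1)] e0, folded \<eta>_def]
  have eq: "(LINT x|lebesgue_on {a<..<b}. v x * deriv (\<eta> n) x) =
      - (LINT x|lebesgue_on {a<..<b}. w x * \<eta> n x)" for n
    using wd test(1)[of n] unfolding has_weak_deriv_def by (simp add: \<eta>_def)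
  have L: "(\<lambda>n. LINT x|lebesgue_on {a<..<b}. v x * deriv (\<eta> n) x) \<longlonglongrightarrow> v c - v d"
  proof -
    have "(LINT x|lebesgue_on {a<..<b}. v x * deriv (\<eta> n) x) =
        integral {a..b} (\<lambda>x. v x * (bump c (e n) x / bump_mass c (e n)))
        - integral {a..b} (\<lambda>x. v x * (bump d (e n) x / bump_mass d (e n)))" for n
    proof -
      have ci: "continuous_on {a..b} (\<lambda>x. v x * (bump p (e n) x / bump_mass p (e n)))" for p
        using bump_mass_pos[OF e0, of p n] by (intro continuous_intros v) auto
      have "(LINT x|lebesgue_on {a<..<b}. v x * deriv (\<eta> n) x) =
        (LINT x|lebesgue_on {a<..<b}. v x * (bump c (e n) x / bump_mass c (e n))
            - v x * (bump d (e n) x / bump_mass d (e n)))"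
        unfolding test(2)[of n, folded \<eta>_def] \<eta>_def by (simp only: right_diff_distrib)
      also have "\<dots> = integral {a..b} (\<lambda>x. v x * (bump c (e n) x / bump_mass c (e n))
            - v x * (bump d (e n) x / bump_mass d (e n)))"
        by (intro bdd_meas_LINT bdd_meas_continuous continuous_on_diff ci)
      finally show ?thesis
        using integral_diff[OF integrable_continuous_real[OF ci[of c]] integrable_continuous_real[OF ci[of d]]]
        by simp
    qed
    then show ?thesis
      using tendsto_diff[OF filterlim_compose[OF bump_average_tendsto[OF v, of c] e_lim]
          filterlim_compose[OF bump_average_tendsto[OF v, of d] e_lim]] c by auto
  qed
  have wi: "set_integrable lebesgue {p..q} w" if "a < p" "q < b" for p q
    using wd that unfolding has_weak_deriv_def locally_integrable_def by blast
  have wr: "integrable lebesgue (\<lambda>x. indicator {c..r} x * w x)"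
    using wi[of c r] c rb by (simp add: set_integrable_def)
  have \<eta>0: "\<eta> n x = 0" if "x \<notin> {c..r}" for n x
    using that er[of n] e0[of n] c smooth_step_eq_0[of x c "e n"] smooth_step_eq_0[of x d "e n"]
      smooth_step_eq_1[of "e n" c x] smooth_step_eq_1[of "e n" d x]
    by (cases "x < c") (auto simp: \<eta>_def)
  have R: "(\<lambda>n. LINT x|lebesgue_on {a<..<b}. w x * \<eta> n x) \<longlonglongrightarrow> integral {c..d} w"
  proof -
    have "(LINT x|lebesgue_on {a<..<b}. w x * \<eta> n x) = (LINT x|lebesgue. indicator {c..r} x * w x * \<eta> n x)" for n
    proof -
      have "(LINT x|lebesgue_on {a<..<b}. w x * \<eta> n x) = (LINT x|lebesgue. indicator {a<..<b} x *\<^sub>R (w x * \<eta> n x))"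
        by (rule integral_restrict_space) simp
      also have "(\<lambda>x. indicator {a<..<b} x *\<^sub>R (w x * \<eta> n x)) = (\<lambda>x. indicator {c..r} x * w x * \<eta> n x)"
        using \<eta>0[of _ n] c rb by (auto simp: indicator_def fun_eq_iff)
      finally show ?thesis .
    qed
    \<comment> \<open>The limit is the indicator of a half-open interval: a step vanishes at its
      left end point and equals 1 at each point to the right of it once the width is small.\<close>
    moreover have "(\<lambda>n. LINT x|lebesgue. indicator {c..r} x * w x * \<eta> n x) \<longlonglongrightarrow>
        (LINT x|lebesgue. indicator {c..r} x * w x * indicator {c<..d} x)"
    proof (rule integral_dominated_convergence[where w="\<lambda>x. \<bar>indicator {c..r} x * w x\<bar>"])
      have \<eta>m: "\<eta> n \<in> borel_measurable lebesgue" for n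
      proof -
        have "continuous_on UNIV (\<eta> n)" unfolding \<eta>_def
          by (intro continuous_on_diff; rule continuous_at_imp_continuous_on)
            (auto intro!: DERIV_isCont smooth_step_has_real_derivative e0)
        then show ?thesis
          by (intro measurable_completion) (simp add: borel_measurable_continuous_onI)
      qed
      show "(\<lambda>x. indicator {c..r} x * w x * \<eta> n x) \<in> borel_measurable lebesgue" for n
        by (rule borel_measurable_times[OF borel_measurable_integrable[OF wr] \<eta>m])
      show "(\<lambda>x. indicator {c..r} x * w x * indicator {c<..d} x) \<in> borel_measurable lebesgue"
        by (rule borel_measurable_times[OF borel_measurable_integrable[OF wr]])
          (intro borel_measurable_indicator, simp)
      show "integrable lebesgue (\<lambda>x. \<bar>indicator {c..r} x * w x\<bar>)" using wr by simp
      show "AE x in lebesgue. norm (indicator {c..r} x * w x * \<eta> n x) \<le> \<bar>indicator {c..r} x * w x\<bar>" for n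
      proof (rule AE_I2)
        fix x
        have "\<bar>\<eta> n x\<bar> \<le> 1" using smooth_step_bounds[OF e0[of n], of c x] smooth_step_bounds[OF e0[of n], of d x]
          by (auto simp: \<eta>_def)
        then show "norm (indicator {c..r} x * w x * \<eta> n x) \<le> \<bar>indicator {c..r} x * w x\<bar>"
          unfolding norm_mult real_norm_def by (simp add: abs_mult mult_left_le)
      qed
      show "AE x in lebesgue. (\<lambda>n. indicator {c..r} x * w x * \<eta> n x) \<longlonglongrightarrow> indicator {c..r} x * w x * indicator {c<..d} x"
      proof (intro AE_I2 tendsto_mult_left tendsto_eventually)
        fix x
        have ev: "\<forall>\<^sub>F n in sequentially. p + e n \<le> x" if "p < x" for p
        proof -
          have "\<forall>\<^sub>F n in sequentially. e n < x - p"
            using e_lim that by (auto simp: filterlim_at intro: order_tendstoD(2))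
          then show ?thesis by eventually_elim simp
        qed
        consider "x \<le> c" | "c < x" "x \<le> d" | "d < x" by linarith
        then show "\<forall>\<^sub>F n in sequentially. \<eta> n x = indicator {c<..d} x"
        proof cases
          case 1
          then show ?thesis using c by (simp add: \<eta>_def smooth_step_eq_0)
        next
          case 2
          show ?thesis using ev[OF 2(1)]
            by eventually_elim (use 2 e0 in \<open>simp add: \<eta>_def smooth_step_eq_0 smooth_step_eq_1\<close>)
        next
          case 3
          show ?thesis using ev[OF 3]
            by eventually_elim (use 3 c e0 in \<open>simp add: \<eta>_def smooth_step_eq_1\<close>)
        qed
      qed
    qed
    moreover have "(LINT x|lebesgue. indicator {c..r} x * w x * indicator {c<..d} x) = integral {c..d} w"
    proof -
      have s: "set_integrable lebesgue {c<..d} w"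
        by (rule set_integrable_subset[OF wi[OF c(1,3)]]) auto
      have "(LINT x|lebesgue. indicator {c..r} x * w x * indicator {c<..d} x) = (LINT x:{c<..d}|lebesgue. w x)"
        unfolding set_lebesgue_integral_def
        by (rule Bochner_Integration.integral_cong) (use rb in \<open>auto simp: indicator_def\<close>)
      also have "\<dots> = integral {c<..d} w" by (rule set_lebesgue_integral_eq_integral[OF s])
      also have "\<dots> = integral {c..d} w"
        by (rule integral_subset_negligible)
          (auto intro!: negligible_subset[OF negligible_sing[of c]])
      finally show ?thesis .
    qed
    ultimately show ?thesis by simp
  qed
  have "v c - v d = - integral {c..d} w"
    using LIMSEQ_unique[OF L] tendsto_minus[OF R] unfolding eq by blast
  then show ?thesis by simp
qed

text \<open>Both functions have the same integral over every compact subinterval, so Lebesgue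
  differentiation applies to their difference.\<close>

lemma weak_deriv_AE_unique:
  assumes "has_weak_deriv a b v w" "has_weak_deriv a b v w'" "continuous_on {a..b} v"
  shows "AE x in lebesgue_on {a<..<b}. w x = w' x"
proof -
  have i: "w integrable_on {c..d}" "w' integrable_on {c..d}" if "a < c" "d < b" for c d
    using assms(1,2) that unfolding has_weak_deriv_def locally_integrable_def
    by (metis set_lebesgue_integral_eq_integral(1))+
  have "AE x in lebesgue_on {a<..<b}. w x - w' x = 0"
    by (rule AE_0_if_interval_integrals_0)
      (simp_all add: integrable_diff i integral_diff weak_deriv_FTC[OF assms(1,3)] weak_deriv_FTC[OF assms(2,3)])
  then show ?thesis by simp
qed

text \<open>Measurability is required whenever the chosen \<open>wderiv\<close> is replaced under an
  integral by an almost everywhere equal function; a compact exhaustion provides it.\<close>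

lemma locally_integrable_borel_measurable:
  assumes "locally_integrable a b w"
  shows "w \<in> borel_measurable (lebesgue_on {a<..<b})"
proof (rule borel_measurable_LIMSEQ_real)
  let ?S = "\<lambda>n. {a + 1 / real (Suc n)..b - 1 / real (Suc n)}"
  show "(\<lambda>x. indicator (?S n) x * w x) \<in> borel_measurable (lebesgue_on {a<..<b})" for n
  proof (rule measurable_restrict_space1)
    have "set_integrable lebesgue (?S n) w" using assms by (auto simp: locally_integrable_def)
    then show "(\<lambda>x. indicator (?S n) x * w x) \<in> borel_measurable lebesgue"
      by (auto simp: set_integrable_def dest: borel_measurable_integrable)
  qed
  fix x assume "x \<in> space (lebesgue_on {a<..<b})"
  then have "min (x - a) (b - x) > 0" by auto
  then have "\<forall>\<^sub>F n in sequentially. 1 / real (Suc n) < min (x - a) (b - x)"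
    using order_tendstoD(2)[OF LIMSEQ_inverse_real_of_nat] unfolding inverse_eq_divide by blast
  then have "\<forall>\<^sub>F n in sequentially. indicator (?S n) x * w x = w x"
    by eventually_elim (auto simp: indicator_def)
  then show "(\<lambda>n. indicator (?S n) x * w x) \<longlonglongrightarrow> w x" by (rule tendsto_eventually)
qed

section \<open>Primitives of bounded functions\<close>


text \<open>Lipschitz functions together with a bounded density of their increments, the common form
  of velocities, upwind maps and finite element functions. It involves neither test functions nor
  pointwise differentiability.\<close>

definition primitive_on :: "real \<Rightarrow> real \<Rightarrow> (real \<Rightarrow> real) \<Rightarrow> (real \<Rightarrow> real) \<Rightarrow> bool" where
  "primitive_on a b v w \<longleftrightarrow> bdd_meas a b w \<and> (\<forall>x\<in>{a..b}. v x = v a + integral {a..x} w)"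

lemma primitive_on_bdd_meas: "primitive_on a b v w \<Longrightarrow> bdd_meas a b w"
  by (simp add: primitive_on_def)

lemma integral_diff_Icc:
  assumes "bdd_meas a b f" "a \<le> x" "x \<le> y" "y \<le> b"
  shows "integral {a..y} f - integral {a..x} f = integral {x..y} f"
  using Henstock_Kurzweil_Integration.integral_combine[of a x y f] assms bdd_meas_integrable_on[of a b f a y]
  by simp

lemma primitive_on_FTC:
  assumes "primitive_on a b v w" "a \<le> x" "x \<le> y" "y \<le> b"
  shows "integral {x..y} w = v y - v x"
proof -
  have "v y = v a + integral {a..y} w" "v x = v a + integral {a..x} w"
    using assms unfolding primitive_on_def by (meson atLeastAtMost_iff order_trans)+
  then show ?thesis
    using integral_diff_Icc[OF primitive_on_bdd_meas[OF assms(1)] assms(2-4)] by linarith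
qed

lemma abs_integral_le_Ioo:
  fixes f :: "real \<Rightarrow> real"
  assumes "f integrable_on {x..y}" "x \<le> y" "\<And>z. z \<in> {x<..<y} \<Longrightarrow> \<bar>f z\<bar> \<le> e"
  shows "\<bar>integral {x..y} f\<bar> \<le> e * (y - x)"
proof -
  have "norm (integral {x<..<y} f) \<le> integral {x<..<y} (\<lambda>_. e)"
    by (rule integral_norm_bound_integral)
      (use assms in \<open>auto simp: integrable_on_open_interval_real\<close>)
  also have "integral {x<..<y} (\<lambda>_. e) = integral {x..y} (\<lambda>_. e)"
    by (rule integral_open_interval_real[symmetric])
  also have "\<dots> = e * (y - x)" using assms(2) by simp
  finally show ?thesis by (simp add: integral_open_interval_real)
qed

text \<open>Used to freeze the coefficients of an integrand at \<open>x\<close>; hence closeness is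
  only asked for at points no farther from \<open>x\<close> than \<open>y\<close>, and
  \<open>y\<close> may lie on either side.\<close>

lemma integral_increment_close:
  assumes f: "bdd_meas a b f" and g: "bdd_meas a b g" and xy: "x \<in> {a..b}" "y \<in> {a..b}"
    and le: "\<And>z. z \<in> {a<..<b} \<Longrightarrow> \<bar>z - x\<bar> \<le> \<bar>y - x\<bar> \<Longrightarrow> \<bar>f z - g z\<bar> \<le> e"
  shows "\<bar>(integral {a..y} f - integral {a..x} f) - (integral {a..y} g - integral {a..x} g)\<bar> \<le> e * \<bar>y - x\<bar>"
proof -
  have *: "\<bar>integral {p..q} f - integral {p..q} g\<bar> \<le> e * (q - p)"
    if "a \<le> p" "p \<le> q" "q \<le> b" "\<And>z. z \<in> {p<..<q} \<Longrightarrow> \<bar>f z - g z\<bar> \<le> e" for p q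
  proof -
    have "integral {p..q} f - integral {p..q} g = integral {p..q} (\<lambda>x. f x - g x)"
      by (rule integral_diff[symmetric]; rule bdd_meas_integrable_on) (use f g that in auto)
    also have "\<bar>\<dots>\<bar> \<le> e * (q - p)"
      by (rule abs_integral_le_Ioo) (use that f g in \<open>auto intro: bdd_meas_integrable_on\<close>)
    finally show ?thesis .
  qed
  show ?thesis
  proof (cases "x \<le> y")
    case True
    then show ?thesis
      using *[of x y] integral_diff_Icc[OF f, of x y] integral_diff_Icc[OF g, of x y] xy le by auto
  next
    case False
    then have "integral {a..x} f - integral {a..y} f = integral {y..x} f"
      "integral {a..x} g - integral {a..y} g = integral {y..x} g"
      using integral_diff_Icc[OF f, of y x] integral_diff_Icc[OF g, of y x] xy by auto
    moreover have "\<bar>integral {y..x} f - integral {y..x} g\<bar> \<le> e * (x - y)"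
      by (rule *) (use False xy le in auto)
    ultimately show ?thesis using False by auto
  qed
qed

lemma primitive_on_lipschitz:
  assumes v: "primitive_on a b v w" and B: "\<And>z. z \<in> {a<..<b} \<Longrightarrow> \<bar>w z\<bar> \<le> B"
    and xy: "x \<in> {a..b}" "y \<in> {a..b}"
  shows "\<bar>v y - v x\<bar> \<le> B * \<bar>y - x\<bar>"
proof -
  have "v y = v a + integral {a..y} w" "v x = v a + integral {a..x} w"
    using assms(1) xy unfolding primitive_on_def by blast+
  then show ?thesis
    using integral_increment_close[OF primitive_on_bdd_meas[OF v] bdd_meas_const[of a b 0] xy, of B] B
    by simp
qed

lemma primitive_on_continuous:
  assumes "primitive_on a b v w"
  shows "continuous_on {a..b} v"
proof -
  obtain B where B: "B > 0" "\<And>z. z \<in> {a<..<b} \<Longrightarrow> \<bar>w z\<bar> \<le> B"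
    using bdd_meas_bound[OF primitive_on_bdd_meas[OF assms]] by blast
  show ?thesis
    unfolding continuous_on_iff
  proof safe
    fix x e :: real assume "x \<in> {a..b}" "e > 0"
    then have "dist (v y) (v x) < e" if "y \<in> {a..b}" "dist y x < e / B" for y
      using primitive_on_lipschitz[OF assms B(2), of x y] that B(1)
      by (simp add: dist_real_def field_simps)
    then show "\<exists>d>0. \<forall>y\<in>{a..b}. dist y x < d \<longrightarrow> dist (v y) (v x) < e"
      using \<open>e > 0\<close> B(1) by (intro exI[of _ "e / B"]) auto
  qed
qed

lemma primitive_on_bdd: "primitive_on a b v w \<Longrightarrow> bdd_meas a b v"
  by (rule bdd_meas_continuous[OF primitive_on_continuous])

text \<open>
  Primitives of bounded functions need not be differentiable, so product and chain rule are obtained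
  from this criterion: the difference of the two sides has derivative zero \<^emph>\<open>everywhere\<close>.
\<close>

lemma primitive_onI:
  assumes w: "bdd_meas a b w"
    and loc: "\<And>x e. x \<in> {a..b} \<Longrightarrow> 0 < e \<Longrightarrow> \<exists>d>0. \<forall>y\<in>{a..b}. \<bar>y - x\<bar> < d \<longrightarrow>
      \<bar>(v y - v x) - (integral {a..y} w - integral {a..x} w)\<bar> \<le> e * \<bar>y - x\<bar>"
  shows "primitive_on a b v w"
  unfolding primitive_on_def
proof (intro conjI w ballI)
  fix x assume x: "x \<in> {a..b}"
  let ?D = "\<lambda>x. v x - integral {a..x} w"
  have "(?D has_derivative (\<lambda>_. 0)) (at x within {a..b})" if "x \<in> {a..b}" for x
    unfolding has_derivative_within_alt
  proof (intro conjI allI impI)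
    fix e :: real assume "e > 0"
    from loc[OF that this] obtain d where d: "d > 0" "\<forall>y\<in>{a..b}. \<bar>y - x\<bar> < d \<longrightarrow>
      \<bar>(v y - v x) - (integral {a..y} w - integral {a..x} w)\<bar> \<le> e * \<bar>y - x\<bar>" by blast
    then show "\<exists>d>0. \<forall>y\<in>{a..b}. norm (y - x) < d \<longrightarrow> norm (?D y - ?D x - 0) \<le> e * norm (y - x)"
      by (intro exI[of _ d]) (auto simp: algebra_simps)
  qed simp
  then have "?D a = ?D x"
    by (intro has_derivative_zero_unique[of "{a..b}" ?D a x]) (use x in auto)
  then show "v x = v a + integral {a..x} w" by simp
qed

lemma primitive_on_mult:
  assumes v: "primitive_on a b v w" and v': "primitive_on a b v' w'"
  shows "primitive_on a b (\<lambda>x. v x * v' x) (\<lambda>x. w x * v' x + v x * w' x)"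
proof (rule primitive_onI)
  note bm = primitive_on_bdd_meas[OF v] primitive_on_bdd_meas[OF v'] primitive_on_bdd[OF v] primitive_on_bdd[OF v']
  show m: "bdd_meas a b (\<lambda>x. w x * v' x + v x * w' x)"
    using bm by auto
  obtain B where B: "B > 0" "\<And>z. z \<in> {a<..<b} \<Longrightarrow> \<bar>w z\<bar> \<le> B"
    using bdd_meas_bound[OF bm(1)] by blast
  obtain B' where B': "B' > 0" "\<And>z. z \<in> {a<..<b} \<Longrightarrow> \<bar>w' z\<bar> \<le> B'"
    using bdd_meas_bound[OF bm(2)] by blast
  fix x e :: real assume x: "x \<in> {a..b}" and "e > 0"
  \<comment> \<open>The quadratic remainder has the factor \<open>3 * B * B'\<close>: one part from
    the product of the two increments, two from freezing.\<close>
  define d where "d = e / (3 * B * B')"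
  have "d > 0" using \<open>e > 0\<close> B B' by (simp add: d_def)
  moreover have "\<bar>(v y * v' y - v x * v' x) - (integral {a..y} (\<lambda>x. w x * v' x + v x * w' x)
        - integral {a..x} (\<lambda>x. w x * v' x + v x * w' x))\<bar> \<le> e * \<bar>y - x\<bar>"
    if y: "y \<in> {a..b}" "\<bar>y - x\<bar> < d" for y
  proof -
    let ?g = "\<lambda>z. v' x * w z + v x * w' z"
    have I: "integral {a..z} ?g = v' x * (v z - v a) + v x * (v' z - v' a)" if "z \<in> {a..b}" for z
    proof -
      have "integral {a..z} ?g = integral {a..z} (\<lambda>z. v' x * w z) + integral {a..z} (\<lambda>z. v x * w' z)"
        by (rule integral_add; rule bdd_meas_integrable_on) (use bm that in auto)
      then show ?thesis
        using primitive_on_FTC[OF v, of a z] primitive_on_FTC[OF v', of a z] that by simp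
    qed
    have "\<bar>(integral {a..y} (\<lambda>x. w x * v' x + v x * w' x) - integral {a..x} (\<lambda>x. w x * v' x + v x * w' x))
        - (integral {a..y} ?g - integral {a..x} ?g)\<bar> \<le> (2 * B * B' * \<bar>y - x\<bar>) * \<bar>y - x\<bar>"
    proof (rule integral_increment_close[OF m _ x y(1)])
      show "bdd_meas a b ?g" using bm by auto
      fix z assume z: "z \<in> {a<..<b}" "\<bar>z - x\<bar> \<le> \<bar>y - x\<bar>"
      have "w z * v' z + v z * w' z - ?g z = w z * (v' z - v' x) + w' z * (v z - v x)"
        by (simp add: algebra_simps)
      also have "\<bar>\<dots>\<bar> \<le> \<bar>w z\<bar> * \<bar>v' z - v' x\<bar> + \<bar>w' z\<bar> * \<bar>v z - v x\<bar>"
        by (rule order_trans[OF abs_triangle_ineq]) (simp add: abs_mult)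
      also have "\<dots> \<le> B * (B' * \<bar>z - x\<bar>) + B' * (B * \<bar>z - x\<bar>)"
        using z x B B' primitive_on_lipschitz[OF v B(2), of x z] primitive_on_lipschitz[OF v' B'(2), of x z]
        by (intro add_mono mult_mono) auto
      also have "\<dots> = 2 * B * B' * \<bar>z - x\<bar>" by (simp add: algebra_simps)
      also have "\<dots> \<le> 2 * B * B' * \<bar>y - x\<bar>" using z B B' by (intro mult_left_mono) auto
      finally show "\<bar>w z * v' z + v z * w' z - ?g z\<bar> \<le> 2 * B * B' * \<bar>y - x\<bar>" .
    qed
    moreover have "(v y * v' y - v x * v' x) - (integral {a..y} ?g - integral {a..x} ?g) = (v y - v x) * (v' y - v' x)"
      unfolding I[OF x] I[OF y(1)] by (simp add: algebra_simps)
    moreover have "\<bar>(v y - v x) * (v' y - v' x)\<bar> \<le> (B * \<bar>y - x\<bar>) * (B' * \<bar>y - x\<bar>)"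
      unfolding abs_mult using B B' x y primitive_on_lipschitz[OF v B(2), of x y] primitive_on_lipschitz[OF v' B'(2), of x y]
      by (intro mult_mono) auto
    ultimately have "\<bar>(v y * v' y - v x * v' x) - (integral {a..y} (\<lambda>x. w x * v' x + v x * w' x)
        - integral {a..x} (\<lambda>x. w x * v' x + v x * w' x))\<bar> \<le> (3 * B * B' * \<bar>y - x\<bar>) * \<bar>y - x\<bar>"
      by (simp add: algebra_simps)
    also have "\<dots> \<le> (3 * B * B' * d) * \<bar>y - x\<bar>"
      using y B B' by (intro mult_right_mono mult_left_mono) auto
    also have "3 * B * B' * d = e" using B B' by (simp add: d_def)
    finally show ?thesis .
  qed
  ultimately show "\<exists>d>0. \<forall>y\<in>{a..b}. \<bar>y - x\<bar> < d \<longrightarrow>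
    \<bar>(v y * v' y - v x * v' x) - (integral {a..y} (\<lambda>x. w x * v' x + v x * w' x)
        - integral {a..x} (\<lambda>x. w x * v' x + v x * w' x))\<bar> \<le> e * \<bar>y - x\<bar>" by blast
qed

lemma primitive_on_C1:
  assumes "continuous_on {a..b} f'" "\<And>x. x \<in> {a..b} \<Longrightarrow> (f has_real_derivative f' x) (at x within {a..b})"
  shows "primitive_on a b f f'"
  unfolding primitive_on_def
proof (intro conjI bdd_meas_continuous assms ballI)
  fix x assume "x \<in> {a..b}"
  then have "(f' has_integral (f x - f a)) {a..x}"
    by (intro fundamental_theorem_of_calculus)
      (auto simp: has_real_derivative_iff_has_vector_derivative[symmetric] intro!: DERIV_subset[OF assms(2)])
  then show "f x = f a + integral {a..x} f'" by (simp add: integral_unique)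
qed

text \<open>Only the outer function is differentiated. Its linear part at \<open>X x\<close> is the
  integral of \<open>\<gamma>\<close> with \<open>\<phi>\<close> frozen at \<open>X x\<close>, while
  \<open>X\<close> enters through its integral representation and the resulting Lipschitz
  bound.\<close>

lemma primitive_on_compose:
  assumes X: "primitive_on a b X \<gamma>" and img: "\<And>x. x \<in> {a..b} \<Longrightarrow> X x \<in> {a..b}"
    and \<phi>: "continuous_on {a..b} \<phi>"
    and \<Phi>: "\<And>x. x \<in> {a..b} \<Longrightarrow> (\<Phi> has_real_derivative \<phi> x) (at x within {a..b})"
  shows "primitive_on a b (\<lambda>x. \<Phi> (X x)) (\<lambda>x. \<phi> (X x) * \<gamma> x)"
proof (rule primitive_onI)
  note bm = primitive_on_bdd_meas[OF X]
  have cX: "continuous_on {a..b} X" by (rule primitive_on_continuous[OF X])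
  have c\<phi>: "continuous_on {a..b} (\<lambda>x. \<phi> (X x))"
    by (rule continuous_on_compose2[OF \<phi> cX]) (use img in auto)
  show m: "bdd_meas a b (\<lambda>x. \<phi> (X x) * \<gamma> x)"
    by (intro bdd_meas_mult bdd_meas_continuous c\<phi> bm)
  obtain B where B: "B > 0" "\<And>z. z \<in> {a<..<b} \<Longrightarrow> \<bar>\<gamma> z\<bar> \<le> B"
    using bdd_meas_bound[OF bm] by blast
  fix x e :: real assume x: "x \<in> {a..b}" and "e > 0"
  \<comment> \<open>Linearising and freezing contribute an error \<open>r * B\<close> each, whence
    the 2.\<close>
  define r where "r = e / (2 * B)"
  have r: "r > 0" using \<open>e > 0\<close> B by (simp add: r_def)
  have "(\<Phi> has_derivative (\<lambda>h. \<phi> (X x) * h)) (at (X x) within {a..b})"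
    using \<Phi>[OF img[OF x]] by (simp add: has_field_derivative_def)
  then obtain d1 where d1: "d1 > 0" "\<And>y. y \<in> {a..b} \<Longrightarrow> \<bar>y - X x\<bar> < d1 \<Longrightarrow>
      \<bar>\<Phi> y - \<Phi> (X x) - \<phi> (X x) * (y - X x)\<bar> \<le> r * \<bar>y - X x\<bar>"
    using r unfolding has_derivative_within_alt by (metis real_norm_def)
  obtain d2 where d2: "d2 > 0" "\<And>y. y \<in> {a..b} \<Longrightarrow> \<bar>y - x\<bar> < d2 \<Longrightarrow> \<bar>\<phi> (X y) - \<phi> (X x)\<bar> < r"
    using c\<phi> x r unfolding continuous_on_iff dist_real_def by metis
  define d where "d = min (d1 / B) d2"
  have "d > 0" using d1 d2 B by (simp add: d_def)
  moreover have "\<bar>(\<Phi> (X y) - \<Phi> (X x)) - (integral {a..y} (\<lambda>x. \<phi> (X x) * \<gamma> x)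
        - integral {a..x} (\<lambda>x. \<phi> (X x) * \<gamma> x))\<bar> \<le> e * \<bar>y - x\<bar>"
    if y: "y \<in> {a..b}" "\<bar>y - x\<bar> < d" for y
  proof -
    have lip: "\<bar>X y - X x\<bar> \<le> B * \<bar>y - x\<bar>" by (rule primitive_on_lipschitz[OF X B(2) x y(1)])
    have "B * \<bar>y - x\<bar> < d1" using y B by (simp add: d_def field_simps)
    then have "\<bar>\<Phi> (X y) - \<Phi> (X x) - \<phi> (X x) * (X y - X x)\<bar> \<le> r * \<bar>X y - X x\<bar>"
      using lip by (intro d1(2) img y) auto
    also have "\<dots> \<le> r * (B * \<bar>y - x\<bar>)" using lip r by (intro mult_left_mono) auto
    finally have 1: "\<bar>\<Phi> (X y) - \<Phi> (X x) - \<phi> (X x) * (X y - X x)\<bar> \<le> r * B * \<bar>y - x\<bar>" by simp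
    let ?g = "\<lambda>z. \<phi> (X x) * \<gamma> z"
    have I: "integral {a..z} ?g = \<phi> (X x) * (X z - X a)" if "z \<in> {a..b}" for z
      using primitive_on_FTC[OF X, of a z] that by simp
    have 2: "\<bar>(integral {a..y} (\<lambda>x. \<phi> (X x) * \<gamma> x) - integral {a..x} (\<lambda>x. \<phi> (X x) * \<gamma> x))
        - (integral {a..y} ?g - integral {a..x} ?g)\<bar> \<le> (r * B) * \<bar>y - x\<bar>"
    proof (rule integral_increment_close[OF m _ x y(1)])
      show "bdd_meas a b ?g" using bm by auto
      fix z assume z: "z \<in> {a<..<b}" "\<bar>z - x\<bar> \<le> \<bar>y - x\<bar>"
      have "\<bar>\<phi> (X z) - \<phi> (X x)\<bar> * \<bar>\<gamma> z\<bar> \<le> r * B"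
        using d2(2)[of z] z y B r by (intro mult_mono) (auto simp: d_def)
      then show "\<bar>\<phi> (X z) * \<gamma> z - ?g z\<bar> \<le> r * B"
        by (simp add: left_diff_distrib[symmetric] abs_mult)
    qed
    have "\<phi> (X x) * (X y - X x) = integral {a..y} ?g - integral {a..x} ?g"
      unfolding I[OF x] I[OF y(1)] by (simp add: algebra_simps)
    with 1 2 have "\<bar>(\<Phi> (X y) - \<Phi> (X x)) - (integral {a..y} (\<lambda>x. \<phi> (X x) * \<gamma> x)
        - integral {a..x} (\<lambda>x. \<phi> (X x) * \<gamma> x))\<bar> \<le> r * B * \<bar>y - x\<bar> + r * B * \<bar>y - x\<bar>"
      by linarith
    also have "\<dots> = e * \<bar>y - x\<bar>" using B by (simp add: r_def)
    finally show ?thesis .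
  qed
  ultimately show "\<exists>d>0. \<forall>y\<in>{a..b}. \<bar>y - x\<bar> < d \<longrightarrow>
    \<bar>(\<Phi> (X y) - \<Phi> (X x)) - (integral {a..y} (\<lambda>x. \<phi> (X x) * \<gamma> x)
        - integral {a..x} (\<lambda>x. \<phi> (X x) * \<gamma> x))\<bar> \<le> e * \<bar>y - x\<bar>" by blast
qed

lemma primitive_on_lincomb:
  assumes v: "primitive_on a b v w" and v': "primitive_on a b v' w'"
  shows "primitive_on a b (\<lambda>x. c * v x + d * v' x) (\<lambda>x. c * w x + d * w' x)"
  unfolding primitive_on_def
proof (intro conjI ballI)
  note bm = primitive_on_bdd_meas[OF v] primitive_on_bdd_meas[OF v']
  show "bdd_meas a b (\<lambda>x. c * w x + d * w' x)" using bm by auto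
  fix x assume x: "x \<in> {a..b}"
  have "integral {a..x} (\<lambda>x. c * w x + d * w' x) = integral {a..x} (\<lambda>x. c * w x) + integral {a..x} (\<lambda>x. d * w' x)"
    by (rule integral_add; rule bdd_meas_integrable_on) (use bm x in auto)
  moreover have "v x = v a + integral {a..x} w" "v' x = v' a + integral {a..x} w'"
    using v v' x unfolding primitive_on_def by blast+
  ultimately show "c * v x + d * v' x = c * v a + d * v' a + integral {a..x} (\<lambda>x. c * w x + d * w' x)"
    by (simp only: integral_mult_right distrib_left)
qed

text \<open>The product rule for \<open>v * \<eta>\<close>, which vanishes at both end
  points.\<close>

lemma primitive_on_weak_deriv:
  assumes "a < b" and v: "primitive_on a b v w"
  shows "has_weak_deriv a b v w"
  unfolding has_weak_deriv_def locally_integrable_def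
proof (intro conjI allI impI ballI)
  note bm = primitive_on_bdd_meas[OF v] primitive_on_bdd[OF v]
  show "set_integrable lebesgue {c..d} v" "set_integrable lebesgue {c..d} w" if "a < c \<and> d < b" for c d
    using bdd_meas_set_integrable that bm by blast+
  fix \<eta> assume "\<eta> \<in> test_functions a b"
  then obtain c d where \<eta>: "\<And>k x. ((deriv ^^ k) \<eta>) differentiable (at x)"
    and cd: "a < c" "d < b" "\<And>x. \<eta> x \<noteq> 0 \<Longrightarrow> c \<le> x \<and> x \<le> d"
    unfolding test_functions_def by blast
  have D: "(\<eta> has_real_derivative deriv \<eta> x) (at x)" for x
    using \<eta>[of 0 x] by (simp add: DERIV_deriv_iff_real_differentiable)
  have "continuous_on {a..b} (deriv \<eta>)"
    using \<eta>[of 1] by (intro continuous_at_imp_continuous_on ballI differentiable_imp_continuous_within) simp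
  then have p: "primitive_on a b \<eta> (deriv \<eta>)"
    by (rule primitive_on_C1) (rule has_field_derivative_at_within[OF D])
  have 0: "\<eta> a = 0" "\<eta> b = 0" using cd by force+
  note q = primitive_on_mult[OF v p]
  have "integral {a..b} (\<lambda>x. w x * \<eta> x + v x * deriv \<eta> x) = 0"
    using primitive_on_FTC[OF q, of a b] \<open>a < b\<close> 0 by simp
  moreover have "integral {a..b} (\<lambda>x. w x * \<eta> x + v x * deriv \<eta> x) =
      integral {a..b} (\<lambda>x. w x * \<eta> x) + integral {a..b} (\<lambda>x. v x * deriv \<eta> x)"
    by (rule integral_add; rule bdd_meas_integrable_on[where a=a and b=b])
      (use bm primitive_on_bdd[OF p] primitive_on_bdd_meas[OF p] in auto)
  moreover have "(LINT x|lebesgue_on {a<..<b}. v x * deriv \<eta> x) = integral {a..b} (\<lambda>x. v x * deriv \<eta> x)"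
    "(LINT x|lebesgue_on {a<..<b}. w x * \<eta> x) = integral {a..b} (\<lambda>x. w x * \<eta> x)"
    using bm primitive_on_bdd[OF p] primitive_on_bdd_meas[OF p] by (auto intro: bdd_meas_LINT)
  ultimately show "(LINT x|lebesgue_on {a<..<b}. v x * deriv \<eta> x) = - (LINT x|lebesgue_on {a<..<b}. w x * \<eta> x)"
    by simp
qed

text \<open>Pins down the choice made in \<open>wderiv\<close>: a weak derivative exists, and any
  two agree almost everywhere.\<close>

lemma wderiv_primitive_on:
  assumes "a < b" "primitive_on a b v w"
  shows "has_weak_deriv a b v (wderiv a b v)"
    and "AE x in lebesgue_on {a<..<b}. wderiv a b v x = w x"
    and "wderiv a b v \<in> borel_measurable (lebesgue_on {a<..<b})"
proof -
  note wd = primitive_on_weak_deriv[OF assms]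
  then show *: "has_weak_deriv a b v (wderiv a b v)"
    unfolding wderiv_def by (rule someI[where P="has_weak_deriv a b v"])
  then show "AE x in lebesgue_on {a<..<b}. wderiv a b v x = w x"
    by (rule weak_deriv_AE_unique[OF _ wd primitive_on_continuous[OF assms(2)]])
  show "wderiv a b v \<in> borel_measurable (lebesgue_on {a<..<b})"
    using * by (intro locally_integrable_borel_measurable) (simp add: has_weak_deriv_def)
qed

section \<open>Essentially bounded derivatives and their bounded representatives\<close>

lemma AE_abs_le_Linf_norm:
  assumes "v \<in> Linf_space a b"
  shows "AE x in lebesgue_on {a<..<b}. \<bar>v x\<bar> \<le> Linf_norm a b v"
proof (cases "a < b")
  case True
  let ?M = "lebesgue_on {a<..<b}"
  have m: "(\<lambda>x. ereal \<bar>v x\<bar>) \<in> borel_measurable ?M"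
    using assms by (auto simp: Linf_space_def)
  \<comment> \<open>\<open>real_of_ereal\<close> is faithful on finite values only. Minus infinity
    is excluded by comparison with 0 on a set of positive measure.\<close>
  have "0 \<le> Linf_esssup a b v"
  proof -
    have "esssup ?M (\<lambda>x. 0 :: ereal) \<le> Linf_esssup a b v"
      unfolding Linf_esssup_def by (rule esssup_mono) auto
    moreover have "esssup ?M (\<lambda>x. 0 :: ereal) = 0"
      by (rule esssup_const) (use True in \<open>simp add: emeasure_restrict_space\<close>)
    ultimately show ?thesis by simp
  qed
  then have "Linf_esssup a b v = ereal (Linf_norm a b v)"
    using assms unfolding Linf_norm_def Linf_space_def
    by (intro ereal_real'[symmetric]) auto
  moreover have "AE x in ?M. ereal \<bar>v x\<bar> \<le> Linf_esssup a b v"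
    unfolding Linf_esssup_def by (rule esssup_AE)
  ultimately show ?thesis by simp
next
  case False
  then have "space (lebesgue_on {a<..<b}) = {}" by simp
  then show ?thesis by (simp add: AE_restrict_space_iff)
qed

lemma Linf_norm_le:
  assumes "v \<in> borel_measurable (lebesgue_on {a<..<b})" "AE x in lebesgue_on {a<..<b}. \<bar>v x\<bar> \<le> B" "0 \<le> B"
  shows "Linf_norm a b v \<le> B" "v \<in> Linf_space a b"
proof -
  have "Linf_esssup a b v \<le> ereal B"
    unfolding Linf_esssup_def using assms by (intro esssup_I) auto
  then show "Linf_norm a b v \<le> B" "v \<in> Linf_space a b"
    using assms by (cases "Linf_esssup a b v"; auto simp: Linf_norm_def Linf_space_def)+
qed

text \<open>Setting \<open>wderiv\<close> to 0 on the null set where it exceeds its norm gives an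
  everywhere bounded function that is still a weak derivative, so the fundamental theorem applies to
  it inside the interval.\<close>

lemma W1inf_primitive_on:
  assumes "a < b" "v \<in> W1inf_space a b"
  obtains w where "primitive_on a b v w" "\<And>x. \<bar>w x\<bar> \<le> Linf_norm a b (wderiv a b v)"
proof -
  from assms obtain w where w: "w \<in> Linf_space a b" "has_weak_deriv a b v w" and v: "continuous_on {a..b} v"
    by (auto simp: W1inf_space_def)
  have wd: "has_weak_deriv a b v (wderiv a b v)"
    unfolding wderiv_def by (rule someI[where P="has_weak_deriv a b v", OF w(2)])
  have eq: "AE x in lebesgue_on {a<..<b}. wderiv a b v x = w x"
    by (rule weak_deriv_AE_unique[OF wd w(2) v])
  have m: "wderiv a b v \<in> borel_measurable (lebesgue_on {a<..<b})"
    using wd by (intro locally_integrable_borel_measurable) (simp add: has_weak_deriv_def)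
  let ?B = "Linf_norm a b (wderiv a b v)"
  have "AE x in lebesgue_on {a<..<b}. \<bar>wderiv a b v x\<bar> \<le> max 0 (Linf_norm a b w)"
    using eq AE_abs_le_Linf_norm[OF w(1)] by eventually_elim auto
  then have "wderiv a b v \<in> Linf_space a b" by (rule Linf_norm_le(2)[OF m]) simp
  then have le: "AE x in lebesgue_on {a<..<b}. \<bar>wderiv a b v x\<bar> \<le> ?B"
    by (rule AE_abs_le_Linf_norm)
  \<comment> \<open>A negative bound on an absolute value fails at every point of an interval of
    positive length.\<close>
  have "?B \<ge> 0"
  proof (rule ccontr)
    assume "\<not> 0 \<le> ?B"
    then have "AE x in lebesgue_on {a<..<b}. False" using le by (elim AE_mp) (auto intro!: AE_I2)
    then have "emeasure lebesgue {a<..<b} = 0"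
      by (subst (asm) AE_iff_measurable[of "{a<..<b}"]) (auto simp: emeasure_restrict_space)
    then show False using assms(1) by simp
  qed
  define g where "g = (\<lambda>x. if \<bar>wderiv a b v x\<bar> \<le> ?B then wderiv a b v x else 0)"
  have bg: "\<bar>g x\<bar> \<le> ?B" for x using \<open>?B \<ge> 0\<close> by (auto simp: g_def)
  have gm: "g \<in> borel_measurable (lebesgue_on {a<..<b})"
    unfolding g_def using m by measurable
  have bmg: "bdd_meas a b g"
    using bg gm by (auto simp: bdd_meas_def)
  have ge: "AE x in lebesgue_on {a<..<b}. wderiv a b v x = g x"
    using le by eventually_elim (simp add: g_def)
  have wg: "has_weak_deriv a b v g"
    unfolding has_weak_deriv_def
  proof (intro conjI ballI)
    show "locally_integrable a b v" using wd by (simp add: has_weak_deriv_def)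
    show "locally_integrable a b g"
      using bdd_meas_set_integrable[OF bmg] by (auto simp: locally_integrable_def)
    fix \<eta> assume "\<eta> \<in> test_functions a b"
    then have d: "\<And>x. \<eta> differentiable (at x)"
      unfolding test_functions_def by (metis (mono_tags, lifting) funpow_0 mem_Collect_eq)
    have "continuous_on {a..b} \<eta>"
      by (intro continuous_at_imp_continuous_on ballI differentiable_imp_continuous_within d)
    then have \<eta>m: "\<eta> \<in> borel_measurable (lebesgue_on {a<..<b})"
      using bdd_meas_continuous by (auto simp: bdd_meas_def)
    have "(LINT x|lebesgue_on {a<..<b}. wderiv a b v x * \<eta> x) = (LINT x|lebesgue_on {a<..<b}. g x * \<eta> x)"
      by (rule integral_cong_AE) (use m gm \<eta>m ge in \<open>auto elim!: AE_mp\<close>)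
    then show "(LINT x|lebesgue_on {a<..<b}. v x * deriv \<eta> x) = - (LINT x|lebesgue_on {a<..<b}. g x * \<eta> x)"
      using wd \<open>\<eta> \<in> test_functions a b\<close> by (simp add: has_weak_deriv_def)
  qed
  have "primitive_on a b v g"
  proof -
    have ci: "continuous_on {a..b} (\<lambda>x. integral {a..x} g)"
      by (rule indefinite_integral_continuous_1[OF bdd_meas_integrable_on[OF bmg]]) auto
    let ?D = "\<lambda>x. v x - integral {a..x} g"
    let ?m = "(a + b) / 2"
    have cD: "continuous_on {a..b} ?D" by (intro continuous_on_diff v ci)
    have cst: "?D x = ?D ?m" if "x \<in> {a<..<b}" for x
    proof (cases "x \<le> ?m")
      case True
      then show ?thesis using weak_deriv_FTC[OF wg v, of x ?m] integral_diff_Icc[OF bmg, of x ?m] that by auto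
    next
      case False
      then show ?thesis using weak_deriv_FTC[OF wg v, of ?m x] integral_diff_Icc[OF bmg, of ?m x] that assms(1) by auto
    qed
    \<comment> \<open>Constancy on the open interval passes to the end points by continuity.\<close>
    have cl: "closure {a<..<b} = {a..b}" using assms(1) by simp
    have "?D x = ?D ?m" if "x \<in> {a..b}" for x
      by (rule continuous_constant_on_closure[of "{a<..<b}" ?D, unfolded cl, OF cD cst that])
    moreover have "a \<in> {a..b}" using assms(1) by simp
    ultimately have D: "?D x = ?D a" if "x \<in> {a..b}" for x using that by metis
    have "v x = v a + integral {a..x} g" if "x \<in> {a..b}" for x
    proof -
      have "integral {a..a} g = 0" by simp
      with D[OF that] show ?thesis by linarith
    qed
    then show ?thesis using bmg unfolding primitive_on_def by blast
  qed
  then show ?thesis using that bg by blast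
qed

section \<open>Pull-backs along the upwind maps, finite elements and dual norms\<close>


lemma L2_inner_eq_integral:
  assumes "bdd_meas a b v" "bdd_meas a b w"
  shows "L2_inner a b v w = integral {a..b} (\<lambda>x. v x * w x)"
  unfolding L2_inner_def by (rule bdd_meas_LINT) (use assms in auto)

lemma L2_inner_cong_AE:
  assumes "v \<in> borel_measurable (lebesgue_on {a<..<b})" "v' \<in> borel_measurable (lebesgue_on {a<..<b})"
    "w \<in> borel_measurable (lebesgue_on {a<..<b})" "w' \<in> borel_measurable (lebesgue_on {a<..<b})"
    "AE x in lebesgue_on {a<..<b}. v x = v' x" "AE x in lebesgue_on {a<..<b}. w x = w' x"
  shows "L2_inner a b v w = L2_inner a b v' w'"
proof -
  have "AE x in lebesgue_on {a<..<b}. v x * w x = v' x * w' x"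
    using assms(5,6) by eventually_elim simp
  then show ?thesis
    unfolding L2_inner_def using assms(1-4) by (intro integral_cong_AE) auto
qed

lemma L2_inner_commute: "L2_inner a b v w = L2_inner a b w v"
  by (simp add: L2_inner_def mult.commute)

lemma L2_inner_self_nonneg: "0 \<le> L2_inner a b v v"
  by (simp add: L2_inner_def)

lemma L2_norm_power2: "(L2_norm a b v)\<^sup>2 = L2_inner a b v v"
  by (simp add: L2_norm_def L2_inner_self_nonneg)

lemma L2_inner_lincomb:
  assumes "bdd_meas a b v" "bdd_meas a b v'" "bdd_meas a b w"
  shows "L2_inner a b (\<lambda>x. c * v x + d * v' x) w = c * L2_inner a b v w + d * L2_inner a b v' w"
proof -
  have 1: "integrable (lebesgue_on {a<..<b}) (\<lambda>x. v x * w x)"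
    "integrable (lebesgue_on {a<..<b}) (\<lambda>x. v' x * w x)"
    using assms by (auto intro!: bdd_meas_integrable)
  have "L2_inner a b (\<lambda>x. c * v x + d * v' x) w =
      (LINT x|lebesgue_on {a<..<b}. c * (v x * w x) + d * (v' x * w x))"
    unfolding L2_inner_def by (rule Bochner_Integration.integral_cong) (auto simp: algebra_simps)
  also have "\<dots> = c * L2_inner a b v w + d * L2_inner a b v' w"
    using 1 by (simp add: L2_inner_def)
  finally show ?thesis .
qed

text \<open>The squared norm of \<open>x p + y q + z r\<close>, expanded. Its instances give Young's
  inequality and, with the coefficients \<open>(2, -1, 0)\<close>, \<open>(1, -1, 0)\<close> and
  \<open>(1, -2, 1)\<close>, the inequalities for the energy.\<close>

lemma L2_inner_lincomb3_self_nonneg: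
  assumes "bdd_meas a b p" "bdd_meas a b q" "bdd_meas a b r"
  shows "0 \<le> x\<^sup>2 * L2_inner a b p p + y\<^sup>2 * L2_inner a b q q + z\<^sup>2 * L2_inner a b r r
    + 2 * x * y * L2_inner a b p q + 2 * x * z * L2_inner a b p r + 2 * y * z * L2_inner a b q r"
proof -
  let ?s = "\<lambda>t. x * p t + y * q t" and ?t = "\<lambda>t. 1 * (x * p t + y * q t) + z * r t"
  have s: "bdd_meas a b ?s" and t: "bdd_meas a b ?t"
    by (intro bdd_meas_add bdd_meas_cmult assms)+
  have *: "L2_inner a b ?t w = x * L2_inner a b p w + y * L2_inner a b q w + z * L2_inner a b r w"
    if "bdd_meas a b w" for w
    by (simp only: L2_inner_lincomb[OF s assms(3) that] L2_inner_lincomb[OF assms(1,2) that]) simp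
  have "0 \<le> L2_inner a b ?t ?t" by (rule L2_inner_self_nonneg)
  also have "\<dots> = x * L2_inner a b ?t p + y * L2_inner a b ?t q + z * L2_inner a b ?t r"
    by (simp only: *[OF t] L2_inner_commute[of a b _ ?t])
  also have "\<dots> = x\<^sup>2 * L2_inner a b p p + y\<^sup>2 * L2_inner a b q q + z\<^sup>2 * L2_inner a b r r
    + 2 * x * y * L2_inner a b p q + 2 * x * z * L2_inner a b p r + 2 * y * z * L2_inner a b q r"
    unfolding *[OF assms(1)] *[OF assms(2)] *[OF assms(3)]
      L2_inner_commute[of a b q p] L2_inner_commute[of a b r p] L2_inner_commute[of a b r q]
    by (simp add: algebra_simps power2_eq_square)
  finally show ?thesis .
qed

lemma L2_inner_Young:
  assumes "bdd_meas a b v" "bdd_meas a b w" "e > 0"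
  shows "\<bar>L2_inner a b v w\<bar> \<le> e * L2_inner a b w w + L2_inner a b v v / (4 * e)"
proof -
  \<comment> \<open>The squared norm of \<open>v + s * (2 * e) * w\<close>; the two signs of
    \<open>s\<close> produce the absolute value.\<close>
  have *: "0 \<le> L2_inner a b v v + (2 * e)\<^sup>2 * L2_inner a b w w + s * (4 * e * L2_inner a b v w)" if "s = 1 \<or> s = -1" for s
    using L2_inner_lincomb3_self_nonneg[OF assms(1,2,2), of 1 "s * (2 * e)" 0] that by auto
  have "4 * e * \<bar>L2_inner a b v w\<bar> \<le> L2_inner a b v v + (2 * e)\<^sup>2 * L2_inner a b w w"
    using *[of 1] *[of "-1"] assms(3) by (simp add: abs_if)
  also have "\<dots> = 4 * e * (e * L2_inner a b w w + L2_inner a b v v / (4 * e))"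
    using assms(3) by (simp add: field_simps power2_eq_square)
  finally show ?thesis using assms(3) by simp
qed

section \<open>Increment of a primitive along a displacement\<close>

lemma integral_power2_le:
  fixes \<phi> :: "real \<Rightarrow> real"
  assumes "continuous_on {p..q} \<phi>" "p \<le> q"
  shows "(integral {p..q} \<phi>)\<^sup>2 \<le> (q - p) * integral {p..q} (\<lambda>x. (\<phi> x)\<^sup>2)"
proof (cases "p = q")
  case False
  then have pq: "p < q" using assms by simp
  let ?I = "integral {p..q} \<phi>" and ?J = "integral {p..q} (\<lambda>x. (\<phi> x)\<^sup>2)"
  \<comment> \<open>The mean value: Cauchy-Schwarz against a constant is nonnegativity of the
    variance.\<close>
  define m where "m = ?I / (q - p)"
  have "0 \<le> integral {p..q} (\<lambda>x. (\<phi> x - m)\<^sup>2)"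
    by (intro integral_nonneg integrable_continuous_real continuous_intros assms) simp
  also have "integral {p..q} (\<lambda>x. (\<phi> x - m)\<^sup>2) = integral {p..q} (\<lambda>x. ((\<phi> x)\<^sup>2 - (2 * m) * \<phi> x) + m\<^sup>2)"
    by (rule integral_cong) (simp add: power2_eq_square algebra_simps)
  also have "\<dots> = integral {p..q} (\<lambda>x. (\<phi> x)\<^sup>2 - (2 * m) * \<phi> x) + integral {p..q} (\<lambda>x. m\<^sup>2)"
    by (intro integral_add integrable_continuous_real continuous_intros assms)
  also have "integral {p..q} (\<lambda>x. (\<phi> x)\<^sup>2 - (2 * m) * \<phi> x) = ?J - integral {p..q} (\<lambda>x. (2 * m) * \<phi> x)"
    by (intro integral_diff integrable_continuous_real continuous_intros assms)
  also have "\<dots> = ?J - 2 * m * ?I" by (simp only: integral_mult_right)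
  also have "integral {p..q} (\<lambda>x. m\<^sup>2) = m\<^sup>2 * (q - p)" using pq by simp
  finally have "0 \<le> (q - p) * (?J - 2 * m * ?I + m\<^sup>2 * (q - p))"
    using pq by simp
  also have "\<dots> = (q - p) * ?J - ?I\<^sup>2"
  proof -
    have I: "?I = m * (q - p)" using pq by (simp add: m_def)
    show ?thesis unfolding I by (simp add: power2_eq_square algebra_simps)
  qed
  finally show ?thesis by simp
qed simp

text \<open>By Cauchy-Schwarz on the segment between \<open>x\<close> and \<open>y x\<close>, the
  squared increment is at most \<open>\<delta>\<close> times the integral of
  \<open>\<phi>\<^sup>2\<close> over the part of \<open>[x - \<delta>, x + \<delta>]\<close> in
  \<open>[a, b]\<close>, itself an increment of the primitive \<open>H\<close>. Integrating in
  \<open>x\<close> compares two translates of that primitive, so \<open>y\<close> is never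
  inverted.\<close>

lemma integral_power2_primitive_increment_le:
  fixes a b \<delta> :: real and \<phi> y :: "real \<Rightarrow> real"
  assumes ab: "a < b" and \<phi>: "continuous_on {a..b} \<phi>" and y: "continuous_on {a..b} y"
    and img: "\<And>x. x \<in> {a..b} \<Longrightarrow> y x \<in> {a..b}" and le: "\<And>x. x \<in> {a..b} \<Longrightarrow> \<bar>y x - x\<bar> \<le> \<delta>"
  shows "integral {a..b} (\<lambda>x. (integral {a..y x} \<phi> - integral {a..x} \<phi>)\<^sup>2)
    \<le> 2 * \<delta>\<^sup>2 * integral {a..b} (\<lambda>x. (\<phi> x)\<^sup>2)"
proof -
  define H where "H = (\<lambda>x. integral {a..x} (\<lambda>x. (\<phi> x)\<^sup>2))"
  \<comment> \<open>Continues \<open>H\<close> by constants, since \<open>x - \<delta>\<close> and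
    \<open>x + \<delta>\<close> may leave \<open>[a, b]\<close>.\<close>
  define G where "G = (\<lambda>x. H (max a (min b x)))"
  let ?\<Phi> = "\<lambda>x. integral {a..x} \<phi>"
  have \<delta>: "\<delta> \<ge> 0" using le[of a] ab abs_ge_zero[of "y a - a"] by (simp del: abs_ge_zero)
  have i2: "(\<lambda>x. (\<phi> x)\<^sup>2) integrable_on {p..q}" if "a \<le> p" "q \<le> b" for p q
    using that by (intro integrable_continuous_real continuous_intros continuous_on_subset[OF \<phi>]) auto
  have cH: "continuous_on {a..b} H" unfolding H_def by (rule indefinite_integral_continuous_1[OF i2]) auto
  have cG: "continuous_on S G" for S unfolding G_def
    by (rule continuous_on_compose2[OF cH]) (use ab in \<open>auto intro!: continuous_intros\<close>)
  have Hmono: "H p \<le> H q" if "a \<le> p" "p \<le> q" "q \<le> b" for p q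
    unfolding H_def by (rule integral_subset_le) (use that i2 in auto)
  have Gmono: "G p \<le> G q" if "p \<le> q" for p q
    unfolding G_def by (rule Hmono) (use that ab in auto)
  have G0: "0 \<le> G p" for p
    unfolding G_def H_def by (rule integral_nonneg[OF i2]) (use ab in auto)
  have Gb: "G p \<le> H b" for p
    unfolding G_def by (rule Hmono) (use ab in auto)
  have c\<Phi>: "continuous_on {a..b} ?\<Phi>"
    by (rule indefinite_integral_continuous_1[OF integrable_continuous_real[OF \<phi>]])
  have c\<Phi>y: "continuous_on {a..b} (\<lambda>x. ?\<Phi> (y x))"
    by (rule continuous_on_compose2[OF c\<Phi> y]) (use img in auto)
  have pw: "(?\<Phi> q - ?\<Phi> p)\<^sup>2 \<le> \<delta> * (G q - G p)" if "a \<le> p" "p \<le> q" "q \<le> b" "q - p \<le> \<delta>" for p q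
  proof -
    have "?\<Phi> q - ?\<Phi> p = integral {p..q} \<phi>"
      by (rule integral_diff_Icc[OF bdd_meas_continuous[OF \<phi>]]) (use that in auto)
    moreover have "(integral {p..q} \<phi>)\<^sup>2 \<le> (q - p) * integral {p..q} (\<lambda>x. (\<phi> x)\<^sup>2)"
      by (rule integral_power2_le) (use that \<phi> in \<open>auto intro: continuous_on_subset\<close>)
    moreover have "H q - H p = integral {p..q} (\<lambda>x. (\<phi> x)\<^sup>2)" unfolding H_def
      by (rule integral_diff_Icc[of a b]) (use that in \<open>auto intro!: bdd_meas_continuous continuous_intros \<phi>\<close>)
    ultimately have "(?\<Phi> q - ?\<Phi> p)\<^sup>2 \<le> (q - p) * (H q - H p)" by simp
    also have "\<dots> \<le> \<delta> * (H q - H p)" using that Hmono[of p q] by (intro mult_right_mono) auto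
    also have "\<dots> = \<delta> * (G q - G p)" using that by (simp add: G_def min_def max_def)
    finally show ?thesis .
  qed
  have "integral {a..b} (\<lambda>x. (?\<Phi> (y x) - ?\<Phi> x)\<^sup>2) \<le> integral {a..b} (\<lambda>x. \<delta> * (G (x + \<delta>) - G (x + - \<delta>)))"
  proof (rule integral_le)
    show "(\<lambda>x. (?\<Phi> (y x) - ?\<Phi> x)\<^sup>2) integrable_on {a..b}"
      by (intro integrable_continuous_real continuous_intros c\<Phi> c\<Phi>y)
    show "(\<lambda>x. \<delta> * (G (x + \<delta>) - G (x + - \<delta>))) integrable_on {a..b}"
      by (intro integrable_continuous_real continuous_intros continuous_on_compose2[OF cG[of UNIV]]) auto
    fix x assume x: "x \<in> {a..b}"
    have "(?\<Phi> (y x) - ?\<Phi> x)\<^sup>2 \<le> \<delta> * (G (max x (y x)) - G (min x (y x)))"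
    proof (cases "x \<le> y x")
      case True
      then show ?thesis using pw[of x "y x"] img[OF x] le[OF x] x by auto
    next
      case False
      then show ?thesis using pw[of "y x" x] img[OF x] le[OF x] x by (auto simp: power2_commute)
    qed
    also have "\<dots> \<le> \<delta> * (G (x + \<delta>) - G (x + - \<delta>))"
      using le[OF x] \<delta> by (intro mult_left_mono diff_mono Gmono) (auto simp: max_def min_def)
    finally show "(?\<Phi> (y x) - ?\<Phi> x)\<^sup>2 \<le> \<delta> * (G (x + \<delta>) - G (x + - \<delta>))" .
  qed
  also have "\<dots> = \<delta> * (integral {a..b} (\<lambda>x. G (x + \<delta>)) - integral {a..b} (\<lambda>x. G (x + - \<delta>)))"
    by (subst integral_mult_right, subst integral_diff)
      (auto intro!: integrable_continuous_real continuous_intros continuous_on_compose2[OF cG[of UNIV]])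
  also have "\<dots> \<le> \<delta> * (2 * \<delta> * H b)"
  proof (intro mult_left_mono \<delta>)
    have sh: "integral {a..b} (\<lambda>x. G (x + c)) = integral {a+c..b+c} G" for c
    proof -
      have "integral {a..b} (G \<circ> (\<lambda>x. x + c)) = integral {a+c..b+c} G"
        by (rule integral_shift[OF cG])
      then show ?thesis by (simp add: o_def)
    qed
    have GI: "G integrable_on {p..q}" for p q by (intro integrable_continuous_real cG)
    have s: "integral {p..q} G + integral {q..r} G = integral {p..r} G" if "p \<le> q" "q \<le> r" for p q r
      by (rule Henstock_Kurzweil_Integration.integral_combine) (use that GI in auto)
    \<comment> \<open>Splitting \<open>[a - \<delta>, b + \<delta>]\<close> at
      \<open>a + \<delta>\<close> and at \<open>b - \<delta>\<close> is valid for
      \<open>\<delta>\<close> of any size. Only strips of width \<open>2 * \<delta>\<close> survive,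
      which is the source of the factor 2.\<close>
    have "integral {a+\<delta>..b+\<delta>} G - integral {a-\<delta>..b-\<delta>} G = integral {b-\<delta>..b+\<delta>} G - integral {a-\<delta>..a+\<delta>} G"
      using s[of "a-\<delta>" "a+\<delta>" "b+\<delta>"] s[of "a-\<delta>" "b-\<delta>" "b+\<delta>"] \<delta> ab by auto
    also have "\<dots> \<le> integral {b-\<delta>..b+\<delta>} G"
      using integral_nonneg[OF GI] G0 by simp
    also have "\<dots> \<le> integral {b-\<delta>..b+\<delta>} (\<lambda>_. H b)"
      by (rule integral_le) (use GI Gb in auto)
    also have "\<dots> = 2 * \<delta> * H b" using \<delta> by simp
    finally show "integral {a..b} (\<lambda>x. G (x + \<delta>)) - integral {a..b} (\<lambda>x. G (x + - \<delta>)) \<le> 2 * \<delta> * H b"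
      unfolding sh by simp
  qed
  finally show ?thesis by (simp add: H_def power2_eq_square)
qed

text \<open>
  Integrating by parts, the pull-back \<open>(\<phi> \<circ> X) \<gamma>\<close> differs from \<open>\<phi>\<close> by the derivative of
  \<open>\<Phi> \<circ> X - \<Phi>\<close>, where \<open>\<Phi>\<close> is a primitive of \<open>\<phi>\<close>; this function is of order \<open>\<delta>\<close> in \<open>L\<^sup>2\<close>
  and vanishes on the boundary.
\<close>

lemma pullback_L2_inner_close:
  assumes ab: "a < b" and \<phi>: "continuous_on {a..b} \<phi>" and X: "primitive_on a b X \<gamma>"
    and img: "\<And>x. x \<in> {a..b} \<Longrightarrow> X x \<in> {a..b}" and le: "\<And>x. x \<in> {a..b} \<Longrightarrow> \<bar>X x - x\<bar> \<le> \<delta>"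
    and bd: "X a = a" "X b = b" and \<psi>: "primitive_on a b \<psi> \<sigma>" and "e > 0"
  shows "bdd_meas a b (\<lambda>x. \<phi> (X x) * \<gamma> x)"
    and "\<bar>L2_inner a b (\<lambda>x. \<phi> (X x) * \<gamma> x) \<psi> - L2_inner a b \<phi> \<psi>\<bar>
      \<le> e * L2_inner a b \<sigma> \<sigma> + \<delta>\<^sup>2 / (2 * e) * L2_inner a b \<phi> \<phi>"
proof -
  define \<Phi> where "\<Phi> = (\<lambda>x. integral {a..x} \<phi>)"
  have D: "(\<Phi> has_real_derivative \<phi> x) (at x within {a..b})" if "x \<in> {a..b}" for x
    unfolding \<Phi>_def using integral_has_real_derivative[OF \<phi> that] .
  have p1: "primitive_on a b (\<lambda>x. \<Phi> (X x)) (\<lambda>x. \<phi> (X x) * \<gamma> x)"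
    by (rule primitive_on_compose[OF X img \<phi> D])
  have p2: "primitive_on a b \<Phi> \<phi>" by (rule primitive_on_C1[OF \<phi> D])
  show bm: "bdd_meas a b (\<lambda>x. \<phi> (X x) * \<gamma> x)" by (rule primitive_on_bdd_meas[OF p1])
  \<comment> \<open>The factors 1 and -1 put the difference into the form of the linear combination
    lemmas.\<close>
  let ?R = "\<lambda>x. 1 * \<Phi> (X x) + (-1) * \<Phi> x" and ?r = "\<lambda>x. 1 * (\<phi> (X x) * \<gamma> x) + (-1) * \<phi> x"
  have R: "primitive_on a b ?R ?r" by (rule primitive_on_lincomb[OF p1 p2])
  note bR = primitive_on_bdd[OF R] primitive_on_bdd_meas[OF R]
  note b\<psi> = primitive_on_bdd[OF \<psi>] primitive_on_bdd_meas[OF \<psi>]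
  have "integral {a..b} (\<lambda>x. ?r x * \<psi> x + ?R x * \<sigma> x) = 0"
    using primitive_on_FTC[OF primitive_on_mult[OF R \<psi>], of a b] ab bd by simp
  moreover have "integral {a..b} (\<lambda>x. ?r x * \<psi> x + ?R x * \<sigma> x) = integral {a..b} (\<lambda>x. ?r x * \<psi> x) + integral {a..b} (\<lambda>x. ?R x * \<sigma> x)"
    by (rule integral_add; rule bdd_meas_integrable_on[where a=a and b=b]; (intro bdd_meas_mult bR b\<psi>)?) auto
  ultimately have "L2_inner a b ?r \<psi> = - L2_inner a b ?R \<sigma>"
    by (simp only: L2_inner_eq_integral[OF bR(2) b\<psi>(1)] L2_inner_eq_integral[OF bR(1) b\<psi>(2)])
  moreover have "L2_inner a b ?r \<psi> = L2_inner a b (\<lambda>x. \<phi> (X x) * \<gamma> x) \<psi> - L2_inner a b \<phi> \<psi>"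
    by (subst L2_inner_lincomb[OF bm bdd_meas_continuous[OF \<phi>] b\<psi>(1)]) simp
  ultimately have "\<bar>L2_inner a b (\<lambda>x. \<phi> (X x) * \<gamma> x) \<psi> - L2_inner a b \<phi> \<psi>\<bar> = \<bar>L2_inner a b ?R \<sigma>\<bar>" by simp
  also have "\<dots> \<le> e * L2_inner a b \<sigma> \<sigma> + L2_inner a b ?R ?R / (4 * e)"
    by (rule L2_inner_Young[OF bR(1) b\<psi>(2) \<open>e > 0\<close>])
  also have "L2_inner a b ?R ?R \<le> 2 * \<delta>\<^sup>2 * L2_inner a b \<phi> \<phi>"
    using integral_power2_primitive_increment_le[OF ab \<phi> primitive_on_continuous[OF X] img le]
    unfolding L2_inner_eq_integral[OF bR(1) bR(1)]
      L2_inner_eq_integral[OF bdd_meas_continuous[OF \<phi>] bdd_meas_continuous[OF \<phi>]]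
    by (simp add: \<Phi>_def power2_eq_square)
  also have "2 * \<delta>\<^sup>2 * L2_inner a b \<phi> \<phi> / (4 * e) = \<delta>\<^sup>2 / (2 * e) * L2_inner a b \<phi> \<phi>" by simp
  finally show "\<bar>L2_inner a b (\<lambda>x. \<phi> (X x) * \<gamma> x) \<psi> - L2_inner a b \<phi> \<psi>\<bar>
      \<le> e * L2_inner a b \<sigma> \<sigma> + \<delta>\<^sup>2 / (2 * e) * L2_inner a b \<phi> \<phi>"
    using \<open>e > 0\<close> by (simp add: divide_right_mono)
qed

text \<open>Vanishing at both end points, \<open>u\<close> is at most \<open>M\<close> times the
  distance to either. With \<open>s * M \<le> 1\<close> the map \<open>X\<close> thus stays in
  \<open>[a, b]\<close>, and its displacement is at most \<open>s * (M * (b - a))\<close>. The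
  density \<open>\<gamma>\<close> is a bounded representative; the facts about \<open>wderiv\<close>
  allow it to be inserted into the scheme.\<close>

lemma upwind_L2_inner_close:
  assumes ab: "a < b" and u: "u \<in> W01inf_space a b" and M: "Linf_norm a b (wderiv a b u) \<le> M"
    and s: "0 \<le> s" "s * M \<le> 1" and X: "\<And>x. X x = x - s * u x"
    and \<phi>: "continuous_on {a..b} \<phi>" and \<psi>: "primitive_on a b \<psi> \<sigma>" and "e > 0"
  obtains \<gamma> where "bdd_meas a b (\<lambda>x. \<phi> (X x) * \<gamma> x)"
    "AE x in lebesgue_on {a<..<b}. wderiv a b X x = \<gamma> x"
    "(\<lambda>x. \<phi> (X x) * wderiv a b X x) \<in> borel_measurable (lebesgue_on {a<..<b})"
    "\<bar>L2_inner a b (\<lambda>x. \<phi> (X x) * \<gamma> x) \<psi> - L2_inner a b \<phi> \<psi>\<bar>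
      \<le> e * L2_inner a b \<sigma> \<sigma> + (s * (M * (b - a)))\<^sup>2 / (2 * e) * L2_inner a b \<phi> \<phi>"
proof -
  have u0: "u a = 0" "u b = 0" using u by (auto simp: W01inf_space_def)
  obtain w where w: "primitive_on a b u w" "\<And>x. \<bar>w x\<bar> \<le> Linf_norm a b (wderiv a b u)"
    by (rule W1inf_primitive_on[OF ab, of u]) (use u in \<open>auto simp: W01inf_space_def\<close>)
  then have wM: "\<bar>w x\<bar> \<le> M" for x using M order_trans by blast
  then have M0: "M \<ge> 0" by (meson abs_ge_zero order_trans)
  have ua: "\<bar>u x\<bar> \<le> M * (x - a)" "\<bar>u x\<bar> \<le> M * (b - x)" if "x \<in> {a..b}" for x
    using primitive_on_lipschitz[OF w(1) wM, of a x] primitive_on_lipschitz[OF w(1) wM, of b x] that ab u0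
    by auto
  have id: "primitive_on a b (\<lambda>x. x) (\<lambda>_. 1)" by (rule primitive_on_C1) auto
  define \<gamma> where "\<gamma> = (\<lambda>x. 1 * 1 + (-s) * w x)"
  have "X = (\<lambda>x. 1 * x + (-s) * u x)" using X by auto
  then have XP: "primitive_on a b X \<gamma>"
    using primitive_on_lincomb[OF id w(1), of 1 "-s"] by (simp add: \<gamma>_def)
  have su: "\<bar>s * u x\<bar> \<le> s * M * (x - a)" "\<bar>s * u x\<bar> \<le> s * M * (b - x)" if "x \<in> {a..b}" for x
    using ua[OF that] s by (auto simp: abs_mult mult.assoc mult_left_mono)
  have img: "X x \<in> {a..b}" if "x \<in> {a..b}" for x
  proof -
    have "s * M * (x - a) \<le> 1 * (x - a)" "s * M * (b - x) \<le> 1 * (b - x)"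
      using that s by (intro mult_right_mono; auto)+
    then have "\<bar>s * u x\<bar> \<le> 1 * (x - a)" "\<bar>s * u x\<bar> \<le> 1 * (b - x)"
      using su[OF that] by (blast intro: order_trans)+
    then show ?thesis by (auto simp: X)
  qed
  have le: "\<bar>X x - x\<bar> \<le> s * (M * (b - a))" if "x \<in> {a..b}" for x
  proof -
    have "s * M * (x - a) \<le> s * M * (b - a)" using that s M0 by (intro mult_left_mono) auto
    then show ?thesis using su[OF that] by (simp add: X)
  qed
  have bd: "X a = a" "X b = b" by (auto simp: X u0)
  note * = pullback_L2_inner_close[OF ab \<phi> XP img le bd \<psi> \<open>e > 0\<close>]
  have "continuous_on {a..b} (\<lambda>x. \<phi> (X x))"
    by (rule continuous_on_compose2[OF \<phi> primitive_on_continuous[OF XP]]) (use img in auto)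
  then have "(\<lambda>x. \<phi> (X x)) \<in> borel_measurable (lebesgue_on {a<..<b})"
    using bdd_meas_continuous by (auto simp: bdd_meas_def)
  then have "(\<lambda>x. \<phi> (X x) * wderiv a b X x) \<in> borel_measurable (lebesgue_on {a<..<b})"
    by (rule borel_measurable_times[OF _ wderiv_primitive_on(3)[OF ab XP]])
  then show ?thesis using that[of \<gamma>] * wderiv_primitive_on(2)[OF ab XP] by blast
qed

section \<open>Finite element functions and dual norms\<close>

lemma bdd_meas_sum:
  assumes "\<And>i. i \<in> I \<Longrightarrow> bdd_meas a b (f i)"
  shows "bdd_meas a b (\<lambda>x. \<Sum>i\<in>I. f i x)"
  using assms by (induction I rule: infinite_finite_induct) auto

text \<open>The density is the piecewise slope, with value 0 at the nodes; these form the finite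
  exceptional set in the fundamental theorem.\<close>

lemma fe_space_primitive_on:
  assumes Np: "1 \<le> Np" and p: "p 1 = a" "p Np = b" "\<And>i. i \<in> {1..<Np} \<Longrightarrow> p i < p (i + 1)" and v: "v \<in> fe_space a b Np p"
  obtains \<sigma> where "primitive_on a b v \<sigma>"
proof -
  obtain c d where cd: "\<And>i x. i \<in> {1..<Np} \<Longrightarrow> x \<in> {p i..p (i + 1)} \<Longrightarrow> v x = c i + d i * x"
    using v unfolding fe_space_def mem_Collect_eq by metis
  define \<sigma> where "\<sigma> = (\<lambda>x. \<Sum>i\<in>{1..<Np}. d i * indicator {p i<..<p (i + 1)} x)"
  have mono: "p i \<le> p j" if "1 \<le> i" "i \<le> j" "j \<le> Np" for i j
    using that(2,1,3)
  proof (induction j rule: dec_induct)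
    case (step n)
    then show ?case using p(3)[of n] by fastforce
  qed simp
  have bm: "bdd_meas a b \<sigma>"
    unfolding \<sigma>_def
  proof (intro bdd_meas_sum bdd_meas_cmult)
    fix i
    show "bdd_meas a b (indicator {p i<..<p (i + 1)})"
      unfolding bdd_meas_def
      by (intro conjI measurable_restrict_space1 borel_measurable_indicator exI[of _ 1])
        (auto simp: indicator_def)
  qed
  have D: "(v has_vector_derivative \<sigma> x) (at x)" if x: "x \<in> {a<..<b} - p ` {1..Np}" for x
  proof -
    let ?I = "{i \<in> {1..Np}. p i \<le> x}"
    \<comment> \<open>The last node not to the right of \<open>x\<close> is the left end of the cell
      containing \<open>x\<close>.\<close>
    define i where "i = Max ?I"
    have "1 \<in> ?I" using x p Np by auto
    then have iI: "i \<in> ?I" unfolding i_def by (intro Max_in) auto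
    have "i \<noteq> Np" using iI p(2) x by auto
    then have iN: "i \<in> {1..<Np}" using iI by auto
    have "\<not> p (i + 1) \<le> x"
    proof
      assume "p (i + 1) \<le> x"
      then have "i + 1 \<in> ?I" using iN by auto
      then have "i + 1 \<le> i" unfolding i_def by (intro Max_ge) auto
      then show False by simp
    qed
    moreover have "p i \<noteq> x" using x iN by auto
    ultimately have xi: "x \<in> {p i<..<p (i + 1)}" using iI by auto
    have "x \<notin> {p j<..<p (j + 1)}" if "j \<in> {1..<Np}" "j \<noteq> i" for j
      using mono[of "j + 1" i] mono[of "i + 1" j] that iN xi by (cases "j < i") auto
    then have "\<sigma> x = (\<Sum>j\<in>{1..<Np}. if j = i then d i else 0)"
      unfolding \<sigma>_def by (intro sum.cong) (use xi in \<open>auto simp: indicator_def\<close>)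
    then have "\<sigma> x = d i" using iN by simp
    have "((\<lambda>x. c i + d i * x) has_vector_derivative d i) (at x)"
      by (auto intro!: derivative_eq_intros simp: has_real_derivative_iff_has_vector_derivative[symmetric])
    then have "(v has_vector_derivative d i) (at x)"
      by (rule has_vector_derivative_transform_within_open[where S="{p i<..<p (i + 1)}"])
        (use xi cd[OF iN] in auto)
    then show ?thesis using \<open>\<sigma> x = d i\<close> by simp
  qed
  have "v x = v a + integral {a..x} \<sigma>" if "x \<in> {a..b}" for x
  proof -
    have "(\<sigma> has_integral (v x - v a)) {a..x}"
      by (rule fundamental_theorem_of_calculus_interior_strong[of "p ` {1..Np}"])
        (use D that v in \<open>auto simp: fe_space_def intro: continuous_on_subset\<close>)
    then show ?thesis by (simp add: integral_unique)
  qed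
  then show ?thesis using that bm unfolding primitive_on_def by blast
qed

lemma primitive_on_wderiv_L2:
  assumes "a < b" "primitive_on a b v \<sigma>" "primitive_on a b v' \<sigma>'"
  shows "L2_inner a b (wderiv a b v) (wderiv a b v') = L2_inner a b \<sigma> \<sigma>'"
  using assms wderiv_primitive_on[OF assms(1,2)] wderiv_primitive_on[OF assms(1,3)]
  by (intro L2_inner_cong_AE) (auto simp: primitive_on_def bdd_meas_def)

lemma primitive_on_H1:
  assumes "a < b" "primitive_on a b v \<sigma>"
  shows "v \<in> H1_space a b" "H1_norm a b v = sqrt (L2_inner a b v v + L2_inner a b \<sigma> \<sigma>)"
proof -
  have L2: "f \<in> L2_space a b" if "bdd_meas a b f" for f
    using that bdd_meas_integrable[OF bdd_meas_power2[OF that]] by (auto simp: L2_space_def bdd_meas_def)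
  show "v \<in> H1_space a b"
    using L2[OF primitive_on_bdd[OF assms(2)]] L2[OF primitive_on_bdd_meas[OF assms(2)]]
      primitive_on_weak_deriv[OF assms] primitive_on_continuous[OF assms(2)] by (auto simp: H1_space_def)
  show "H1_norm a b v = sqrt (L2_inner a b v v + L2_inner a b \<sigma> \<sigma>)"
    by (simp add: H1_norm_def L2_norm_power2 primitive_on_wderiv_L2[OF assms(1,2,2)])
qed

text \<open>Rescale \<open>\<psi>\<close> to norm one. Boundedness of \<open>F\<close> acts twice:
  it makes the supremum a genuine one, and it gives \<open>F \<psi> = 0\<close> if
  \<open>\<psi>\<close> has norm zero and cannot be rescaled.\<close>

lemma abs_le_dual_norm:
  assumes ab: "a < b" and F: "F \<in> H1_dual a b" and \<psi>: "\<psi> \<in> V" and prim: "primitive_on a b \<psi> \<sigma>"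
    and V: "V \<subseteq> H1_space a b" and scale: "\<And>c. (\<lambda>x. c * \<psi> x) \<in> V"
  shows "\<bar>F \<psi>\<bar> \<le> dual_norm a b V F * sqrt (L2_inner a b \<psi> \<psi> + L2_inner a b \<sigma> \<sigma>)"
proof -
  let ?h = "H1_norm a b \<psi>"
  obtain M where M: "\<And>\<psi>. \<psi> \<in> H1_space a b \<Longrightarrow> \<bar>F \<psi>\<bar> \<le> M * H1_norm a b \<psi>"
    using F unfolding H1_dual_def mem_Collect_eq by metis
  have h: "?h = sqrt (L2_inner a b \<psi> \<psi> + L2_inner a b \<sigma> \<sigma>)" by (rule primitive_on_H1[OF ab prim])
  then have h0: "0 \<le> ?h" by (simp add: L2_inner_self_nonneg)
  have "\<bar>F \<psi>\<bar> \<le> dual_norm a b V F * ?h"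
  proof (cases "?h = 0")
    case True
    then show ?thesis using M[of \<psi>] \<psi> V by auto
  next
    case False
    then have hp: "?h > 0" using h0 by simp
    \<comment> \<open>The summand with factor 0 matches linearity as stated in
      \<open>H1_dual\<close>, for combinations of two functions.\<close>
    let ?\<theta> = "\<lambda>x. (1 / ?h) * \<psi> x + 0 * \<psi> x"
    have "?\<theta> = (\<lambda>x. (1 / ?h) * \<psi> x)" by auto
    then have \<theta>V: "?\<theta> \<in> V" using scale by metis
    have p\<theta>: "primitive_on a b ?\<theta> (\<lambda>x. (1 / ?h) * \<sigma> x + 0 * \<sigma> x)"
      by (rule primitive_on_lincomb[OF prim prim])
    have "L2_inner a b ?\<theta> ?\<theta> = (1 / ?h)\<^sup>2 * L2_inner a b \<psi> \<psi>"
      "L2_inner a b (\<lambda>x. (1 / ?h) * \<sigma> x + 0 * \<sigma> x) (\<lambda>x. (1 / ?h) * \<sigma> x + 0 * \<sigma> x) = (1 / ?h)\<^sup>2 * L2_inner a b \<sigma> \<sigma>"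
      by (simp_all add: L2_inner_def power2_eq_square)
    then have "H1_norm a b ?\<theta> = sqrt ((1 / ?h)\<^sup>2 * (L2_inner a b \<psi> \<psi> + L2_inner a b \<sigma> \<sigma>))"
      using primitive_on_H1(2)[OF ab p\<theta>] by (simp only: distrib_left)
    also have "\<dots> = (1 / ?h) * ?h" using hp by (simp only: real_sqrt_mult h[symmetric] real_sqrt_abs) simp
    finally have 1: "H1_norm a b ?\<theta> = 1" using hp by simp
    have "\<bar>F ?\<theta>\<bar> \<le> dual_norm a b V F"
      unfolding dual_norm_def
    proof (rule cSUP_upper)
      show "?\<theta> \<in> {\<psi> \<in> V. H1_norm a b \<psi> \<le> 1}" using \<theta>V 1 by simp
      show "bdd_above ((\<lambda>\<psi>. \<bar>F \<psi>\<bar>) ` {\<psi> \<in> V. H1_norm a b \<psi> \<le> 1})"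
      proof (rule bdd_aboveI2)
        fix \<theta> assume \<theta>: "\<theta> \<in> {\<psi> \<in> V. H1_norm a b \<psi> \<le> 1}"
        then have "\<bar>F \<theta>\<bar> \<le> M * H1_norm a b \<theta>" using M V by auto
        also have "\<dots> \<le> \<bar>M\<bar> * 1" using \<theta>
          by (intro mult_mono) (auto simp: H1_norm_def)
        finally show "\<bar>F \<theta>\<bar> \<le> \<bar>M\<bar>" by simp
      qed
    qed
    moreover have "F ?\<theta> = (1 / ?h) * F \<psi> + 0 * F \<psi>"
      using F \<psi> V unfolding H1_dual_def by blast
    then have "\<bar>F ?\<theta>\<bar> = \<bar>F \<psi>\<bar> / ?h" using hp by simp
    ultimately have "\<bar>F \<psi>\<bar> / ?h \<le> dual_norm a b V F" by simp
    then show ?thesis using hp by (simp only: pos_divide_le_eq)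
  qed
  then show ?thesis by (simp add: h)
qed

lemma fe_space_scale: "v \<in> fe_space a b Np p \<Longrightarrow> (\<lambda>x. c * v x) \<in> fe_space a b Np p"
  unfolding fe_space_def mem_Collect_eq
proof (intro conjI ballI)
  assume v: "continuous_on {a..b} v \<and> (\<forall>i\<in>{1..<Np}. \<exists>c d. \<forall>x\<in>{p i..p (i + 1)}. v x = c + d * x)"
  then show "continuous_on {a..b} (\<lambda>x. c * v x)" by (auto intro!: continuous_intros)
  fix i assume "i \<in> {1..<Np}"
  then obtain e d where "\<forall>x\<in>{p i..p (i + 1)}. v x = e + d * x" using v by blast
  then show "\<exists>e d. \<forall>x\<in>{p i..p (i + 1)}. c * v x = e + d * x"
    by (intro exI[of _ "c * e"] exI[of _ "c * d"]) (auto simp: algebra_simps)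
qed

section \<open>Energy estimate for the scheme\<close>


text \<open>The supremum in the seminorm is meaningful only for a bounded family. By continuity in
  time the norm exceeds its value at \<open>t\<close> by at most 1 near \<open>t\<close>, and
  finitely many such neighbourhoods cover \<open>[0, T]\<close>.\<close>

lemma Linf_norm_wderiv_bdd_above:
  assumes ab: "a < b" and u: "u \<in> C_W01inf a b T"
  shows "bdd_above ((\<lambda>t. Linf_norm a b (wderiv a b (u t))) ` {0..T})"
proof -
  let ?m = "\<lambda>t. Linf_norm a b (wderiv a b (u t))"
  have W: "u t \<in> W1inf_space a b" if "t \<in> {0..T}" for t
    using u that by (auto simp: C_W01inf_def W01inf_space_def)
  \<comment> \<open>\<open>wderiv\<close> of a difference agrees with the difference of derivatives
    only almost everywhere, so the triangle inequality goes through the densities \<open>ws\<close>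
    and \<open>wt\<close>.\<close>
  have step: "?m s \<le> ?m t + 1"
    if s: "s \<in> {0..T}" and t: "t \<in> {0..T}" and c: "W1inf_norm a b (\<lambda>x. u s x - u t x) < 1" for s t
  proof -
    obtain ws where ws: "primitive_on a b (u s) ws" "\<And>x. \<bar>ws x\<bar> \<le> ?m s"
      using W1inf_primitive_on[OF ab W[OF s]] by blast
    obtain wt where wt: "primitive_on a b (u t) wt" "\<And>x. \<bar>wt x\<bar> \<le> ?m t"
      using W1inf_primitive_on[OF ab W[OF t]] by blast
    let ?d = "wderiv a b (\<lambda>x. u s x - u t x)"
    have d: "primitive_on a b (\<lambda>x. u s x - u t x) (\<lambda>x. ws x - wt x)"
      using primitive_on_lincomb[OF ws(1) wt(1), of 1 "-1"] by simp
    have m0: "0 \<le> ?m s" "0 \<le> ?m t" using ws(2) wt(2) by (meson abs_ge_zero order_trans)+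
    have "AE x in lebesgue_on {a<..<b}. \<bar>?d x\<bar> \<le> ?m s + ?m t"
      using wderiv_primitive_on(2)[OF ab d]
    proof eventually_elim
      case (elim x)
      then show ?case using ws(2)[of x] wt(2)[of x] abs_triangle_ineq4[of "ws x" "wt x"] by simp
    qed
    then have "?d \<in> Linf_space a b"
      by (rule Linf_norm_le(2)[OF wderiv_primitive_on(3)[OF ab d]]) (use m0 in simp)
    then have "AE x in lebesgue_on {a<..<b}. \<bar>?d x\<bar> \<le> Linf_norm a b ?d"
      by (rule AE_abs_le_Linf_norm)
    then have "AE x in lebesgue_on {a<..<b}. \<bar>wderiv a b (u s) x\<bar> \<le> ?m t + 1"
      using wderiv_primitive_on(2)[OF ab d] wderiv_primitive_on(2)[OF ab ws(1)]
    proof eventually_elim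
      case (elim x)
      then have "\<bar>ws x - wt x\<bar> < 1" using c by (simp add: W1inf_norm_def)
      then show ?case using elim wt(2)[of x] by linarith
    qed
    then show ?thesis
      by (rule Linf_norm_le(1)[OF wderiv_primitive_on(3)[OF ab ws(1)]]) (use m0 in simp)
  qed
  have "\<exists>d>0. \<forall>s\<in>{0..T}. dist s t < d \<longrightarrow> ?m s \<le> ?m t + 1" if t: "t \<in> {0..T}" for t
  proof -
    have "((\<lambda>s. W1inf_norm a b (\<lambda>x. u s x - u t x)) \<longlongrightarrow> 0) (at t within {0..T})"
      using u t by (auto simp: C_W01inf_def)
    then have "\<forall>\<^sub>F s in at t within {0..T}. W1inf_norm a b (\<lambda>x. u s x - u t x) < 1"
      by (rule order_tendstoD(2)) simp
    then obtain d where d: "d > 0"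
      "\<And>s. s \<in> {0..T} \<Longrightarrow> s \<noteq> t \<Longrightarrow> dist s t < d \<Longrightarrow> W1inf_norm a b (\<lambda>x. u s x - u t x) < 1"
      unfolding eventually_at by blast
    have "?m s \<le> ?m t + 1" if "s \<in> {0..T}" "dist s t < d" for s
      using step[OF that(1) t d(2)] that by (cases "s = t") auto
    then show ?thesis using d(1) by blast
  qed
  then obtain d where d: "\<And>t. t \<in> {0..T} \<Longrightarrow> d t > 0"
    "\<And>t s. t \<in> {0..T} \<Longrightarrow> s \<in> {0..T} \<Longrightarrow> dist s t < d t \<Longrightarrow> ?m s \<le> ?m t + 1"
    by metis
  have cover: "{0..T} \<subseteq> (\<Union>t\<in>{0..T}. ball t (d t))" using d(1) by force
  obtain I where I: "I \<subseteq> {0..T}" "finite I" "{0..T} \<subseteq> (\<Union>t\<in>I. ball t (d t))"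
    by (rule compactE_image[OF compact_Icc _ cover]) auto
  show ?thesis
  proof (rule bdd_aboveI2)
    fix s assume s: "s \<in> {0..T}"
    then obtain t where t: "t \<in> I" "dist s t < d t" using I(3) by (auto simp: dist_commute)
    then have "?m s \<le> ?m t + 1" using d(2) I(1) s by blast
    also have "?m t \<le> Max (?m ` I)" using I(2) t by (intro Max_ge) auto
    finally show "?m s \<le> Max (?m ` I) + 1" by simp
  qed
qed

lemma Linf_norm_wderiv_le_seminorm:
  assumes "a < b" "u \<in> C_W01inf a b T" "t \<in> {0..T}"
  shows "Linf_norm a b (wderiv a b (u t)) \<le> C_W1inf_seminorm a b T u"
  unfolding C_W1inf_seminorm_def
  by (rule cSUP_upper[OF assms(3) Linf_norm_wderiv_bdd_above[OF assms(1,2)]])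

section \<open>Discrete energy argument for the second order backward difference\<close>

lemma discrete_Gronwall:
  fixes A :: "nat \<Rightarrow> real"
  assumes le: "\<And>n. n \<le> N \<Longrightarrow> A n \<le> R + r * (\<Sum>k<n. A k)" and r: "0 \<le> r" and n: "n \<le> N" and R: "0 \<le> R"
  shows "R + r * (\<Sum>k<n. A k) \<le> R * exp (r * real n)"
  using n
\<comment> \<open>The induction runs on the majorant of \<open>A n\<close>, which grows by a factor
  of at most \<open>1 + r \<le> exp r\<close> per step.\<close>
proof (induction n)
  case (Suc n)
  let ?S = "R + r * (\<Sum>k<n. A k)"
  have "R + r * (\<Sum>k<Suc n. A k) = ?S + r * A n" by (simp add: algebra_simps)
  also have "\<dots> \<le> ?S + r * ?S" using le[of n] Suc.prems r by (intro add_left_mono mult_left_mono) auto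
  also have "\<dots> = ?S * (1 + r)" by (simp add: algebra_simps)
  also have "\<dots> \<le> (R * exp (r * real n)) * (1 + r)"
    using Suc r by (intro mult_right_mono) auto
  also have "\<dots> \<le> R * exp (r * real (Suc n))"
  proof -
    have "(R * exp (r * real n)) * (1 + r) \<le> (R * exp (r * real n)) * exp r"
      by (intro mult_left_mono exp_ge_add_one_self) (use R in auto)
    also have "\<dots> = R * exp (r * real (Suc n))" by (simp add: algebra_simps exp_add)
    finally show ?thesis .
  qed
  finally show ?case .
qed simp

text \<open>
  \<open>A\<close>, \<open>G\<close> stand for the squared norms of \<open>\<phi>\<^sub>h\<^sup>n\<close> and its derivative, \<open>B\<close>, \<open>C\<close> for the inner
  products of \<open>\<phi>\<^sub>h\<^sup>n\<close> with its two predecessors, \<open>D\<close> for the dual norm of \<open>F\<^sup>n\<close>; then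
  \<open>5 * A n - 4 * B n + A (n - 1)\<close> is the energy.
\<close>

lemma bdf2_energy_bound:
  fixes A G B C D :: "nat \<Rightarrow> real" and T \<nu> c dt :: real
  assumes T: "T > 0" and \<nu>: "\<nu> > 0" and c: "c \<ge> 0" and dt: "dt > 0" "real N * dt \<le> T" and N: "1 \<le> N"
    and A0: "\<And>n. n \<le> N \<Longrightarrow> 0 \<le> A n" and G0: "\<And>n. n \<le> N \<Longrightarrow> 0 \<le> G n"
    and first: "(A 1 - B 1) / dt + \<nu> * G 1 \<le> D 1 * sqrt (A 1 + G 1) + \<nu> / 4 * G 1 + c * A 0"
    and later: "\<And>n. 2 \<le> n \<Longrightarrow> n \<le> N \<Longrightarrow> (3 * A n - 4 * B n + C n) / (2 * dt) + \<nu> * G n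
      \<le> D n * sqrt (A n + G n) + \<nu> / 4 * G n + c * (A (n - 1) + A (n - 2))"
    and E_ge: "\<And>n. 1 \<le> n \<Longrightarrow> n \<le> N \<Longrightarrow> 0 \<le> 4 * A n - 4 * B n + A (n - 1)"
    and E_diff: "\<And>n. 2 \<le> n \<Longrightarrow> n \<le> N \<Longrightarrow>
      (5 * A n - 4 * B n + A (n - 1)) - (5 * A (n - 1) - 4 * B (n - 1) + A (n - 2))
        \<le> 2 * (3 * A n - 4 * B n + C n)"
    and start: "0 \<le> A 1 - 2 * B 1 + A 0"
  defines "\<epsilon> \<equiv> min (\<nu> / 2) (1 / (6 * T))"
  defines "S \<equiv> dt * (\<Sum>n=1..N. (D n)\<^sup>2)"
  defines "Q \<equiv> 2 * (3 + 3 / \<epsilon>) * exp ((24 * c + 6 * \<epsilon>) * T)"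
  shows "\<And>n. 1 \<le> n \<Longrightarrow> n \<le> N \<Longrightarrow> A n \<le> Q * (A 0 + S)"
    and "\<nu> * (dt * (\<Sum>n=1..N. G n)) \<le> Q * (A 0 + S)"
proof -
  \<comment> \<open>The bound \<open>\<nu> / 2\<close> limits the diffusion spent on the load to
    \<open>\<nu> / 4 * G n\<close>. The bound \<open>1 / (6 * T)\<close>, with
    \<open>dt \<le> T\<close>, gives \<open>3 * (dt * \<epsilon>) \<le> 1 / 2\<close>, so the
    implicit term in \<open>A n\<close> can be absorbed.\<close>
  have \<epsilon>: "\<epsilon> > 0" "\<epsilon> \<le> \<nu> / 2" "\<epsilon> \<le> 1 / (6 * T)" using T \<nu> by (auto simp: \<epsilon>_def)
  have dtT: "dt \<le> T"
  proof -
    have "1 * dt \<le> real N * dt" using N dt by (intro mult_right_mono) auto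
    also have "\<dots> \<le> T" by (rule dt(2))
    finally show ?thesis by simp
  qed
  have "dt * \<epsilon> \<le> T * (1 / (6 * T))" using dt dtT \<epsilon> T by (intro mult_mono) auto
  then have dt\<epsilon>: "dt * \<epsilon> \<le> 1 / 6" using T by simp
  have young: "dt * (D n * sqrt (A n + G n)) \<le> dt * (D n)\<^sup>2 / (2 * \<epsilon>) + dt * \<epsilon> / 2 * A n + dt * \<nu> / 4 * G n"
    if "n \<le> N" for n
  proof -
    let ?s = "sqrt (A n + G n)"
    have s: "?s\<^sup>2 = A n + G n" using A0[OF that] G0[OF that] by simp
    have "0 \<le> (D n - \<epsilon> * ?s)\<^sup>2" by simp
    also have "\<dots> = (D n)\<^sup>2 - 2 * \<epsilon> * (D n * ?s) + \<epsilon>\<^sup>2 * ?s\<^sup>2"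
      by (simp only: power2_eq_square) (simp add: algebra_simps del: real_sqrt_mult_self)
    also have "?s\<^sup>2 = A n + G n" by (rule s)
    finally have "2 * \<epsilon> * (D n * ?s) \<le> (D n)\<^sup>2 + \<epsilon>\<^sup>2 * (A n + G n)" by simp
    then have "D n * ?s \<le> ((D n)\<^sup>2 + \<epsilon>\<^sup>2 * (A n + G n)) / (2 * \<epsilon>)"
      using \<epsilon>(1) by (simp add: field_simps)
    also have "\<dots> = (D n)\<^sup>2 / (2 * \<epsilon>) + \<epsilon> / 2 * A n + \<epsilon> / 2 * G n"
      using \<epsilon>(1) by (simp add: field_simps power2_eq_square)
    also have "\<epsilon> / 2 * G n \<le> \<nu> / 4 * G n" using \<epsilon> G0[OF that] by (intro mult_right_mono) auto
    finally have "dt * (D n * ?s) \<le> dt * ((D n)\<^sup>2 / (2 * \<epsilon>) + \<epsilon> / 2 * A n + \<nu> / 4 * G n)"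
      using dt by (intro mult_left_mono) auto
    then show ?thesis by (simp add: algebra_simps)
  qed
  define E where "E = (\<lambda>n. 5 * A n - 4 * B n + A (n - 1))"
  \<comment> \<open>The Euler step is taken six times:
    \<open>6 * (A 1 - B 1) + 3 * A 0 - E 1\<close> equals
    \<open>(A 1 - 2 * B 1 + A 0) + A 0\<close>, which is nonnegative.\<close>
  have E1: "E 1 + \<nu> * dt * G 1 \<le> 3 * A 0 + 3 / \<epsilon> * (dt * (D 1)\<^sup>2) + 3 * (dt * \<epsilon>) * A 1 + 6 * c * dt * A 0"
  proof -
    have "dt * ((A 1 - B 1) / dt + \<nu> * G 1) \<le> dt * (D 1 * sqrt (A 1 + G 1) + \<nu> / 4 * G 1 + c * A 0)"
      using first dt by (intro mult_left_mono) auto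
    moreover have "dt * ((A 1 - B 1) / dt + \<nu> * G 1) = (A 1 - B 1) + \<nu> * dt * G 1"
      using dt by (simp add: distrib_left)
    moreover have "dt * (D 1 * sqrt (A 1 + G 1) + \<nu> / 4 * G 1 + c * A 0)
        = dt * (D 1 * sqrt (A 1 + G 1)) + dt * \<nu> / 4 * G 1 + c * dt * A 0"
      by (simp add: algebra_simps)
    ultimately have "(A 1 - B 1) + \<nu> * dt * G 1 \<le> dt * (D 1 * sqrt (A 1 + G 1)) + dt * \<nu> / 4 * G 1 + c * dt * A 0"
      by simp
    moreover have "0 \<le> \<nu> * dt * G 1" using \<nu> dt G0[of 1] N by simp
    ultimately show ?thesis
      using young[OF N] start A0[of 0] by (simp add: E_def field_simps)
  qed
  \<comment> \<open>Multiplying by \<open>4 * dt\<close> yields twice the form that dominates the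
    energy increment. Of the diffusion, one quarter goes to the transport error and one quarter to
    the load.\<close>
  have En: "E n + 2 * (\<nu> * dt * G n) \<le> E (n - 1) + 2 / \<epsilon> * (dt * (D n)\<^sup>2) + 2 * (dt * \<epsilon>) * A n
      + 4 * c * dt * (A (n - 1) + A (n - 2))" if n: "2 \<le> n" "n \<le> N" for n
  proof -
    have "4 * dt * ((3 * A n - 4 * B n + C n) / (2 * dt) + \<nu> * G n)
      \<le> 4 * dt * (D n * sqrt (A n + G n) + \<nu> / 4 * G n + c * (A (n - 1) + A (n - 2)))"
      using later[OF n] dt by (intro mult_left_mono) auto
    moreover have "4 * dt * ((3 * A n - 4 * B n + C n) / (2 * dt) + \<nu> * G n)
        = 2 * (3 * A n - 4 * B n + C n) + 4 * (\<nu> * dt * G n)"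
      using dt by (simp only: distrib_left[of "4 * dt"]) simp
    moreover have "4 * dt * (D n * sqrt (A n + G n) + \<nu> / 4 * G n + c * (A (n - 1) + A (n - 2)))
        = 4 * (dt * (D n * sqrt (A n + G n))) + dt * \<nu> * G n + 4 * c * dt * (A (n - 1) + A (n - 2))"
      by (simp add: algebra_simps)
    ultimately have "2 * (3 * A n - 4 * B n + C n) + 4 * (\<nu> * dt * G n)
      \<le> 4 * (dt * (D n * sqrt (A n + G n))) + dt * \<nu> * G n + 4 * c * dt * (A (n - 1) + A (n - 2))"
      by simp
    moreover have "4 * (dt * (D n * sqrt (A n + G n))) \<le> 2 / \<epsilon> * (dt * (D n)\<^sup>2) + 2 * (dt * \<epsilon>) * A n + dt * \<nu> * G n"
      using young[OF n(2)] by (simp add: field_simps)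
    moreover have "E n - E (n - 1) \<le> 2 * (3 * A n - 4 * B n + C n)"
    proof -
      have "n - 1 - 1 = n - 2" by simp
      then show ?thesis using E_diff[OF n] by (simp add: E_def)
    qed
    ultimately show ?thesis by (simp add: algebra_simps)
  qed
  \<comment> \<open>Each \<open>A k\<close> is charged by the steps that follow it. The negative
    last term reserves the charge of the next step, where \<open>A (n - 1)\<close> is the older
    predecessor; the coefficient 12 leaves room for the Euler step.\<close>
  have main: "E n + \<nu> * dt * (\<Sum>k=1..n. G k) \<le> 3 * A 0 + 3 / \<epsilon> * (dt * (\<Sum>k=1..n. (D k)\<^sup>2))
      + 3 * (dt * \<epsilon>) * (\<Sum>k=1..n. A k) + (12 * c * dt) * (\<Sum>k<n. A k) - 4 * c * dt * A (n - 1)"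
    if "1 \<le> n" "n \<le> N" for n
    using that
  proof (induction n rule: dec_induct)
    case base
    have "0 \<le> c * dt * A 0" using c dt A0[of 0] by simp
    then show ?case using E1 by (simp add: algebra_simps)
  next
    case (step n)
    have IH: "E n + \<nu> * dt * (\<Sum>k=1..n. G k) \<le> 3 * A 0 + 3 / \<epsilon> * (dt * (\<Sum>k=1..n. (D k)\<^sup>2))
      + 3 * (dt * \<epsilon>) * (\<Sum>k=1..n. A k) + (12 * c * dt) * (\<Sum>k<n. A k) - 4 * c * dt * A (n - 1)"
      using step by simp
    have 1: "E (Suc n) + 2 * (\<nu> * dt * G (Suc n)) \<le> E n + 2 / \<epsilon> * (dt * (D (Suc n))\<^sup>2) + 2 * (dt * \<epsilon>) * A (Suc n)
      + 4 * c * dt * (A n + A (n - 1))"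
      using En[of "Suc n"] step by (simp add: numeral_2_eq_2)
    have nonneg: "0 \<le> c * dt * A n" "0 \<le> \<nu> * dt * G (Suc n)" "0 \<le> (1 / \<epsilon>) * (dt * (D (Suc n))\<^sup>2)"
      "0 \<le> (dt * \<epsilon>) * A (Suc n)"
      using c dt \<nu> \<epsilon>(1) A0[of n] A0[of "Suc n"] G0[of "Suc n"] step by auto
    have sums: "(\<Sum>k=1..Suc n. f k) = (\<Sum>k=1..n. f k) + f (Suc n)" for f :: "nat \<Rightarrow> real" by simp
    define e where "e = 1 / \<epsilon>"
    have e: "3 / \<epsilon> = 3 * e" "2 / \<epsilon> = 2 * e" "1 / \<epsilon> = e" by (simp_all add: e_def)
    show ?case using IH 1 nonneg unfolding e
      unfolding sums sum.lessThan_Suc distrib_left diff_Suc_1 mult.assoc by linarith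
  qed
  define R where "R = 3 * A 0 + 3 / \<epsilon> * S"
  define q where "q = 24 * c + 6 * \<epsilon>"
  have S0: "0 \<le> S" unfolding S_def using dt by (intro mult_nonneg_nonneg sum_nonneg) auto
  have R0: "0 \<le> R" using A0[of 0] S0 \<epsilon>(1) by (simp add: R_def)
  have q0: "0 \<le> q * dt" using c \<epsilon>(1) dt by (simp add: q_def)
  \<comment> \<open>After half of \<open>A n\<close> is absorbed, doubling turns the rate
    \<open>12 * c + 3 * \<epsilon>\<close> into \<open>q\<close>.\<close>
  have key: "A n + 2 * (\<nu> * dt * (\<Sum>k=1..n. G k)) \<le> 2 * R + (q * dt) * (\<Sum>k<n. A k)" if n: "1 \<le> n" "n \<le> N" for n
  proof -
    have "(\<Sum>k=1..n. (D k)\<^sup>2) \<le> (\<Sum>k=1..N. (D k)\<^sup>2)" using n by (intro sum_mono2) auto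
    then have "3 / \<epsilon> * (dt * (\<Sum>k=1..n. (D k)\<^sup>2)) \<le> 3 / \<epsilon> * S"
      unfolding S_def using dt \<epsilon>(1) by (intro mult_left_mono) auto
    moreover have "(\<Sum>k=1..n. A k) \<le> A n + (\<Sum>k<n. A k)"
    proof -
      have "{1..n} = insert n {1..<n}" using n by auto
      then have "(\<Sum>k=1..n. A k) = A n + (\<Sum>k\<in>{1..<n}. A k)" by simp
      also have "(\<Sum>k\<in>{1..<n}. A k) \<le> (\<Sum>k<n. A k)" using n A0 by (intro sum_mono2) auto
      finally show ?thesis by simp
    qed
    then have "3 * (dt * \<epsilon>) * (\<Sum>k=1..n. A k) \<le> 3 * (dt * \<epsilon>) * (A n + (\<Sum>k<n. A k))"
      using dt \<epsilon>(1) by (intro mult_left_mono) auto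
    moreover have "3 * (dt * \<epsilon>) * A n \<le> 1 / 2 * A n"
      using dt\<epsilon> A0[OF n(2)] by (intro mult_right_mono) auto
    moreover have "A n \<le> E n" using E_ge[OF n] by (simp add: E_def)
    moreover have "0 \<le> 4 * c * dt * A (n - 1)" using c dt A0[of "n - 1"] n by simp
    ultimately have "A n / 2 + \<nu> * dt * (\<Sum>k=1..n. G k) \<le> R + (12 * c * dt) * (\<Sum>k<n. A k) + 3 * (dt * \<epsilon>) * (\<Sum>k<n. A k)"
      using main[OF n] unfolding R_def distrib_left by linarith
    then show ?thesis by (simp add: q_def algebra_simps)
  qed
  have Gsum: "0 \<le> \<nu> * dt * (\<Sum>k=1..n. G k)" if "n \<le> N" for n
    using \<nu> dt G0 that by (intro mult_nonneg_nonneg sum_nonneg) auto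
  have le: "A n \<le> 2 * R + (q * dt) * (\<Sum>k<n. A k)" if "n \<le> N" for n
  proof (cases "n = 0")
    case True
    have "0 \<le> 3 / \<epsilon> * S" using S0 \<epsilon>(1) by simp
    then show ?thesis using True A0[of 0] by (simp add: R_def)
  next
    case False
    then show ?thesis using key[of n] Gsum[of n] that by simp
  qed
  have bound: "2 * R + (q * dt) * (\<Sum>k<n. A k) \<le> Q * (A 0 + S)" if "n \<le> N" for n
  proof -
    have "2 * R + (q * dt) * (\<Sum>k<n. A k) \<le> 2 * R * exp (q * dt * real n)"
      by (rule discrete_Gronwall[OF le q0 that]) (use R0 in auto)
    also have "\<dots> \<le> 2 * R * exp (q * T)"
    proof (intro mult_left_mono)
      have "dt * real n \<le> dt * real N" using that dt by (intro mult_left_mono) auto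
      also have "\<dots> \<le> T" using dt by (simp add: mult.commute)
      finally have "dt * real n \<le> T" .
      moreover have "0 \<le> q" using c \<epsilon>(1) by (simp add: q_def)
      ultimately have "q * (dt * real n) \<le> q * T" by (intro mult_left_mono)
      then show "exp (q * dt * real n) \<le> exp (q * T)" by (simp add: mult.assoc)
    qed (use R0 in simp)
    also have "2 * R \<le> 2 * (3 + 3 / \<epsilon>) * (A 0 + S)"
      using A0[of 0] S0 \<epsilon>(1) by (simp add: R_def field_simps)
    finally show ?thesis unfolding Q_def q_def by (simp add: mult.assoc mult.commute mult.left_commute mult_right_mono)
  qed
  show "A n \<le> Q * (A 0 + S)" if "1 \<le> n" "n \<le> N" for n
    using le[OF that(2)] bound[OF that(2)] by simp
  have "\<nu> * (dt * (\<Sum>n=1..N. G n)) \<le> A N + 2 * (\<nu> * dt * (\<Sum>k=1..N. G k))"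
    using Gsum[of N] A0[of N] by (simp add: mult.assoc)
  then show "\<nu> * (dt * (\<Sum>n=1..N. G n)) \<le> Q * (A 0 + S)"
    using key[OF N order_refl] bound[of N] by simp
qed


section \<open>Energy inequality for a single step\<close>

lemma first_step_energy:
  assumes ab: "a < b" and u: "u t \<in> W01inf_space a b" and M: "Linf_norm a b (wderiv a b (u t)) \<le> M"
    and dt: "0 < dt" "dt * M \<le> 1" and \<nu>: "\<nu> > 0" and X: "\<And>x. X x = x - dt * u t x"
    and \<phi>0: "continuous_on {a..b} \<phi>0" and \<phi>: "primitive_on a b \<phi> \<sigma>"
    and eq: "L2_inner a b (\<lambda>x. (\<phi> x - \<phi>0 (X x) * wderiv a b X x) / dt) \<phi> + \<nu> * L2_inner a b \<sigma> \<sigma> = r"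
  shows "(L2_inner a b \<phi> \<phi> - L2_inner a b \<phi>0 \<phi>) / dt + \<nu> * L2_inner a b \<sigma> \<sigma>
    \<le> r + \<nu> / 4 * L2_inner a b \<sigma> \<sigma> + 16 * (M * (b - a))\<^sup>2 / \<nu> * L2_inner a b \<phi>0 \<phi>0"
proof -
  note bm = primitive_on_bdd[OF \<phi>]
  \<comment> \<open>After division by \<open>dt\<close>, the weight \<open>\<nu> * dt / 4\<close>
    costs a quarter of the diffusion, and the squared displacement leaves an error constant free of
    \<open>dt\<close>.\<close>
  obtain \<gamma> where \<gamma>: "bdd_meas a b (\<lambda>x. \<phi>0 (X x) * \<gamma> x)"
    "AE x in lebesgue_on {a<..<b}. wderiv a b X x = \<gamma> x"
    "(\<lambda>x. \<phi>0 (X x) * wderiv a b X x) \<in> borel_measurable (lebesgue_on {a<..<b})"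
    "\<bar>L2_inner a b (\<lambda>x. \<phi>0 (X x) * \<gamma> x) \<phi> - L2_inner a b \<phi>0 \<phi>\<bar>
      \<le> (\<nu> * dt / 4) * L2_inner a b \<sigma> \<sigma> + (dt * (M * (b - a)))\<^sup>2 / (2 * (\<nu> * dt / 4)) * L2_inner a b \<phi>0 \<phi>0"
    by (rule upwind_L2_inner_close[OF ab u M less_imp_le[OF dt(1)] dt(2) X \<phi>0 \<phi>, of "\<nu> * dt / 4"])
      (use \<nu> dt in auto)
  let ?p = "\<lambda>x. \<phi>0 (X x) * \<gamma> x"
  have m: "\<phi> \<in> borel_measurable (lebesgue_on {a<..<b})" "?p \<in> borel_measurable (lebesgue_on {a<..<b})"
    using bm \<gamma>(1) by (auto simp: bdd_meas_def)
  have "AE x in lebesgue_on {a<..<b}. (\<phi> x - \<phi>0 (X x) * wderiv a b X x) / dt = (1 / dt) * \<phi> x + (- 1 / dt) * ?p x"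
    using \<gamma>(2) by eventually_elim (simp add: diff_divide_distrib)
  then have "L2_inner a b (\<lambda>x. (\<phi> x - \<phi>0 (X x) * wderiv a b X x) / dt) \<phi>
      = L2_inner a b (\<lambda>x. (1 / dt) * \<phi> x + (- 1 / dt) * ?p x) \<phi>"
    using m \<gamma>(3) by (intro L2_inner_cong_AE) auto
  also have "\<dots> = (L2_inner a b \<phi> \<phi> - L2_inner a b ?p \<phi>) / dt"
    by (simp only: L2_inner_lincomb[OF bm \<gamma>(1) bm]) (simp add: diff_divide_distrib)
  finally have "(L2_inner a b \<phi> \<phi> - L2_inner a b ?p \<phi>) / dt + \<nu> * L2_inner a b \<sigma> \<sigma> = r"
    using eq by simp
  moreover have "(L2_inner a b ?p \<phi> - L2_inner a b \<phi>0 \<phi>) / dt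
      \<le> \<nu> / 4 * L2_inner a b \<sigma> \<sigma> + 2 * (M * (b - a))\<^sup>2 / \<nu> * L2_inner a b \<phi>0 \<phi>0"
  proof -
    have "(L2_inner a b ?p \<phi> - L2_inner a b \<phi>0 \<phi>) / dt \<le> ((\<nu> * dt / 4) * L2_inner a b \<sigma> \<sigma>
        + (dt * (M * (b - a)))\<^sup>2 / (2 * (\<nu> * dt / 4)) * L2_inner a b \<phi>0 \<phi>0) / dt"
      using \<gamma>(4) dt by (intro divide_right_mono) auto
    also have "\<dots> = \<nu> / 4 * L2_inner a b \<sigma> \<sigma> + 2 * (M * (b - a))\<^sup>2 / \<nu> * L2_inner a b \<phi>0 \<phi>0"
      unfolding power_mult_distrib[of dt] power2_eq_square[of dt] using dt \<nu> by (simp add: add_divide_distrib)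
    finally show ?thesis .
  qed
  \<comment> \<open>Enlarged to 16 so that both kinds of steps share one constant.\<close>
  moreover have "2 * (M * (b - a))\<^sup>2 / \<nu> * L2_inner a b \<phi>0 \<phi>0 \<le> 16 * (M * (b - a))\<^sup>2 / \<nu> * L2_inner a b \<phi>0 \<phi>0"
    using \<nu> by (intro mult_right_mono divide_right_mono L2_inner_self_nonneg) auto
  moreover have "(L2_inner a b \<phi> \<phi> - L2_inner a b \<phi>0 \<phi>) / dt
    = (L2_inner a b \<phi> \<phi> - L2_inner a b ?p \<phi>) / dt + (L2_inner a b ?p \<phi> - L2_inner a b \<phi>0 \<phi>) / dt"
    by (simp add: diff_divide_distrib)
  ultimately show ?thesis by linarith
qed

text \<open>The pull-backs carry the factors \<open>2 / dt\<close> and \<open>1 / (2 * dt)\<close>.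
  The weights \<open>\<nu> * dt / 16\<close> and \<open>\<nu> * dt / 4\<close> make each cost
  \<open>\<nu> / 8\<close> of the diffusion, together the same quarter as in the first step.\<close>

lemma later_step_energy:
  assumes ab: "a < b" and u: "u t \<in> W01inf_space a b" and M: "Linf_norm a b (wderiv a b (u t)) \<le> M"
    and dt: "0 < dt" "2 * dt * M \<le> 1" and \<nu>: "\<nu> > 0"
    and X: "\<And>x. X x = x - dt * u t x" and Y: "\<And>x. Y x = x - 2 * dt * u t x"
    and \<phi>1: "continuous_on {a..b} \<phi>1" and \<phi>0: "continuous_on {a..b} \<phi>0" and \<phi>: "primitive_on a b \<phi> \<sigma>"
    and eq: "L2_inner a b (\<lambda>x. (3 * \<phi> x - 4 * \<phi>1 (X x) * wderiv a b X x + \<phi>0 (Y x) * wderiv a b Y x) / (2 * dt)) \<phi>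
      + \<nu> * L2_inner a b \<sigma> \<sigma> = r"
  shows "(3 * L2_inner a b \<phi> \<phi> - 4 * L2_inner a b \<phi>1 \<phi> + L2_inner a b \<phi>0 \<phi>) / (2 * dt) + \<nu> * L2_inner a b \<sigma> \<sigma>
    \<le> r + \<nu> / 4 * L2_inner a b \<sigma> \<sigma>
      + 16 * (M * (b - a))\<^sup>2 / \<nu> * (L2_inner a b \<phi>1 \<phi>1 + L2_inner a b \<phi>0 \<phi>0)"
proof -
  let ?K = "M * (b - a)" and ?G = "L2_inner a b \<sigma> \<sigma>"
  note bm = primitive_on_bdd[OF \<phi>]
  \<comment> \<open>The case distinction is due to the sign of \<open>M\<close>, which is not among
    the assumptions here.\<close>
  have "dt * M \<le> 1" using dt by (cases "M \<le> 0") (auto simp: mult_le_0_iff intro: order_trans[of _ 0])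
  obtain \<gamma> where \<gamma>: "bdd_meas a b (\<lambda>x. \<phi>1 (X x) * \<gamma> x)"
    "AE x in lebesgue_on {a<..<b}. wderiv a b X x = \<gamma> x"
    "(\<lambda>x. \<phi>1 (X x) * wderiv a b X x) \<in> borel_measurable (lebesgue_on {a<..<b})"
    "\<bar>L2_inner a b (\<lambda>x. \<phi>1 (X x) * \<gamma> x) \<phi> - L2_inner a b \<phi>1 \<phi>\<bar>
      \<le> (\<nu> * dt / 16) * ?G + (dt * ?K)\<^sup>2 / (2 * (\<nu> * dt / 16)) * L2_inner a b \<phi>1 \<phi>1"
    by (rule upwind_L2_inner_close[OF ab u M less_imp_le[OF dt(1)] \<open>dt * M \<le> 1\<close> X \<phi>1 \<phi>, of "\<nu> * dt / 16"])
      (use \<nu> dt in auto)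
  obtain \<gamma>' where \<gamma>': "bdd_meas a b (\<lambda>x. \<phi>0 (Y x) * \<gamma>' x)"
    "AE x in lebesgue_on {a<..<b}. wderiv a b Y x = \<gamma>' x"
    "(\<lambda>x. \<phi>0 (Y x) * wderiv a b Y x) \<in> borel_measurable (lebesgue_on {a<..<b})"
    "\<bar>L2_inner a b (\<lambda>x. \<phi>0 (Y x) * \<gamma>' x) \<phi> - L2_inner a b \<phi>0 \<phi>\<bar>
      \<le> (\<nu> * dt / 4) * ?G + (2 * dt * ?K)\<^sup>2 / (2 * (\<nu> * dt / 4)) * L2_inner a b \<phi>0 \<phi>0"
    by (rule upwind_L2_inner_close[OF ab u M _ dt(2) Y \<phi>0 \<phi>, of "\<nu> * dt / 4"])
      (use \<nu> dt in auto)
  let ?p = "\<lambda>x. \<phi>1 (X x) * \<gamma> x" and ?q = "\<lambda>x. \<phi>0 (Y x) * \<gamma>' x"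
  let ?f = "\<lambda>x. (3 / (2 * dt)) * \<phi> x + (- 4 / (2 * dt)) * ?p x"
  have m: "\<phi> \<in> borel_measurable (lebesgue_on {a<..<b})" "?p \<in> borel_measurable (lebesgue_on {a<..<b})"
    "?q \<in> borel_measurable (lebesgue_on {a<..<b})"
    using bm \<gamma>(1) \<gamma>'(1) by (auto simp: bdd_meas_def)
  have bf: "bdd_meas a b ?f" by (intro bdd_meas_add bdd_meas_cmult bm \<gamma>(1))
  have ae: "AE x in lebesgue_on {a<..<b}.
      (3 * \<phi> x - 4 * \<phi>1 (X x) * wderiv a b X x + \<phi>0 (Y x) * wderiv a b Y x) / (2 * dt) = 1 * ?f x + (1 / (2 * dt)) * ?q x"
    using \<gamma>(2) \<gamma>'(2) by eventually_elim (simp add: diff_divide_distrib add_divide_distrib)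
  have m': "(\<lambda>x. (3 * \<phi> x - 4 * \<phi>1 (X x) * wderiv a b X x + \<phi>0 (Y x) * wderiv a b Y x) / (2 * dt))
      \<in> borel_measurable (lebesgue_on {a<..<b})"
    unfolding mult.assoc[of 4]
    by (intro borel_measurable_divide borel_measurable_add borel_measurable_diff borel_measurable_times
        borel_measurable_const m \<gamma>(3) \<gamma>'(3))
  have "L2_inner a b (\<lambda>x. (3 * \<phi> x - 4 * \<phi>1 (X x) * wderiv a b X x + \<phi>0 (Y x) * wderiv a b Y x) / (2 * dt)) \<phi>
      = L2_inner a b (\<lambda>x. 1 * ?f x + (1 / (2 * dt)) * ?q x) \<phi>"
    by (rule L2_inner_cong_AE[OF m' _ m(1) m(1) ae]) (use m in auto)
  also have "\<dots> = (3 * L2_inner a b \<phi> \<phi> - 4 * L2_inner a b ?p \<phi> + L2_inner a b ?q \<phi>) / (2 * dt)"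
    by (simp only: L2_inner_lincomb[OF bf \<gamma>'(1) bm] L2_inner_lincomb[OF bm \<gamma>(1) bm])
      (simp add: diff_divide_distrib add_divide_distrib)
  finally have "(3 * L2_inner a b \<phi> \<phi> - 4 * L2_inner a b ?p \<phi> + L2_inner a b ?q \<phi>) / (2 * dt) + \<nu> * ?G = r"
    using eq by simp
  moreover have "(2 / dt) * (L2_inner a b ?p \<phi> - L2_inner a b \<phi>1 \<phi>)
      \<le> \<nu> / 8 * ?G + 16 * ?K\<^sup>2 / \<nu> * L2_inner a b \<phi>1 \<phi>1"
  proof -
    have "(2 / dt) * (L2_inner a b ?p \<phi> - L2_inner a b \<phi>1 \<phi>) \<le> (2 / dt) * ((\<nu> * dt / 16) * ?G
        + (dt * ?K)\<^sup>2 / (2 * (\<nu> * dt / 16)) * L2_inner a b \<phi>1 \<phi>1)"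
      using \<gamma>(4) dt by (intro mult_left_mono) auto
    also have "\<dots> = \<nu> / 8 * ?G + 16 * ?K\<^sup>2 / \<nu> * L2_inner a b \<phi>1 \<phi>1"
      unfolding power_mult_distrib[of dt] power2_eq_square[of dt] using dt \<nu> by (simp add: distrib_left)
    finally show ?thesis .
  qed
  moreover have "(1 / (2 * dt)) * (L2_inner a b \<phi>0 \<phi> - L2_inner a b ?q \<phi>)
      \<le> \<nu> / 8 * ?G + 4 * ?K\<^sup>2 / \<nu> * L2_inner a b \<phi>0 \<phi>0"
  proof -
    have "(1 / (2 * dt)) * (L2_inner a b \<phi>0 \<phi> - L2_inner a b ?q \<phi>) \<le> (1 / (2 * dt)) * ((\<nu> * dt / 4) * ?G
        + (2 * dt * ?K)\<^sup>2 / (2 * (\<nu> * dt / 4)) * L2_inner a b \<phi>0 \<phi>0)"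
      using \<gamma>'(4) dt by (intro mult_left_mono) auto
    also have "\<dots> = \<nu> / 8 * ?G + 4 * ?K\<^sup>2 / \<nu> * L2_inner a b \<phi>0 \<phi>0"
      unfolding power_mult_distrib power2_eq_square[of dt] using dt \<nu> by (simp add: distrib_left)
    finally show ?thesis .
  qed
  moreover have "4 * ?K\<^sup>2 / \<nu> * L2_inner a b \<phi>0 \<phi>0 \<le> 16 * ?K\<^sup>2 / \<nu> * L2_inner a b \<phi>0 \<phi>0"
    using \<nu> by (intro mult_right_mono divide_right_mono L2_inner_self_nonneg) auto
  moreover have "(3 * L2_inner a b \<phi> \<phi> - 4 * L2_inner a b \<phi>1 \<phi> + L2_inner a b \<phi>0 \<phi>) / (2 * dt)
    = (3 * L2_inner a b \<phi> \<phi> - 4 * L2_inner a b ?p \<phi> + L2_inner a b ?q \<phi>) / (2 * dt)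
      + (2 / dt) * (L2_inner a b ?p \<phi> - L2_inner a b \<phi>1 \<phi>)
      + (1 / (2 * dt)) * (L2_inner a b \<phi>0 \<phi> - L2_inner a b ?q \<phi>)"
    using dt by (simp add: field_simps)
  ultimately show ?thesis unfolding distrib_left by linarith
qed

section \<open>Assembly of the stability estimate\<close>

lemma real_num_steps_le:
  assumes "0 < dt" "0 < T" "n \<le> num_steps T dt"
  shows "real n * dt \<le> T"
proof -
  have "real n \<le> real (num_steps T dt)" using assms by simp
  also have "\<dots> \<le> T / dt" using assms by (simp add: num_steps_def)
  finally show ?thesis using assms by (simp add: field_simps)
qed

text \<open>Reduction to the scalar recursion. \<open>Q\<close> is built from \<open>T\<close>,
  \<open>\<nu>\<close> and \<open>c\<close> alone, hence it is independent of the mesh, the time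
  step and the solution.\<close>

lemma numerical_solution_energy_bound:
  fixes a b T \<nu> dt :: real and u :: "real \<Rightarrow> real \<Rightarrow> real" and \<phi> :: "nat \<Rightarrow> real \<Rightarrow> real"
  assumes ab: "a < b" and T: "T > 0" and \<nu>: "\<nu> > 0" and u: "u \<in> C_W01inf a b T"
    and F: "F \<in> H1_time_dual a b T" and dt: "dt > 0"
    and cfl: "dt * C_W1inf_seminorm a b T u \<le> 1 / 8"
    and mesh: "moving_mesh a b (num_steps T dt) Np P"
    and sol: "is_numerical_solution a b T \<nu> u F dt Np P \<phi>" and N1: "1 \<le> num_steps T dt"
  defines "N \<equiv> num_steps T dt"
  defines "c \<equiv> 16 * (C_W1inf_seminorm a b T u * (b - a))\<^sup>2 / \<nu>"
  defines "\<epsilon> \<equiv> min (\<nu> / 2) (1 / (6 * T))"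
  defines "Q \<equiv> 2 * (3 + 3 / \<epsilon>) * exp ((24 * c + 6 * \<epsilon>) * T)"
  shows "\<And>n. 1 \<le> n \<Longrightarrow> n \<le> N \<Longrightarrow>
      (L2_norm a b (\<phi> n))\<^sup>2 \<le> Q * ((L2_norm a b (\<phi> 0))\<^sup>2 + (l2_dual_norm a b dt N Np P F)\<^sup>2)"
    and "\<nu> * (l2_L2_norm a b dt N (\<lambda>n. wderiv a b (\<phi> n)))\<^sup>2
      \<le> Q * ((L2_norm a b (\<phi> 0))\<^sup>2 + (l2_dual_norm a b dt N Np P F)\<^sup>2)"
proof -
  let ?M = "C_W1inf_seminorm a b T u"
  note N1 = N1[folded N_def]
  have tN: "real n * dt \<in> {0..T}" if "n \<le> N" for n
    using real_num_steps_le[OF dt T] that dt by (simp add: N_def)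
  have uW: "u (real n * dt) \<in> W01inf_space a b" if "n \<le> N" for n
    using u tN[OF that] by (auto simp: C_W01inf_def)
  have uM: "Linf_norm a b (wderiv a b (u (real n * dt))) \<le> ?M" if "n \<le> N" for n
    by (rule Linf_norm_wderiv_le_seminorm[OF ab u tN[OF that]])
  have FD: "F (real n * dt) \<in> H1_dual a b" if "n \<le> N" for n
    using F tN[OF that] by (auto simp: H1_time_dual_def)
  have \<phi>V: "\<phi> n \<in> fe_space a b Np (P n)" if "n \<le> N" for n
    using sol that by (auto simp: is_numerical_solution_def N_def)
  have prim: "\<exists>\<sigma>. primitive_on a b v \<sigma>" if "n \<le> N" "v \<in> fe_space a b Np (P n)" for n v
  proof -
    have "1 \<le> Np" "P n 1 = a" "P n Np = b" "\<And>i. i \<in> {1..<Np} \<Longrightarrow> P n i < P n (i + 1)"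
      using mesh that(1) by (auto simp: moving_mesh_def N_def)
    from fe_space_primitive_on[OF this that(2)] show ?thesis by blast
  qed
  then have "\<forall>n. \<exists>\<sigma>. n \<le> N \<longrightarrow> primitive_on a b (\<phi> n) \<sigma>" using \<phi>V by blast
  then obtain \<sigma> where \<sigma>: "\<And>n. n \<le> N \<Longrightarrow> primitive_on a b (\<phi> n) (\<sigma> n)"
    by metis
  have c\<phi>: "continuous_on {a..b} (\<phi> n)" if "n \<le> N" for n
    by (rule primitive_on_continuous[OF \<sigma>[OF that]])
  have bm: "bdd_meas a b (\<phi> n)" if "n \<le> N" for n
    by (rule primitive_on_bdd[OF \<sigma>[OF that]])
  have VH: "fe_space a b Np (P n) \<subseteq> H1_space a b" if "n \<le> N" for n
    using prim[OF that] primitive_on_H1(1)[OF ab] by blast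
  have wd: "L2_inner a b (wderiv a b (\<phi> n)) (wderiv a b (\<phi> n)) = L2_inner a b (\<sigma> n) (\<sigma> n)" if "n \<le> N" for n
    using primitive_on_wderiv_L2[OF ab \<sigma>[OF that] \<sigma>[OF that]] .
  define A where "A = (\<lambda>n. L2_inner a b (\<phi> n) (\<phi> n))"
  define G where "G = (\<lambda>n. L2_inner a b (\<sigma> n) (\<sigma> n))"
  define B where "B = (\<lambda>n. L2_inner a b (\<phi> (n - 1)) (\<phi> n))"
  define C where "C = (\<lambda>n. L2_inner a b (\<phi> (n - 2)) (\<phi> n))"
  define D where "D = (\<lambda>n. dual_norm a b (fe_space a b Np (P n)) (F (real n * dt)))"
  \<comment> \<open>Since \<open>\<phi> n\<close> belongs to the finite element space of its own
    level, the dual norm over that space suffices.\<close>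
  have FD_le: "F (real n * dt) (\<phi> n) \<le> D n * sqrt (A n + G n)" if "n \<le> N" for n
    using abs_le_dual_norm[OF ab FD[OF that] \<phi>V[OF that] \<sigma>[OF that] VH[OF that] fe_space_scale[OF \<phi>V[OF that]]]
    by (simp add: D_def A_def G_def)
  have up: "upwind u dt n x = x - dt * u (real n * dt) x" "upwind2 u dt n x = x - 2 * dt * u (real n * dt) x" for n x
    by (simp_all add: upwind_def upwind2_def)
  have cfl': "dt * ?M \<le> 1" "2 * dt * ?M \<le> 1" using cfl by auto
  have first: "(A 1 - B 1) / dt + \<nu> * G 1 \<le> D 1 * sqrt (A 1 + G 1) + \<nu> / 4 * G 1 + c * A 0"
  proof -
    have "L2_inner a b (\<lambda>x. (\<phi> 1 x - \<phi> 0 (upwind u dt 1 x) * wderiv a b (upwind u dt 1) x) / dt) (\<phi> 1)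
      + \<nu> * L2_inner a b (\<sigma> 1) (\<sigma> 1) = F (real 1 * dt) (\<phi> 1)"
    proof -
      have "\<forall>\<psi>\<in>fe_space a b Np (P 1).
          L2_inner a b (\<lambda>x. (\<phi> 1 x - \<phi> 0 (upwind u dt 1 x) * jacobian a b u dt 1 x) / dt) \<psi>
            + \<nu> * L2_inner a b (wderiv a b (\<phi> 1)) (wderiv a b \<psi>) = F dt \<psi>"
        using sol N1 unfolding is_numerical_solution_def N_def by blast
      from bspec[OF this \<phi>V[OF N1]] show ?thesis by (simp add: jacobian_def wd[OF N1, simplified])
    qed
    from first_step_energy[where u=u and t="real 1 * dt", OF ab uW[OF N1] uM[OF N1] dt cfl'(1) \<nu> up(1)
        c\<phi>[OF le0] \<sigma>[OF N1] this]
    show ?thesis using FD_le[OF N1] by (simp add: A_def B_def G_def c_def)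
  qed
  have later: "(3 * A n - 4 * B n + C n) / (2 * dt) + \<nu> * G n
      \<le> D n * sqrt (A n + G n) + \<nu> / 4 * G n + c * (A (n - 1) + A (n - 2))" if n: "2 \<le> n" "n \<le> N" for n
  proof -
    have n': "n - 1 \<le> N" "n - 2 \<le> N" using n by auto
    have "L2_inner a b (\<lambda>x. (3 * \<phi> n x - 4 * \<phi> (n - 1) (upwind u dt n x) * wderiv a b (upwind u dt n) x
        + \<phi> (n - 2) (upwind2 u dt n x) * wderiv a b (upwind2 u dt n) x) / (2 * dt)) (\<phi> n)
      + \<nu> * L2_inner a b (\<sigma> n) (\<sigma> n) = F (real n * dt) (\<phi> n)"
    proof -
      have "\<forall>n\<in>{2..N}. \<forall>\<psi>\<in>fe_space a b Np (P n).
          L2_inner a b (\<lambda>x. (3 * \<phi> n x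
                - 4 * \<phi> (n - 1) (upwind u dt n x) * jacobian a b u dt n x
                + \<phi> (n - 2) (upwind2 u dt n x) * jacobian2 a b u dt n x) / (2 * dt)) \<psi>
            + \<nu> * L2_inner a b (wderiv a b (\<phi> n)) (wderiv a b \<psi>)
          = F (real n * dt) \<psi>"
        using sol unfolding is_numerical_solution_def N_def by blast
      moreover have "n \<in> {2..N}" using n by simp
      ultimately show ?thesis using \<phi>V[OF n(2)] unfolding jacobian_def jacobian2_def wd[OF n(2), symmetric] by blast
    qed
    from later_step_energy[where u=u and t="real n * dt", OF ab uW[OF n(2)] uM[OF n(2)] dt cfl'(2) \<nu> up(1,2)
        c\<phi>[OF n'(1)] c\<phi>[OF n'(2)] \<sigma>[OF n(2)] this]
    show ?thesis using FD_le[OF n(2)] by (simp add: A_def B_def C_def G_def c_def)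
  qed
  have E_ge: "0 \<le> 4 * A n - 4 * B n + A (n - 1)" if n: "1 \<le> n" "n \<le> N" for n
    using L2_inner_lincomb3_self_nonneg[of a b "\<phi> n" "\<phi> (n - 1)" "\<phi> n" 2 "-1" 0] bm n
    by (simp add: A_def B_def L2_inner_commute[of a b "\<phi> n" "\<phi> (n - Suc 0)"])
  have start: "0 \<le> A 1 - 2 * B 1 + A 0"
    using L2_inner_lincomb3_self_nonneg[of a b "\<phi> 1" "\<phi> 0" "\<phi> 1" 1 "-1" 0] bm N1
    by (simp add: A_def B_def L2_inner_commute[of a b "\<phi> (Suc 0)" "\<phi> 0"])
  have E_diff: "(5 * A n - 4 * B n + A (n - 1)) - (5 * A (n - 1) - 4 * B (n - 1) + A (n - 2))
      \<le> 2 * (3 * A n - 4 * B n + C n)" if n: "2 \<le> n" "n \<le> N" for n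
  proof -
    have n2: "n - 1 - 1 = n - 2" and nN: "n - 1 \<le> N" "n - 2 \<le> N" using n by auto
    \<comment> \<open>The squared norm of the second difference of \<open>\<phi>\<close>, which is
      exactly the gap between the two sides of the claim.\<close>
    have "0 \<le> A n + 4 * A (n - 1) + A (n - 2) - 4 * B n + 2 * C n - 4 * B (n - 1)"
      using L2_inner_lincomb3_self_nonneg[OF bm[OF n(2)] bm[OF nN(1)] bm[OF nN(2)], of 1 "-2" 1]
      unfolding A_def B_def C_def n2 L2_inner_commute[of a b "\<phi> n" "\<phi> (n - 1)"]
        L2_inner_commute[of a b "\<phi> n" "\<phi> (n - 2)"] L2_inner_commute[of a b "\<phi> (n - 1)" "\<phi> (n - 2)"]
      by simp
    then show ?thesis by simp
  qed
  have c0: "0 \<le> c" using \<nu> by (simp add: c_def)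
  have NT: "real N * dt \<le> T" using tN[of N] by simp
  have A0: "0 \<le> A n" and G0: "0 \<le> G n" if "n \<le> N" for n by (simp_all add: A_def G_def L2_inner_self_nonneg)
  have bound1: "A n \<le> Q * (A 0 + dt * (\<Sum>n=1..N. (D n)\<^sup>2))" if "1 \<le> n" "n \<le> N" for n
    unfolding Q_def \<epsilon>_def
    by (rule bdf2_energy_bound(1)[where G=G and B=B and C=C])
      (fact T \<nu> c0 dt NT N1 A0 G0 first later E_ge E_diff start that)+
  have bound2: "\<nu> * (dt * (\<Sum>n=1..N. G n)) \<le> Q * (A 0 + dt * (\<Sum>n=1..N. (D n)\<^sup>2))"
    unfolding Q_def \<epsilon>_def
    by (rule bdf2_energy_bound(2)[where G=G and B=B and C=C])
      (fact T \<nu> c0 dt NT N1 A0 G0 first later E_ge E_diff start)+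
  have S: "(l2_dual_norm a b dt N Np P F)\<^sup>2 = dt * (\<Sum>n=1..N. (D n)\<^sup>2)"
    unfolding l2_dual_norm_def D_def using dt by (intro real_sqrt_pow2 mult_nonneg_nonneg sum_nonneg) auto
  show "(L2_norm a b (\<phi> n))\<^sup>2 \<le> Q * ((L2_norm a b (\<phi> 0))\<^sup>2 + (l2_dual_norm a b dt N Np P F)\<^sup>2)"
    if "1 \<le> n" "n \<le> N" for n
    using bound1[OF that] by (simp add: S L2_norm_power2 A_def)
  have "(l2_L2_norm a b dt N (\<lambda>n. wderiv a b (\<phi> n)))\<^sup>2 = dt * (\<Sum>n=1..N. (L2_norm a b (wderiv a b (\<phi> n)))\<^sup>2)"
    unfolding l2_L2_norm_def using dt by (intro real_sqrt_pow2 mult_nonneg_nonneg sum_nonneg) auto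
  also have "\<dots> = dt * (\<Sum>n=1..N. G n)"
    by (simp add: L2_norm_power2 wd G_def)
  finally show "\<nu> * (l2_L2_norm a b dt N (\<lambda>n. wderiv a b (\<phi> n)))\<^sup>2
      \<le> Q * ((L2_norm a b (\<phi> 0))\<^sup>2 + (l2_dual_norm a b dt N Np P F)\<^sup>2)"
    using bound2 by (simp add: S L2_norm_power2 A_def)
qed

theorem corollary5:
  fixes a b T \<nu> :: real and u :: "real \<Rightarrow> real \<Rightarrow> real"
  assumes "a < b" and "T > 0" and "\<nu> > 0"
    and "u \<in> C_W01inf a b T"
  shows "\<exists>C>0. \<forall>(f :: real \<Rightarrow> real \<Rightarrow> real) (g :: real \<Rightarrow> real \<Rightarrow> real)
            (F :: real \<Rightarrow> (real \<Rightarrow> real) \<Rightarrow> real)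
            (dt :: real) (Np :: nat) (P :: nat \<Rightarrow> nat \<Rightarrow> real) (\<phi> :: nat \<Rightarrow> real \<Rightarrow> real).
      (\<forall>t\<in>{0<..<T}. f t \<in> L2_space a b) \<longrightarrow>
      (\<forall>t\<in>{0<..<T}. \<forall>\<psi>\<in>H1_space a b. F t \<psi> = load_functional a b (f t) (g t) \<psi>) \<longrightarrow>
      F \<in> H1_time_dual a b T \<longrightarrow>
      dt > 0 \<longrightarrow>
      dt * C_W1inf_seminorm a b T u \<le> 1 / 8 \<longrightarrow>
      moving_mesh a b (num_steps T dt) Np P \<longrightarrow>
      is_numerical_solution a b T \<nu> u F dt Np P \<phi> \<longrightarrow>
      linf_L2_norm a b (num_steps T dt) \<phi>
        + sqrt \<nu> * l2_L2_norm a b dt (num_steps T dt) (\<lambda>n. wderiv a b (\<phi> n))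
      \<le> C * (L2_norm a b (\<phi> 0) + l2_dual_norm a b dt (num_steps T dt) Np P F)"
proof -
  \<comment> \<open>All constants are fixed before the force, the time step, the mesh and the
    solution are introduced.\<close>
  define c where "c = 16 * (C_W1inf_seminorm a b T u * (b - a))\<^sup>2 / \<nu>"
  define \<epsilon> where "\<epsilon> = min (\<nu> / 2) (1 / (6 * T))"
  define Q where "Q = 2 * (3 + 3 / \<epsilon>) * exp ((24 * c + 6 * \<epsilon>) * T)"
  have "\<epsilon> > 0" using assms(2,3) by (simp add: \<epsilon>_def)
  then have Q: "Q > 0" unfolding Q_def by (intro mult_pos_pos add_pos_pos) auto
  have est: "linf_L2_norm a b (num_steps T dt) \<phi>
        + sqrt \<nu> * l2_L2_norm a b dt (num_steps T dt) (\<lambda>n. wderiv a b (\<phi> n))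
      \<le> (2 * sqrt Q) * (L2_norm a b (\<phi> 0) + l2_dual_norm a b dt (num_steps T dt) Np P F)"
    if F: "F \<in> H1_time_dual a b T" and dt: "dt > 0" and cfl: "dt * C_W1inf_seminorm a b T u \<le> 1 / 8"
      and mesh: "moving_mesh a b (num_steps T dt) Np P" and sol: "is_numerical_solution a b T \<nu> u F dt Np P \<phi>"
    for F :: "real \<Rightarrow> (real \<Rightarrow> real) \<Rightarrow> real" and dt Np P \<phi>
  proof -
    let ?N = "num_steps T dt"
    let ?x = "L2_norm a b (\<phi> 0)" and ?y = "l2_dual_norm a b dt ?N Np P F"
    have x: "0 \<le> ?x" by (simp add: L2_norm_def L2_inner_self_nonneg)
    have y: "0 \<le> ?y" unfolding l2_dual_norm_def using dt
      by (intro real_sqrt_ge_zero mult_nonneg_nonneg sum_nonneg) auto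
    have rhs: "0 \<le> sqrt Q * (?x + ?y)" using Q x y by simp
    \<comment> \<open>Each of the two squared bounds becomes linear in the data because
      \<open>?x\<close> and \<open>?y\<close> are nonnegative; adding them gives the constant
      \<open>2 * sqrt Q\<close>.\<close>
    have root: "z \<le> sqrt Q * (?x + ?y)" if "z\<^sup>2 \<le> Q * (?x\<^sup>2 + ?y\<^sup>2)" for z
    proof -
      have "Q * (?x\<^sup>2 + ?y\<^sup>2) \<le> Q * (?x + ?y)\<^sup>2"
        using Q x y by (intro mult_left_mono) (auto simp: power2_sum)
      also have "\<dots> = (sqrt Q * (?x + ?y))\<^sup>2" using Q by (simp add: power_mult_distrib)
      finally have "z\<^sup>2 \<le> (sqrt Q * (?x + ?y))\<^sup>2" using that by simp
      then show ?thesis by (rule power2_le_imp_le[OF _ rhs])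
    qed
    show ?thesis
    proof (cases "?N = 0")
      \<comment> \<open>Here \<open>dt > T\<close>: no step is taken, and both norms on the left are
        0, by the inserted 0 and by the empty sum.\<close>
      case True
      then show ?thesis using rhs by (simp add: linf_L2_norm_def l2_L2_norm_def mult.assoc)
    next
      case False
      then have N1: "1 \<le> ?N" by simp
      note bound = numerical_solution_energy_bound[OF assms(1-4) F dt cfl mesh sol N1,
          folded c_def \<epsilon>_def, folded Q_def]
      have "linf_L2_norm a b ?N \<phi> \<le> sqrt Q * (?x + ?y)"
        unfolding linf_L2_norm_def using rhs bound(1) by (auto intro!: root)
      moreover have "sqrt \<nu> * l2_L2_norm a b dt ?N (\<lambda>n. wderiv a b (\<phi> n)) \<le> sqrt Q * (?x + ?y)"
        using bound(2) assms(3) by (intro root) (simp add: power_mult_distrib)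
      ultimately show ?thesis by simp
    qed
  qed
  show ?thesis
    by (intro exI[of _ "2 * sqrt Q"] conjI allI impI est) (use Q in auto)
qed

end
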